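(* Let $p$ be a real polynomial on $\mathbb{C}^n$, weighted homogeneous of weight 1 and containing no purely holomorphic or purely antiholomorphic monomials, such that $\{z: p(z,\bar z)=0\}$ contains no complex submanifold of positive dimension, and such that both $p^{(0)}$ and $(p^2)^{(0)}$ satisfy condition (N). If there is a nonzero tangential holomorphic vector field $Q$ for the domain $\{(w,z): v+p(z,\bar z)<0\}$ with $\mathrm{wt}\,Q>0$, then $p$ is balanced.
   Context: Coordinates $(w,z)=(z_0,z_1,\dots,z_n)$, $w=u+iv$. Weights: $\delta_0=1$ for $w$, $\delta_j=1/(2m_j)$ ($m_j$ positive integers) for $z_j$; $\mathrm{wt}(z^J)=\sum_k j_k\delta_k$, $\mathrm{wt}(z^J\bar z^K)=\mathrm{wt}\,J+\mathrm{wt}\,K$; homogeneous of weight $\mu$ means all monomials have weight $\mu$. The signature of a monomial $z^A\bar z^B$ is $\mathrm{wt}\,A-\mathrm{wt}\,B$; for a polynomial $\varphi$ in $z,\bar z$, $\varphi^{(\nu)}$ denotes the sum of its monomials of signature $\nu$, and $\varphi$ is balanced if $\varphi=\varphi^{(0)}$. Condition (N) for a polynomial $\varphi(z,\bar z)$: there is no nonzero holomorphic vector field $R=\sum_{j=1}^n r_j(z)\partial/\partial z_j$ on $\mathbb{C}^n$ with $R\varphi=0$ ($R$ differentiates only in $z$). A holomorphic vector field $Q=\sum_{k=0}^nQ_k\partial/\partial z_k$ on a domain $D$ is tangential if its coefficients extend smoothly to $\bar D$ and $\mathrm{Re}\,Q$ is tangent to $\partial D$. The weight of $z^J\partial/\partial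 z_k$ is $\mathrm{wt}(J)-\delta_k$, and $\mathrm{wt}\,Q$ is the smallest weight of a nonzero homogeneous term in the Taylor expansion of $Q$ at $0$. *)

theory Defs
  imports "HOL-Analysis.Analysis"
begin

text \<open>Multi-indices on z = (z_1,...,z_n) are functions 'n => nat; m j is the
  positive integer m_j, so delta_j = 1/(2 m_j).\<close>

definition wt :: "('n::finite \<Rightarrow> nat) \<Rightarrow> ('n \<Rightarrow> nat) \<Rightarrow> real" where
  "wt m A = (\<Sum>i\<in>UNIV. real (A i) / (2 * real (m i)))"

text \<open>c A B is the coefficient of z^A conj(z)^B.\<close>

definition zmono :: "('n::finite \<Rightarrow> nat) \<Rightarrow> complex^'n \<Rightarrow> complex" where
  "zmono A z = (\<Prod>i\<in>UNIV. (z $ i) ^ A i)"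

definition cnjv :: "complex^'n \<Rightarrow> complex^'n" where
  "cnjv z = (\<chi> i. cnj (z $ i))"

definition is_poly :: "(('n::finite \<Rightarrow> nat) \<Rightarrow> ('n \<Rightarrow> nat) \<Rightarrow> complex) \<Rightarrow> bool" where
  "is_poly c \<longleftrightarrow> finite {(A, B). c A B \<noteq> 0}"

definition peval :: "(('n::finite \<Rightarrow> nat) \<Rightarrow> ('n \<Rightarrow> nat) \<Rightarrow> complex) \<Rightarrow> complex^'n \<Rightarrow> complex" where
  "peval c z = (\<Sum>(A, B)\<in>{(A, B). c A B \<noteq> 0}. c A B * zmono A z * zmono B (cnjv z))"

text \<open>Real polynomial: hermitian coefficients (equivalently, real-valued).\<close>
definition real_poly :: "(('n::finite \<Rightarrow> nat) \<Rightarrow> ('n \<Rightarrow> nat) \<Rightarrow> complex) \<Rightarrow> bool" where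
  "real_poly c \<longleftrightarrow> is_poly c \<and> (\<forall>A B. c B A = cnj (c A B))"

definition weighted_homogeneous ::
  "('n::finite \<Rightarrow> nat) \<Rightarrow> real \<Rightarrow> (('n \<Rightarrow> nat) \<Rightarrow> ('n \<Rightarrow> nat) \<Rightarrow> complex) \<Rightarrow> bool" where
  "weighted_homogeneous m \<mu> c \<longleftrightarrow> (\<forall>A B. c A B \<noteq> 0 \<longrightarrow> wt m A + wt m B = \<mu>)"

definition no_pure_terms :: "(('n::finite \<Rightarrow> nat) \<Rightarrow> ('n \<Rightarrow> nat) \<Rightarrow> complex) \<Rightarrow> bool" where
  "no_pure_terms c \<longleftrightarrow> (\<forall>A. c A (\<lambda>_. 0) = 0 \<and> c (\<lambda>_. 0) A = 0)"

definition pmult ::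
  "(('n::finite \<Rightarrow> nat) \<Rightarrow> ('n \<Rightarrow> nat) \<Rightarrow> complex) \<Rightarrow> (('n \<Rightarrow> nat) \<Rightarrow> ('n \<Rightarrow> nat) \<Rightarrow> complex)
    \<Rightarrow> ('n \<Rightarrow> nat) \<Rightarrow> ('n \<Rightarrow> nat) \<Rightarrow> complex" where
  "pmult c d A B =
     (\<Sum>A1\<in>{A1. \<forall>i. A1 i \<le> A i}. \<Sum>B1\<in>{B1. \<forall>i. B1 i \<le> B i}.
        c A1 B1 * d (\<lambda>i. A i - A1 i) (\<lambda>i. B i - B1 i))"

definition sig_part ::
  "('n::finite \<Rightarrow> nat) \<Rightarrow> real \<Rightarrow> (('n \<Rightarrow> nat) \<Rightarrow> ('n \<Rightarrow> nat) \<Rightarrow> complex)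
    \<Rightarrow> ('n \<Rightarrow> nat) \<Rightarrow> ('n \<Rightarrow> nat) \<Rightarrow> complex" where
  "sig_part m \<nu> c A B = (if wt m A - wt m B = \<nu> then c A B else 0)"

definition balanced ::
  "('n::finite \<Rightarrow> nat) \<Rightarrow> (('n \<Rightarrow> nat) \<Rightarrow> ('n \<Rightarrow> nat) \<Rightarrow> complex) \<Rightarrow> bool" where
  "balanced m c \<longleftrightarrow> c = sig_part m 0 c"

definition dz ::
  "'n \<Rightarrow> (('n::finite \<Rightarrow> nat) \<Rightarrow> ('n \<Rightarrow> nat) \<Rightarrow> complex) \<Rightarrow> ('n \<Rightarrow> nat) \<Rightarrow> ('n \<Rightarrow> nat) \<Rightarrow> complex" where
  "dz j c A B = of_nat (A j + 1) * c (A(j := A j + 1)) B"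

definition holo_vec_on :: "(complex^'n) set \<Rightarrow> (complex^'n \<Rightarrow> complex) \<Rightarrow> bool" where
  "holo_vec_on S f \<longleftrightarrow> (\<forall>x\<in>S. \<exists>L. (f has_derivative L) (at x) \<and> (\<forall>c v. L (c *s v) = c * L v))"

definition csmul :: "complex \<Rightarrow> complex \<times> (complex^'n) \<Rightarrow> complex \<times> (complex^'n)" where
  "csmul c \<zeta> = (c * fst \<zeta>, c *s snd \<zeta>)"

definition holo_on :: "(complex \<times> (complex^'n)) set \<Rightarrow> (complex \<times> (complex^'n) \<Rightarrow> complex) \<Rightarrow> bool" where
  "holo_on S f \<longleftrightarrow> (\<forall>x\<in>S. \<exists>L. (f has_derivative L) (at x) \<and> (\<forall>c v. L (csmul c v) = c * L v))"

definition condN ::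
  "(('n::finite \<Rightarrow> nat) \<Rightarrow> ('n \<Rightarrow> nat) \<Rightarrow> complex) \<Rightarrow> bool" where
  "condN c \<longleftrightarrow> \<not> (\<exists>r :: 'n \<Rightarrow> complex^'n \<Rightarrow> complex.
      (\<forall>j. holo_vec_on UNIV (r j)) \<and> (\<exists>j z. r j z \<noteq> 0) \<and>
      (\<forall>z. (\<Sum>j\<in>UNIV. r j z * peval (dz j c) z) = 0))"

definition biholo :: "(complex^'n) set \<Rightarrow> (complex^'n) set \<Rightarrow> (complex^'n \<Rightarrow> complex^'n) \<Rightarrow> bool" where
  "biholo U V \<psi> \<longleftrightarrow> (\<forall>i. holo_vec_on U (\<lambda>x. \<psi> x $ i)) \<and> inj_on \<psi> U \<and> \<psi> ` U = V \<and>
     (\<forall>i. holo_vec_on V (\<lambda>y. inv_into U \<psi> y $ i))"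

definition pos_dim_complex_submanifold :: "(complex^'n::finite) set \<Rightarrow> bool" where
  "pos_dim_complex_submanifold M \<longleftrightarrow> M \<noteq> {} \<and>
     (\<forall>a\<in>M. \<exists>U V \<psi> I. open U \<and> a \<in> U \<and> open V \<and> biholo U V \<psi> \<and> I \<noteq> {} \<and>
        \<psi> ` (M \<inter> U) = V \<inter> {x. \<forall>i. i \<notin> I \<longrightarrow> x $ i = 0})"

fun Ck_on :: "nat \<Rightarrow> 'a::real_normed_vector set \<Rightarrow> ('a \<Rightarrow> 'b::real_normed_vector) \<Rightarrow> bool" where
  "Ck_on 0 U f = continuous_on U f"
| "Ck_on (Suc k) U f = (f differentiable_on U \<and>
      (\<forall>v. Ck_on k U (\<lambda>x. frechet_derivative f (at x) v)))"

definition smooth_on :: "'a::real_normed_vector set \<Rightarrow> ('a \<Rightarrow> 'b::real_normed_vector) \<Rightarrow> bool" where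
  "smooth_on U f \<longleftrightarrow> open U \<and> (\<forall>k. Ck_on k U f)"

definition smooth_to_closure ::
  "'a::real_normed_vector set \<Rightarrow> ('a \<Rightarrow> 'b::real_normed_vector) \<Rightarrow> bool" where
  "smooth_to_closure D f \<longleftrightarrow> (\<exists>U G. closure D \<subseteq> U \<and> smooth_on U G \<and> (\<forall>x\<in>closure D. G x = f x))"

definition model_domain ::
  "(('n::finite \<Rightarrow> nat) \<Rightarrow> ('n \<Rightarrow> nat) \<Rightarrow> complex) \<Rightarrow> (complex \<times> (complex^'n)) set" where
  "model_domain c = {(w, z). Im w + Re (peval c z) < 0}"

definition comp :: "(complex \<times> (complex^'n) \<Rightarrow> complex \<times> (complex^'n)) \<Rightarrow> 'n option
     \<Rightarrow> complex \<times> (complex^'n) \<Rightarrow> complex" where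
  "comp Q k \<zeta> = (case k of None \<Rightarrow> fst (Q \<zeta>) | Some j \<Rightarrow> snd (Q \<zeta>) $ j)"

text \<open>Q is tangential for D: holomorphic on D, coefficients extend smoothly to the closure,
  and Re Q (the real vector field with the same components) is tangent to the boundary,
  i.e. lies in the kernel of the differential of the defining function v + p at each
  boundary point.\<close>
definition tangential ::
  "(complex \<times> (complex^'n)) set \<Rightarrow> (complex \<times> (complex^'n) \<Rightarrow> real) \<Rightarrow>
   (complex \<times> (complex^'n) \<Rightarrow> complex \<times> (complex^'n)) \<Rightarrow> bool" where
  "tangential D r Q \<longleftrightarrow> (\<forall>k. holo_on D (comp Q k)) \<and> smooth_to_closure D Q \<and>
     (\<forall>\<zeta>\<in>frontier D. \<forall>L. (r has_derivative L) (at \<zeta>) \<longrightarrow> L (Q \<zeta>) = 0)"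

type_synonym 'n midx = "nat \<times> ('n \<Rightarrow> nat)"

definition wmono :: "'n::finite midx \<Rightarrow> complex \<times> (complex^'n) \<Rightarrow> complex" where
  "wmono J \<zeta> = fst \<zeta> ^ fst J * zmono (snd J) (snd \<zeta>)"

definition wcnj :: "complex \<times> (complex^'n) \<Rightarrow> complex \<times> (complex^'n)" where
  "wcnj \<zeta> = (cnj (fst \<zeta>), cnjv (snd \<zeta>))"

definition mdeg :: "'n::finite midx \<Rightarrow> nat" where
  "mdeg J = fst J + (\<Sum>i\<in>UNIV. snd J i)"

definition mwt :: "('n::finite \<Rightarrow> nat) \<Rightarrow> 'n midx \<Rightarrow> real" where
  "mwt m J = real (fst J) + wt m (snd J)"

definition delta :: "('n \<Rightarrow> nat) \<Rightarrow> 'n option \<Rightarrow> real" where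
  "delta m k = (case k of None \<Rightarrow> 1 | Some j \<Rightarrow> 1 / (2 * real (m j)))"

definition taylor_at0 ::
  "(complex \<times> (complex^'n::finite)) set \<Rightarrow> (complex \<times> (complex^'n) \<Rightarrow> complex \<times> (complex^'n)) \<Rightarrow>
   ('n option \<Rightarrow> 'n midx \<Rightarrow> 'n midx \<Rightarrow> complex) \<Rightarrow> bool" where
  "taylor_at0 D Q a \<longleftrightarrow> (\<forall>k N.
     ((\<lambda>\<zeta>. (comp Q k \<zeta> - (\<Sum>(J, K)\<in>{(J, K). mdeg J + mdeg K \<le> N}.
            a k J K * wmono J \<zeta> * wmono K (wcnj \<zeta>))) / of_real (norm \<zeta> ^ N))
       \<longlongrightarrow> 0) (at 0 within closure D))"

text \<open>wt Q > 0: the Taylor expansion has a nonzero term and every nonzero term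
  zeta^J conj(zeta)^K d/d zeta_k has weight wt J + wt K - delta_k > 0.\<close>
definition wt_pos ::
  "('n::finite \<Rightarrow> nat) \<Rightarrow> (complex \<times> (complex^'n)) set \<Rightarrow> (complex \<times> (complex^'n) \<Rightarrow> complex \<times> (complex^'n)) \<Rightarrow> bool" where
  "wt_pos m D Q \<longleftrightarrow> (\<exists>a. taylor_at0 D Q a \<and> (\<exists>k J K. a k J K \<noteq> 0) \<and>
      (\<forall>k J K. a k J K \<noteq> 0 \<longrightarrow> mwt m J + mwt m K - delta m k > 0))"

end

theory Submission
  imports Defs "HOL-Computational_Algebra.Polynomial" "HOL-Complex_Analysis.Cauchy_Integral_Formula"
begin

text \<open>Rescaling at the origin replaces \<open>Q\<close> by its homogeneous part of lowest weight, a polynomial holomorphic field that is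
  still tangential. Tangential fields are closed under d/dw and under brackets, so one may differentiate in \<open>w\<close> until a field
  \<open>T\<close> independent of \<open>w\<close> is reached; let \<open>l\<close> be its weight.

  If \<open>l > 0\<close>, or \<open>l < 0\<close> and \<open>T\<close> vanishes at 0, then \<open>T\<close> is nilpotent on the components of \<open>p\<close>. Because these have no common
  zero, its orbits stay bounded in finite time and grow polynomially, and a rescaled orbit converges to a nonzero point at
  which every component vanishes, which is impossible. The remaining fields with \<open>-1 < l < 0\<close> lead by brackets either
  to a contradiction or, like \<open>l = 0\<close> and \<open>l = -1\<close>, to a field of weight 1 with nonzero w-derivative. For such a field
  condition (N) for the balanced part of \<open>p\<^sup>2\<close> forces its part linear in \<open>w\<close> to be a multiple of the Euler field, and its
  part independent of \<open>w\<close> again has orbits accumulating at a common zero unless \<open>p\<close> is balanced.\<close>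

section \<open>The ring of polynomial functions\<close>

text \<open>The obstacle is that the hypothesis on the zero set concerns real points (z, cnj z),
  whereas the tangency relation is algebraic and couples the component of holomorphic weight h with
  that of weight h + l. Polarisation separates the two sides: a holomorphic field moves z and leaves
  the conjugate variable frozen as a parameter, so a leading coefficient along an orbit is again a
  polynomial in that parameter. Setting the parameter to the conjugate of the limit point,
  conjugating, and taking the leading coefficient once more expresses the value at the real limit
  point by mixed derivatives D^i Db^j of one component, and these the relation can kill. A
  polynomial field need not be complete. Its orbits are continued for all times because nilpotent
  functions are polynomial in time along them and the components of p are coercive. The square of p
  enters through w: on r = 0 one has w - wb = -2i p, so a term w B' of the field contributes p times
  B' p, which is half of B' applied to p^2.\<close>

inductive_set poly_fun :: "(('v \<Rightarrow> complex) \<Rightarrow> complex) set" where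
  const: "(\<lambda>_. c) \<in> poly_fun"
| coord: "(\<lambda>x. x v) \<in> poly_fun"
| add: "f \<in> poly_fun \<Longrightarrow> g \<in> poly_fun \<Longrightarrow> (\<lambda>x. f x + g x) \<in> poly_fun"
| mult: "f \<in> poly_fun \<Longrightarrow> g \<in> poly_fun \<Longrightarrow> (\<lambda>x. f x * g x) \<in> poly_fun"

text \<open>Polynomials are kept as functions, so that ring identities are checked by evaluation;
  coefficients are recovered by weight projections in \<open>monomial_independent\<close>.\<close>

typedef 'v pol = "poly_fun :: (('v \<Rightarrow> complex) \<Rightarrow> complex) set"
  morphisms ev Abs_pol
  using poly_fun.const by blast

setup_lifting type_definition_pol

lemma pol_eqI: "(\<And>x. ev f x = ev g x) \<Longrightarrow> f = g"
  by (metis ev_inject ext)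

lemma poly_fun_line: "f \<in> poly_fun \<Longrightarrow> \<exists>q::complex poly. \<forall>t. f (\<lambda>v. a v + t * b v) = poly q t"
proof (induction rule: poly_fun.induct)
  case (const c)
  show ?case by (rule exI[of _ "[:c:]"]) simp
next
  case (coord v)
  show ?case by (rule exI[of _ "[:a v, b v:]"]) (simp add: mult.commute)
next
  case (add f g)
  then obtain q r where "\<forall>t. f (\<lambda>v. a v + t * b v) = poly q t" "\<forall>t. g (\<lambda>v. a v + t * b v) = poly r t"
    by blast
  then show ?case by (intro exI[of _ "q + r"]) simp
next
  case (mult f g)
  then obtain q r where "\<forall>t. f (\<lambda>v. a v + t * b v) = poly q t" "\<forall>t. g (\<lambda>v. a v + t * b v) = poly r t"
    by blast
  then show ?case by (intro exI[of _ "q * r"]) simp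
qed

text \<open>Restriction to the complex line through a and b reduces the absence of zero divisors to
  polynomials in one variable.\<close>

lemma poly_fun_mult_zero:
  assumes "f \<in> poly_fun" "g \<in> poly_fun" "\<forall>x. f x * g x = 0" "f a \<noteq> 0"
  shows "g b = 0"
proof -
  define c where "c = (\<lambda>v. b v - a v)"
  obtain q where q: "\<forall>t. f (\<lambda>v. a v + t * c v) = poly q t" using poly_fun_line assms(1) by blast
  obtain r where r: "\<forall>t. g (\<lambda>v. a v + t * c v) = poly r t" using poly_fun_line assms(2) by blast
  have "poly (q * r) t = 0" for t using assms(3) q r by (metis poly_mult)
  then have "q * r = 0" using poly_all_0_iff_0 by blast
  moreover have "poly q 0 \<noteq> 0" using q assms(4) by (auto dest: spec[of _ 0])
  ultimately have "r = 0" by auto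
  then show ?thesis using r by (auto simp: c_def dest: spec[of _ 1])
qed

instantiation pol :: (type) idom
begin

lift_definition zero_pol :: "'a pol" is "\<lambda>_. 0" by (rule poly_fun.const)
lift_definition one_pol :: "'a pol" is "\<lambda>_. 1" by (rule poly_fun.const)
lift_definition plus_pol :: "'a pol \<Rightarrow> 'a pol \<Rightarrow> 'a pol" is "\<lambda>f g x. f x + g x" by (rule poly_fun.add)
lift_definition times_pol :: "'a pol \<Rightarrow> 'a pol \<Rightarrow> 'a pol" is "\<lambda>f g x. f x * g x" by (rule poly_fun.mult)
lift_definition uminus_pol :: "'a pol \<Rightarrow> 'a pol" is "\<lambda>f x. - f x"
  using poly_fun.mult[OF poly_fun.const[of "-1"]] by simp
lift_definition minus_pol :: "'a pol \<Rightarrow> 'a pol \<Rightarrow> 'a pol" is "\<lambda>f g x. f x - g x"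
  using poly_fun.add[OF _ poly_fun.mult[OF poly_fun.const[of "-1"]]] by simp

instance
proof
  fix a b :: "'a pol"
  assume "a \<noteq> 0" "b \<noteq> 0"
  then obtain x y where "ev a x \<noteq> 0" "ev b y \<noteq> 0"
    by (metis pol_eqI zero_pol.rep_eq)
  then show "a * b \<noteq> 0"
    using poly_fun_mult_zero[OF ev ev, of a b x y] by (metis times_pol.rep_eq zero_pol.rep_eq)
next
  show "(0::'a pol) \<noteq> 1"
    by (metis one_pol.rep_eq zero_neq_one zero_pol.rep_eq)
qed (transfer; simp add: algebra_simps fun_eq_iff)+

end

lift_definition cst :: "complex \<Rightarrow> 'v pol" is "\<lambda>c _. c" by (rule poly_fun.const)
lift_definition var :: "'v \<Rightarrow> 'v pol" is "\<lambda>v x. x v" by (rule poly_fun.coord)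

lemma ev_simps [simp]:
  "ev 0 x = 0" "ev 1 x = 1" "ev (f + g) x = ev f x + ev g x" "ev (f * g) x = ev f x * ev g x"
  "ev (- f) x = - ev f x" "ev (f - g) x = ev f x - ev g x" "ev (cst c) x = c" "ev (var v) x = x v"
  by (simp_all add: zero_pol.rep_eq one_pol.rep_eq plus_pol.rep_eq times_pol.rep_eq uminus_pol.rep_eq
      minus_pol.rep_eq cst.rep_eq var.rep_eq)

lemma ev_sum [simp]: "ev (sum f A) x = (\<Sum>a\<in>A. ev (f a) x)"
  by (induction A rule: infinite_finite_induct) auto
lemma ev_prod [simp]: "ev (prod f A) x = (\<Prod>a\<in>A. ev (f a) x)"
  by (induction A rule: infinite_finite_induct) auto
lemma ev_power [simp]: "ev (f ^ n) x = ev f x ^ n"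
  by (induction n) auto
lemma ev_of_nat [simp]: "ev (of_nat n) x = of_nat n"
  by (induction n) auto

lemma cst_hom: "cst 0 = 0" "cst 1 = 1" "cst (a + b) = cst a + cst b" "cst (a * b) = cst a * cst b"
  "cst (- a) = - cst a" "cst (a - b) = cst a - cst b" "cst (of_nat n) = of_nat n"
  by (auto intro: pol_eqI)

lemma cst_eq_iff [simp]: "cst a = cst b \<longleftrightarrow> a = b"
  by (metis cst.rep_eq)

lemma cst_eq_0_iff [simp]: "cst a = 0 \<longleftrightarrow> a = 0"
  by (metis cst_eq_iff cst_hom(1))

lemma pol_induct [case_names cst var add mult]:
  assumes "\<And>c. P (cst c)" "\<And>v. P (var v)"
    "\<And>f g. P f \<Longrightarrow> P g \<Longrightarrow> P (f + g)" "\<And>f g. P f \<Longrightarrow> P g \<Longrightarrow> P (f * g)"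
  shows "P f"
proof -
  have "P (Abs_pol g)" if "g \<in> poly_fun" for g
    using that
  proof (induction rule: poly_fun.induct)
    case (const c)
    then show ?case using assms(1)[of c] by (simp add: cst_def)
  next
    case (coord v)
    then show ?case using assms(2)[of v] by (simp add: var_def)
  next
    case (add f g)
    have "Abs_pol (\<lambda>x. f x + g x) = Abs_pol f + Abs_pol g"
      by (rule pol_eqI) (simp add: Abs_pol_inverse add.hyps poly_fun.add)
    then show ?case using assms(3) add by simp
  next
    case (mult f g)
    have "Abs_pol (\<lambda>x. f x * g x) = Abs_pol f * Abs_pol g"
      by (rule pol_eqI) (simp add: Abs_pol_inverse mult.hyps poly_fun.mult)
    then show ?case using assms(4) mult by simp
  qed
  from this[OF ev[of f]] show ?thesis by (simp add: ev_inverse)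
qed

lemma pol_nonzero_point: "f \<noteq> 0 \<Longrightarrow> \<exists>x. ev f x \<noteq> 0"
  by (metis ev_simps(1) pol_eqI)

section \<open>Partial derivatives and derivations\<close>

lemma poly_fun_deriv:
  "f \<in> poly_fun \<Longrightarrow> \<exists>g\<in>poly_fun. \<forall>x. ((\<lambda>t. f (x(v := t))) has_field_derivative g x) (at (x v))"
proof (induction rule: poly_fun.induct)
  case (const c)
  show ?case by (rule bexI[OF _ poly_fun.const[of 0]]) auto
next
  case (coord w)
  show ?case by (rule bexI[OF _ poly_fun.const[of "if w = v then 1 else 0"]]) (auto intro!: derivative_eq_intros)
next
  case (add f g)
  then obtain f' g' where *: "f' \<in> poly_fun" "g' \<in> poly_fun"
    "\<forall>x. ((\<lambda>t. f (x(v := t))) has_field_derivative f' x) (at (x v))"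
    "\<forall>x. ((\<lambda>t. g (x(v := t))) has_field_derivative g' x) (at (x v))" by blast
  show ?case
    by (rule bexI[OF _ poly_fun.add[OF *(1,2)]]) (intro allI DERIV_add, (use * in blast)+)
next
  case (mult f g)
  then obtain f' g' where *: "f' \<in> poly_fun" "g' \<in> poly_fun"
    "\<And>x. ((\<lambda>t. f (x(v := t))) has_field_derivative f' x) (at (x v))"
    "\<And>x. ((\<lambda>t. g (x(v := t))) has_field_derivative g' x) (at (x v))" by blast
  have "((\<lambda>t. f (x(v := t)) * g (x(v := t))) has_field_derivative f' x * g x + g' x * f x) (at (x v))" for x
    using DERIV_mult[OF *(3,4)[of x]] by simp
  then have "\<forall>x. ((\<lambda>t. f (x(v := t)) * g (x(v := t))) has_field_derivative f' x * g x + g' x * f x) (at (x v))" ..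
  moreover have "(\<lambda>x. f' x * g x + g' x * f x) \<in> poly_fun"
    using * mult.hyps by (intro poly_fun.add poly_fun.mult)
  ultimately show ?case by (intro bexI[where x = "\<lambda>x. f' x * g x + g' x * f x"])
qed

lift_definition pd :: "'v \<Rightarrow> 'v pol \<Rightarrow> 'v pol" is "\<lambda>v f x. deriv (\<lambda>t. f (x(v := t))) (x v)"
proof -
  fix v :: 'v and f :: "('v \<Rightarrow> complex) \<Rightarrow> complex"
  assume "f \<in> poly_fun"
  then obtain g where "g \<in> poly_fun" "\<forall>x. ((\<lambda>t. f (x(v := t))) has_field_derivative g x) (at (x v))"
    using poly_fun_deriv[OF \<open>f \<in> poly_fun\<close>, of v] by blast
  moreover from this have "(\<lambda>x. deriv (\<lambda>t. f (x(v := t))) (x v)) = g"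
    by (auto intro: DERIV_imp_deriv)
  ultimately show "(\<lambda>x. deriv (\<lambda>t. f (x(v := t))) (x v)) \<in> poly_fun" by simp
qed

lemma ev_pd: "((\<lambda>t. ev f (x(v := t))) has_field_derivative ev (pd v f) x) (at (x v))"
  using poly_fun_deriv[OF ev[of f], of v] by (auto simp: pd.rep_eq dest!: spec[of _ x] intro: DERIV_deriv_iff_has_field_derivative[THEN iffD2])

lemma pd_eqI: "(\<And>x. ((\<lambda>t. ev f (x(v := t))) has_field_derivative ev g x) (at (x v))) \<Longrightarrow> pd v f = g"
  by (rule pol_eqI) (metis DERIV_unique ev_pd)

lemma pd_cst [simp]: "pd v (cst c) = 0"
  by (rule pd_eqI) simp
lemma pd_var: "pd v (var w) = (if v = w then 1 else 0)"
  by (rule pd_eqI) (auto intro!: derivative_eq_intros)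
lemma pd_add [simp]: "pd v (f + g) = pd v f + pd v g"
  by (rule pd_eqI) (use ev_pd in \<open>auto intro!: DERIV_add\<close>)
lemma pd_mult: "pd v (f * g) = pd v f * g + f * pd v g"
proof (rule pd_eqI)
  fix x
  show "((\<lambda>t. ev (f * g) (x(v := t))) has_field_derivative ev (pd v f * g + f * pd v g) x) (at (x v))"
    using DERIV_mult[OF ev_pd[of f x v] ev_pd[of g x v]] by (simp add: mult.commute)
qed

definition der :: "('v::finite \<Rightarrow> 'v pol) \<Rightarrow> 'v pol \<Rightarrow> 'v pol" where
  "der A f = (\<Sum>v\<in>UNIV. A v * pd v f)"

lemma der_cst [simp]: "der A (cst c) = 0"
  and der_add [simp]: "der A (f + g) = der A f + der A g"
  and der_mult: "der A (f * g) = der A f * g + f * der A g"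
  by (simp_all add: der_def pd_mult sum.distrib sum_distrib_left sum_distrib_right algebra_simps)

lemma der_var [simp]: "der A (var v) = A v"
proof -
  have "der A (var v) = (\<Sum>w\<in>UNIV. if w = v then A w else 0)"
    unfolding der_def by (rule sum.cong) (auto simp: pd_var)
  then show ?thesis by simp
qed

lemma der_0 [simp]: "der A 0 = 0" and der_1 [simp]: "der A 1 = 0"
  using der_cst[of A 0] der_cst[of A 1] by (simp_all add: cst_hom del: der_cst)

lemma der_uminus [simp]: "der A (- f) = - der A f"
  using der_add[of A f "- f"] by (simp add: eq_neg_iff_add_eq_0 add.commute)
lemma der_diff [simp]: "der A (f - g) = der A f - der A g"
  using der_add[of A f "- g"] by simp
lemma der_sum: "der A (sum f S) = (\<Sum>i\<in>S. der A (f i))"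
  by (induction S rule: infinite_finite_induct) auto
lemma der_cst_mult [simp]: "der A (cst c * f) = cst c * der A f"
  by (simp add: der_mult)

text \<open>Commutator identities for fields are proved this way: both sides are derivations, so
  only the variables need checking.\<close>

lemma derivation_eqI:
  fixes L M :: "'v pol \<Rightarrow> 'v pol"
  assumes "\<And>c. L (cst c) = 0" "\<And>f g. L (f + g) = L f + L g" "\<And>f g. L (f * g) = L f * g + f * L g"
    and "\<And>c. M (cst c) = 0" "\<And>f g. M (f + g) = M f + M g" "\<And>f g. M (f * g) = M f * g + f * M g"
    and "\<And>v. L (var v) = M (var v)"
  shows "L f = M f"
  by (induction f rule: pol_induct) (simp_all add: assms)

lemma pd_eq_der: "pd v = der (\<lambda>w. if w = v then 1 else 0)"
proof
  fix f :: "'a pol"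
  show "pd v f = der (\<lambda>w. if w = v then 1 else 0) f"
    by (rule derivation_eqI) (auto simp: pd_mult der_mult pd_var)
qed

definition brk :: "('v::finite \<Rightarrow> 'v pol) \<Rightarrow> ('v \<Rightarrow> 'v pol) \<Rightarrow> 'v \<Rightarrow> 'v pol" where
  "brk A B v = der A (B v) - der B (A v)"

lemma der_brk: "der (brk A B) f = der A (der B f) - der B (der A f)"
  by (rule derivation_eqI) (auto simp: brk_def der_mult algebra_simps)

lemma der_commute: "(\<And>v. der A (B v) = der B (A v)) \<Longrightarrow> der A (der B f) = der B (der A f)"
  using der_brk[of A B f] by (simp add: brk_def der_def)

lemma pd_commute: "pd v (pd w f) = pd w (pd v (f :: 'v::finite pol))"
  unfolding pd_eq_der by (rule der_commute) auto

lemma ev_chain: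
  fixes f :: "'v::finite pol"
  assumes "\<And>v. ((\<lambda>s. \<gamma> s v) has_field_derivative \<gamma>' v) (at t)"
  shows "((\<lambda>s. ev f (\<gamma> s)) has_field_derivative (\<Sum>v\<in>UNIV. ev (pd v f) (\<gamma> t) * \<gamma>' v)) (at (t::complex))"
proof (induction f rule: pol_induct)
  case (cst c)
  then show ?case by simp
next
  case (var v)
  have "(\<Sum>w\<in>UNIV. ev (pd w (var v)) (\<gamma> t) * \<gamma>' w) = (\<Sum>w\<in>UNIV. if w = v then \<gamma>' w else 0)"
    by (rule sum.cong) (auto simp: pd_var)
  then show ?case using assms[of v] by simp
next
  case (add f g)
  from DERIV_add[OF this] show ?case by (simp add: sum.distrib algebra_simps)
next
  case (mult f g)
  from DERIV_mult[OF this] show ?case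
    by (simp add: sum.distrib algebra_simps pd_mult sum_distrib_left)
qed

text \<open>The derivative along the segment from x to y vanishes: each term has either a vanishing
  partial derivative or a vanishing increment.\<close>

lemma ev_cong_pd:
  assumes "\<And>v. v \<notin> V \<Longrightarrow> pd v f = 0" "\<And>v. v \<in> V \<Longrightarrow> x v = y v"
  shows "ev f x = ev f (y :: 'v::finite \<Rightarrow> complex)"
proof -
  define \<gamma> where "\<gamma> s v = x v + s * (y v - x v)" for s v
  have d: "((\<lambda>s. ev f (\<gamma> s)) has_field_derivative 0) (at t within UNIV)" for t
  proof -
    have "((\<lambda>s. ev f (\<gamma> s)) has_field_derivative (\<Sum>v\<in>UNIV. ev (pd v f) (\<gamma> t) * (y v - x v))) (at t)"
      by (rule ev_chain) (auto simp: \<gamma>_def intro!: derivative_eq_intros)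
    moreover have "(\<Sum>v\<in>UNIV. ev (pd v f) (\<gamma> t) * (y v - x v)) = 0"
    proof (intro sum.neutral ballI)
      fix v show "ev (pd v f) (\<gamma> t) * (y v - x v) = 0"
        using assms by (cases "v \<in> V") auto
    qed
    ultimately show ?thesis by simp
  qed
  have "ev f (\<gamma> 0) = ev f (\<gamma> 1)"
    using has_field_derivative_zero_constant[OF convex_UNIV d] by (metis UNIV_I)
  moreover have "\<gamma> 0 = x" "\<gamma> 1 = y" by (auto simp: \<gamma>_def)
  ultimately show ?thesis by simp
qed

lemma continuous_ev:
  assumes "\<And>v. ((\<lambda>k. X k v) \<longlongrightarrow> x v) F"
  shows "((\<lambda>k. ev f (X k)) \<longlongrightarrow> ev f x) F"
  by (induction f rule: pol_induct) (auto intro!: tendsto_intros assms)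

abbreviation rc :: "real \<Rightarrow> 'v pol" where "rc a \<equiv> cst (complex_of_real a)"

definition Eu :: "('v::finite \<Rightarrow> real) \<Rightarrow> 'v pol \<Rightarrow> 'v pol" where
  "Eu \<omega> = der (\<lambda>v. rc (\<omega> v) * var v)"

section \<open>Weights\<close>

text \<open>Weighted homogeneity is expressed by Euler's identity.\<close>

definition whom :: "('v::finite \<Rightarrow> real) \<Rightarrow> real \<Rightarrow> 'v pol \<Rightarrow> bool" where
  "whom \<omega> a f \<longleftrightarrow> Eu \<omega> f = rc a * f"

lemma whom_0 [simp]: "whom \<omega> a 0"
  by (simp add: whom_def Eu_def)
lemma whom_cst: "whom \<omega> 0 (cst c)"
  by (simp add: whom_def Eu_def cst_hom)
lemma whom_var: "whom \<omega> (\<omega> v) (var v)"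
  by (simp add: whom_def Eu_def)
lemma whom_add: "whom \<omega> a f \<Longrightarrow> whom \<omega> a g \<Longrightarrow> whom \<omega> a (f + g)"
  by (simp add: whom_def Eu_def algebra_simps)
lemma whom_diff: "whom \<omega> a f \<Longrightarrow> whom \<omega> a g \<Longrightarrow> whom \<omega> a (f - g)"
  by (simp add: whom_def Eu_def algebra_simps)
lemma whom_uminus: "whom \<omega> a f \<Longrightarrow> whom \<omega> a (- f)"
  by (simp add: whom_def Eu_def)
lemma whom_mult: "whom \<omega> a f \<Longrightarrow> whom \<omega> b g \<Longrightarrow> whom \<omega> (a + b) (f * g)"
  by (simp add: whom_def Eu_def der_mult cst_hom algebra_simps)
lemma whom_cst_mult: "whom \<omega> a f \<Longrightarrow> whom \<omega> a (cst c * f)"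
  using whom_mult[OF whom_cst] by force
lemma whom_sum: "(\<And>i. i \<in> S \<Longrightarrow> whom \<omega> a (g i)) \<Longrightarrow> whom \<omega> a (sum g S)"
  by (induction S rule: infinite_finite_induct) (auto intro: whom_add)
lemma whom_power: "whom \<omega> a f \<Longrightarrow> whom \<omega> (real n * a) (f ^ n)"
proof (induction n)
  case 0
  show ?case using whom_cst[of \<omega> 1] by (simp add: cst_hom)
next
  case (Suc n)
  then show ?case using whom_mult[of \<omega> a f "real n * a" "f ^ n"] by (simp add: algebra_simps)
qed
lemma whom_prod: "finite S \<Longrightarrow> (\<And>i. i \<in> S \<Longrightarrow> whom \<omega> (a i) (g i)) \<Longrightarrow> whom \<omega> (sum a S) (prod g S)"
proof (induction S rule: finite_induct)
  case empty
  show ?case using whom_cst[of \<omega> 1] by (simp add: cst_hom)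
next
  case (insert x F)
  then show ?case using whom_mult[of \<omega> "a x" "g x"] by simp
qed

lemma whom_unique: "whom \<omega> a f \<Longrightarrow> whom \<omega> b f \<Longrightarrow> a \<noteq> b \<Longrightarrow> f = 0"
  by (auto simp: whom_def)

text \<open>Euler's identity is the derivative of this law in \<theta>. The parameter is complex
  because the zero set is studied along complex orbits, not only along real dilations.\<close>

lemma whom_scale:
  assumes "whom \<omega> a f"
  shows "ev f (\<lambda>v. exp (of_real (\<omega> v) * \<theta>) * x v) = exp (of_real a * \<theta>) * ev f x"
proof -
  define \<gamma> where "\<gamma> \<theta> v = exp (of_real (\<omega> v) * \<theta>) * x v" for \<theta> :: complex and v
  have d: "((\<lambda>s. exp (- (of_real a * s)) * ev f (\<gamma> s)) has_field_derivative 0) (at t within UNIV)" for t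
  proof -
    have 1: "((\<lambda>s. ev f (\<gamma> s)) has_field_derivative (\<Sum>v\<in>UNIV. ev (pd v f) (\<gamma> t) * (of_real (\<omega> v) * \<gamma> t v))) (at t)"
      by (rule ev_chain) (auto simp: \<gamma>_def intro!: derivative_eq_intros)
    have "(\<Sum>v\<in>UNIV. ev (pd v f) (\<gamma> t) * (of_real (\<omega> v) * \<gamma> t v)) = ev (Eu \<omega> f) (\<gamma> t)"
      by (simp add: Eu_def der_def mult_ac)
    also have "\<dots> = of_real a * ev f (\<gamma> t)" using assms by (simp add: whom_def)
    finally have 2: "((\<lambda>s. ev f (\<gamma> s)) has_field_derivative of_real a * ev f (\<gamma> t)) (at t)" using 1 by simp
    have "((\<lambda>s. exp (- (of_real a * s)) * ev f (\<gamma> s)) has_field_derivative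
      (- of_real a * exp (- (of_real a * t))) * ev f (\<gamma> t) + (of_real a * ev f (\<gamma> t)) * exp (- (of_real a * t))) (at t)"
      by (rule DERIV_mult[OF _ 2]) (auto intro!: derivative_eq_intros)
    then show ?thesis by (simp add: algebra_simps)
  qed
  have "exp (- (of_real a * \<theta>)) * ev f (\<gamma> \<theta>) = exp (- (of_real a * 0)) * ev f (\<gamma> 0)"
    using has_field_derivative_zero_constant[OF convex_UNIV d] by (metis UNIV_I)
  moreover have "\<gamma> 0 = x" by (auto simp: \<gamma>_def)
  ultimately show ?thesis unfolding \<gamma>_def by (simp add: exp_minus field_simps)
qed

lemma whom_ev_0:
  assumes "whom \<omega> a f" "a \<noteq> 0" "\<And>v. \<omega> v \<noteq> 0 \<Longrightarrow> x v = 0"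
  shows "ev f x = 0"
proof -
  \<comment> \<open>The parameter 1/a makes the scaling factor exp 1, which differs from 1, while x
    itself is fixed.\<close>
  have "(\<lambda>v. exp (of_real (\<omega> v) * of_real (1/a)) * x v) = x"
  proof
    fix v show "exp (of_real (\<omega> v) * of_real (1/a)) * x v = x v"
      using assms(3)[of v] by (cases "\<omega> v = 0") auto
  qed
  then have "ev f x = exp 1 * ev f x"
    using whom_scale[OF assms(1), of "of_real (1/a)" x] assms(2) by (simp flip: of_real_mult)
  moreover have "exp (1::complex) \<noteq> 1"
  proof -
    have "exp (1::complex) = of_real (exp 1)" using exp_of_real[of 1, where 'a = complex] by simp
    then show ?thesis using exp_gt_one[of "1::real"] by (metis less_irrefl of_real_eq_1_iff zero_less_one)
  qed
  ultimately show ?thesis by (metis mult_cancel_right2)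
qed

lemma exp_lim_0: "a < 0 \<Longrightarrow> (\<lambda>k. exp (a * real k)) \<longlonglongrightarrow> 0"
  using LIMSEQ_power_zero[of "exp a"] by (simp add: exp_of_nat_mult[symmetric] mult.commute)

text \<open>Contracting x by exp(-\<omega> k) keeps the points convergent, while the value at x is
  exp(a k) times the value there, with a < 0.\<close>

lemma whom_neg:
  assumes "whom \<omega> a f" "a < 0" "\<And>v. 0 \<le> \<omega> v"
  shows "f = 0"
proof (rule pol_eqI)
  fix x :: "'a \<Rightarrow> complex"
  define X :: "nat \<Rightarrow> 'a \<Rightarrow> complex"
    where "X = (\<lambda>k v. exp (of_real (\<omega> v) * of_real (- real k)) * x v)"
  have s: "ev f x = exp (of_real (a * real k)) * ev f (X k)" for k
    using whom_scale[OF assms(1), of "of_real (- real k)" x] by (simp add: X_def exp_minus field_simps)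
  have X: "(\<lambda>k. X k v) \<longlonglongrightarrow> (if \<omega> v = 0 then x v else 0)" for v
  proof (cases "\<omega> v = 0")
    case False
    then have "\<omega> v > 0" using assms(3)[of v] by simp
    then have "(\<lambda>k. exp (\<omega> v * - real k)) \<longlonglongrightarrow> 0" using exp_lim_0[of "- \<omega> v"] by simp
    then have "(\<lambda>k. complex_of_real (exp (\<omega> v * - real k)) * x v) \<longlonglongrightarrow> of_real 0 * x v"
      by (intro tendsto_intros)
    then show ?thesis using False by (simp add: X_def exp_of_real[symmetric] del: exp_of_real)
  qed (simp add: X_def)
  have "(\<lambda>k. exp (a * real k)) \<longlonglongrightarrow> 0" using assms(2) by (rule exp_lim_0)
  then have "(\<lambda>k. complex_of_real (exp (a * real k)) * ev f (X k)) \<longlonglongrightarrow> of_real 0 * ev f (\<lambda>v. if \<omega> v = 0 then x v else 0)"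
    by (intro tendsto_intros continuous_ev X)
  moreover have "complex_of_real (exp (a * real k)) * ev f (X k) = ev f x" for k
    unfolding s[of k] exp_of_real ..
  ultimately have "(\<lambda>k. ev f x) \<longlonglongrightarrow> 0" by simp
  then show "ev f x = ev 0 x" by (simp add: LIMSEQ_const_iff)
qed

lemma whom_const:
  assumes "whom \<omega> 0 f" "\<And>v. 0 \<le> \<omega> v"
  shows "ev f x = ev f (\<lambda>v. if \<omega> v = 0 then x v else 0)"
proof -
  define X :: "nat \<Rightarrow> 'a \<Rightarrow> complex"
    where "X = (\<lambda>k v. exp (of_real (\<omega> v) * of_real (- real k)) * x v)"
  have s: "ev f (X k) = ev f x" for k
    using whom_scale[OF assms(1), of "of_real (- real k)" x] by (simp add: X_def)
  have X: "(\<lambda>k. X k v) \<longlonglongrightarrow> (if \<omega> v = 0 then x v else 0)" for v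
  proof (cases "\<omega> v = 0")
    case False
    then have "\<omega> v > 0" using assms(2)[of v] by simp
    then have "(\<lambda>k. exp (\<omega> v * - real k)) \<longlonglongrightarrow> 0" using exp_lim_0[of "- \<omega> v"] by simp
    then have "(\<lambda>k. complex_of_real (exp (\<omega> v * - real k)) * x v) \<longlonglongrightarrow> of_real 0 * x v"
      by (intro tendsto_intros)
    then show ?thesis using False by (simp add: X_def exp_of_real[symmetric] del: exp_of_real)
  qed (simp add: X_def)
  have "(\<lambda>k. ev f (X k)) \<longlonglongrightarrow> ev f (\<lambda>v. if \<omega> v = 0 then x v else 0)"
    by (intro continuous_ev X)
  then show ?thesis by (simp add: s LIMSEQ_const_iff)
qed

text \<open>Components of different weight are eigenvectors of Euler's operator: subtracting b
  removes the component b and multiplies the others by the nonzero a - b.\<close>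

lemma whom_independent:
  assumes "finite S" "\<And>a. a \<in> S \<Longrightarrow> whom \<omega> a (g a)" "(\<Sum>a\<in>S. g a) = 0"
  shows "\<forall>a\<in>S. g a = 0"
  using assms
proof (induction S arbitrary: g rule: finite_induct)
  case (insert b S)
  have "Eu \<omega> (\<Sum>a\<in>insert b S. g a) = (\<Sum>a\<in>insert b S. rc a * g a)"
    unfolding Eu_def der_sum using insert.prems(1) by (intro sum.cong) (auto simp: whom_def Eu_def)
  then have "(\<Sum>a\<in>insert b S. rc a * g a) - rc b * (\<Sum>a\<in>insert b S. g a) = 0"
    using insert.prems(2) by (simp add: Eu_def)
  then have "(\<Sum>a\<in>S. rc (a - b) * g a) = 0"
    using insert.hyps by (simp add: sum_distrib_left sum_distrib_right algebra_simps cst_hom sum_subtractf)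
  then have "\<forall>a\<in>S. rc (a - b) * g a = 0"
    by (intro insert.IH) (auto intro!: whom_cst_mult insert.prems)
  then have "\<forall>a\<in>S. g a = 0" using insert.hyps(2) by auto
  then show ?case using insert.prems insert.hyps by simp
qed simp

section \<open>Decomposition into weight components\<close>

definition wdec :: "('v::finite \<Rightarrow> real) \<Rightarrow> 'v pol \<Rightarrow> (real \<Rightarrow> 'v pol) \<Rightarrow> bool" where
  "wdec \<omega> f g \<longleftrightarrow> (\<forall>a. whom \<omega> a (g a)) \<and> (\<exists>S. finite S \<and> (\<forall>a. a \<notin> S \<longrightarrow> g a = 0) \<and> f = (\<Sum>a\<in>S. g a))"

lemma wdec_unique: "wdec \<omega> f g \<Longrightarrow> wdec \<omega> f h \<Longrightarrow> g = h"
proof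
  fix b
  assume "wdec \<omega> f g" "wdec \<omega> f h"
  then obtain S T where *: "finite S" "\<forall>a. a \<notin> S \<longrightarrow> g a = 0" "f = (\<Sum>a\<in>S. g a)"
    "finite T" "\<forall>a. a \<notin> T \<longrightarrow> h a = 0" "f = (\<Sum>a\<in>T. h a)" "\<forall>a. whom \<omega> a (g a)" "\<forall>a. whom \<omega> a (h a)"
    unfolding wdec_def by metis
  have "(\<Sum>a\<in>S \<union> T. g a) = (\<Sum>a\<in>S. g a)" "(\<Sum>a\<in>S \<union> T. h a) = (\<Sum>a\<in>T. h a)"
    using *(1,2,4,5) by (auto intro!: sum.mono_neutral_right)
  then have "(\<Sum>a\<in>S \<union> T. g a) = f" "(\<Sum>a\<in>S \<union> T. h a) = f"
    using *(3,6) by simp_all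
  then have "(\<Sum>a\<in>S \<union> T. g a - h a) = 0" by (simp add: sum_subtractf)
  then have "\<forall>a\<in>S \<union> T. g a - h a = 0"
    using * by (intro whom_independent[of _ \<omega>]) (auto intro: whom_diff)
  then show "g b = h b" using * by (metis UnCI right_minus_eq)
qed

lemma wdec_hom: "whom \<omega> b f \<Longrightarrow> wdec \<omega> f (\<lambda>a. if a = b then f else 0)"
  unfolding wdec_def by (auto intro!: exI[of _ "{b}"])

lemma wdec_add: "wdec \<omega> f g \<Longrightarrow> wdec \<omega> f' g' \<Longrightarrow> wdec \<omega> (f + f') (\<lambda>a. g a + g' a)"
proof -
  assume "wdec \<omega> f g" "wdec \<omega> f' g'"
  then obtain S T where *: "finite S" "\<forall>a. a \<notin> S \<longrightarrow> g a = 0" "f = (\<Sum>a\<in>S. g a)"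
    "finite T" "\<forall>a. a \<notin> T \<longrightarrow> g' a = 0" "f' = (\<Sum>a\<in>T. g' a)" "\<forall>a. whom \<omega> a (g a)" "\<forall>a. whom \<omega> a (g' a)"
    unfolding wdec_def by metis
  have "(\<Sum>a\<in>S \<union> T. g a) = (\<Sum>a\<in>S. g a)" "(\<Sum>a\<in>S \<union> T. g' a) = (\<Sum>a\<in>T. g' a)"
    using *(1,2,4,5) by (auto intro!: sum.mono_neutral_right)
  then have "(\<Sum>a\<in>S \<union> T. g a) = f" "(\<Sum>a\<in>S \<union> T. g' a) = f'"
    using *(3,6) by simp_all
  with * show ?thesis
    unfolding wdec_def by (auto simp: sum.distrib intro!: whom_add exI[of _ "S \<union> T"])
qed

text \<open>One rule covers every operator that shifts the weight: derivations, conjugate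
  derivations, multiplication by a homogeneous factor.\<close>

lemma wdec_linear:
  assumes "wdec \<omega> f g" "\<And>f g. L (f + g) = L f + L g" "\<And>b g. whom \<omega> b g \<Longrightarrow> whom \<omega>' (b + l) (L g)"
  shows "wdec \<omega>' (L f) (\<lambda>a. L (g (a - l)))"
proof -
  obtain S where *: "finite S" "\<forall>a. a \<notin> S \<longrightarrow> g a = 0" "f = (\<Sum>a\<in>S. g a)" "\<forall>a. whom \<omega> a (g a)"
    using assms(1) unfolding wdec_def by metis
  have L0: "L 0 = 0" using assms(2)[of 0 0] by (metis add.right_neutral add_left_cancel)
  have Ls: "L (sum g S) = (\<Sum>a\<in>S. L (g a))"
    by (induction S rule: infinite_finite_induct) (auto simp: assms(2) L0)
  have "whom \<omega>' a (L (g (a - l)))" for a using assms(3)[of "a - l"] * by simp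
  moreover have "(\<Sum>a\<in>(\<lambda>a. a + l) ` S. L (g (a - l))) = (\<Sum>a\<in>S. L (g a))"
    by (subst sum.reindex) (auto simp: inj_on_def)
  moreover have "L (g (a - l)) = 0" if "a \<notin> (\<lambda>a. a + l) ` S" for a
  proof -
    have "a - l \<notin> S" using that by (metis diff_add_cancel image_eqI)
    then show ?thesis using * L0 by simp
  qed
  ultimately show ?thesis
    unfolding wdec_def using * Ls by (auto intro!: exI[of _ "(\<lambda>a. a + l) ` S"])
qed

lemma wdec_exists: "\<exists>g. wdec \<omega> f g"
proof (induction f rule: pol_induct)
  case (cst c)
  then show ?case using wdec_hom[OF whom_cst] by blast
next
  case (var v)
  then show ?case using wdec_hom[OF whom_var] by blast
next
  case (add f g)
  then show ?case using wdec_add by blast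
next
  case (mult f f')
  then obtain g g' where d: "wdec \<omega> f g" "wdec \<omega> f' g'" by blast
  obtain S where *: "finite S" "f = (\<Sum>a\<in>S. g a)" "\<forall>a. whom \<omega> a (g a)"
    using d unfolding wdec_def by metis
  \<comment> \<open>Only one factor is split: each homogeneous piece of it shifts the decomposition
    of the other.\<close>
  have "\<exists>h. wdec \<omega> ((\<Sum>a\<in>S. g a) * f') h" using *(1)
  proof (induction S rule: finite_induct)
    case empty
    show ?case using wdec_hom[OF whom_0] by force
  next
    case (insert b S)
    have "wdec \<omega> (g b * f') (\<lambda>a. g b * g' (a - b))"
      by (rule wdec_linear[OF d(2)], simp add: distrib_left, subst add.commute, rule whom_mult) (use * in auto)
    with insert show ?case using wdec_add by (fastforce simp: distrib_right)
  qed
  then show ?case using * by simp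
qed

text \<open>The family is unique by \<open>wdec_unique\<close>, so the choice merely names the
  projection.\<close>

definition wcomp :: "('v::finite \<Rightarrow> real) \<Rightarrow> real \<Rightarrow> 'v pol \<Rightarrow> 'v pol" where
  "wcomp \<omega> a f = (SOME g. wdec \<omega> f g) a"

lemma wdec_cmp: "wdec \<omega> f (\<lambda>a. wcomp \<omega> a f)"
  using someI_ex[OF wdec_exists[of \<omega> f]] by (simp add: wcomp_def)

lemma wcomp_eqI: "wdec \<omega> f g \<Longrightarrow> wcomp \<omega> a f = g a"
  using fun_cong[OF wdec_unique[OF wdec_cmp, of \<omega> f g], of a] by simp

lemma whom_cmp: "whom \<omega> a (wcomp \<omega> a f)"
  using wdec_cmp[of \<omega> f] by (simp add: wdec_def)

lemma wcomp_finite: "finite {a. wcomp \<omega> a f \<noteq> 0}"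
  using wdec_cmp[of \<omega> f] unfolding wdec_def by (metis (mono_tags, lifting) finite_subset mem_Collect_eq subsetI)

lemma wcomp_sum_all: "finite S \<Longrightarrow> {a. wcomp \<omega> a f \<noteq> 0} \<subseteq> S \<Longrightarrow> (\<Sum>a\<in>S. wcomp \<omega> a f) = f"
proof -
  assume S: "finite S" "{a. wcomp \<omega> a f \<noteq> 0} \<subseteq> S"
  obtain T where T: "finite T" "\<forall>a. a \<notin> T \<longrightarrow> wcomp \<omega> a f = 0" "f = (\<Sum>a\<in>T. wcomp \<omega> a f)"
    using wdec_cmp[of \<omega> f] unfolding wdec_def by metis
  have "(\<Sum>a\<in>S. wcomp \<omega> a f) = (\<Sum>a\<in>{a. wcomp \<omega> a f \<noteq> 0}. wcomp \<omega> a f)"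
    using S by (intro sum.mono_neutral_right) auto
  also have "\<dots> = (\<Sum>a\<in>T. wcomp \<omega> a f)"
    using T by (intro sum.mono_neutral_left) auto
  finally show ?thesis using T(3) by simp
qed

lemma wcomp_hom: "whom \<omega> b f \<Longrightarrow> wcomp \<omega> a f = (if a = b then f else 0)"
  using wcomp_eqI[OF wdec_hom] by metis
lemma wcomp_add [simp]: "wcomp \<omega> a (f + g) = wcomp \<omega> a f + wcomp \<omega> a g"
  using wcomp_eqI[OF wdec_add[OF wdec_cmp wdec_cmp]] .
lemma wcomp_linear:
  assumes "\<And>f g. L (f + g) = L f + L g" "\<And>b g. whom \<omega> b g \<Longrightarrow> whom \<omega>' (b + l) (L g)"
  shows "wcomp \<omega>' a (L f) = L (wcomp \<omega> (a - l) f)"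
  using wcomp_eqI[OF wdec_linear[where L = L, OF wdec_cmp assms], where a = a] .
lemma wcomp_0 [simp]: "wcomp \<omega> a 0 = 0"
  by (simp add: wcomp_hom)
lemma wcomp_uminus [simp]: "wcomp \<omega> a (- f) = - wcomp \<omega> a f"
  using wcomp_linear[where L = uminus and \<omega> = \<omega> and \<omega>' = \<omega> and l = 0 and a = a and f = f] by (simp add: whom_uminus)
lemma wcomp_diff [simp]: "wcomp \<omega> a (f - g) = wcomp \<omega> a f - wcomp \<omega> a g"
  using wcomp_add[of \<omega> a f "- g"] by (simp del: wcomp_add)
lemma wcomp_cst_mult [simp]: "wcomp \<omega> a (cst c * f) = cst c * wcomp \<omega> a f"
  using wcomp_linear[where L = "(*) (cst c)" and \<omega> = \<omega> and \<omega>' = \<omega> and l = 0 and a = a and f = f]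
  by (simp add: whom_cst_mult distrib_left)
lemma wcomp_mult_hom: "whom \<omega> b g \<Longrightarrow> wcomp \<omega> a (g * f) = g * wcomp \<omega> (a - b) f"
  by (rule wcomp_linear, simp add: distrib_left, subst add.commute, rule whom_mult)
lemma wcomp_sum: "wcomp \<omega> a (sum f S) = (\<Sum>i\<in>S. wcomp \<omega> a (f i))"
  by (induction S rule: infinite_finite_induct) auto
section \<open>Holomorphic vector fields and conjugation\<close>

text \<open>Real polynomials are polarised: over variables \<open>'k + 'k\<close> the coordinates \<open>Inl k\<close> are the holomorphic
  ones and \<open>Inr k\<close> their conjugates, treated as independent. \<open>C\<close> is complex conjugation in this setting, and a
  holomorphic vector field with components \<open>A\<close> acts by \<open>D A\<close>, its conjugate by \<open>Db A\<close>.\<close>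

definition swp :: "'k + 'k \<Rightarrow> 'k + 'k" where "swp = case_sum Inr Inl"
lemma swp_simps [simp]: "swp (Inl k) = Inr k" "swp (Inr k) = Inl k" "swp (swp v) = v"
  by (auto simp: swp_def split: sum.splits)

lift_definition C :: "('k + 'k) pol \<Rightarrow> ('k + 'k) pol" is "\<lambda>f x. cnj (f (\<lambda>v. cnj (x (swp v))))"
proof -
  fix f :: "('k + 'k \<Rightarrow> complex) \<Rightarrow> complex"
  assume "f \<in> poly_fun"
  then show "(\<lambda>x. cnj (f (\<lambda>v. cnj (x (swp v))))) \<in> poly_fun"
  proof (induction rule: poly_fun.induct)
    case (const c)
    show ?case by (rule poly_fun.const)
  next
    case (coord v)
    show ?case using poly_fun.coord[of "swp v"] by simp
  next
    case (add f g)
    show ?case using poly_fun.add[OF add.IH] by simp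
  next
    case (mult f g)
    show ?case using poly_fun.mult[OF mult.IH] by simp
  qed
qed

lemma ev_C: "ev (C f) x = cnj (ev f (\<lambda>v. cnj (x (swp v))))"
  by (simp add: C.rep_eq)
lemma C_C [simp]: "C (C f) = f"
  by (rule pol_eqI) (simp add: ev_C)
lemma C_simps [simp]: "C 0 = 0" "C 1 = 1" "C (f + g) = C f + C g" "C (f * g) = C f * C g" "C (- f) = - C f"
  "C (f - g) = C f - C g" "C (cst c) = cst (cnj c)" "C (var (Inl k)) = var (Inr k)" "C (var (Inr k)) = var (Inl k)"
  by (auto intro!: pol_eqI simp: ev_C)
lemma C_var: "C (var v) = var (swp v)"
  by (rule pol_eqI) (simp add: ev_C)
lemma C_sum [simp]: "C (sum f S) = (\<Sum>i\<in>S. C (f i))"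
  by (induction S rule: infinite_finite_induct) auto
lemma C_prod [simp]: "C (prod f S) = (\<Prod>i\<in>S. C (f i))"
  by (induction S rule: infinite_finite_induct) auto
lemma C_power [simp]: "C (f ^ n) = C f ^ n"
  by (induction n) auto
lemma C_eq_0_iff [simp]: "C f = 0 \<longleftrightarrow> f = 0"
  by (metis C_C C_simps(1))

text \<open>For holomorphic A, the sum of \<open>D A\<close> and \<open>Db A\<close> is the real
  vector field with components A, acting on polarised functions.\<close>

definition D :: "('k \<Rightarrow> ('k::finite + 'k) pol) \<Rightarrow> ('k + 'k) pol \<Rightarrow> ('k + 'k) pol" where
  "D A = der (case_sum A (\<lambda>_. 0))"
definition Db :: "('k \<Rightarrow> ('k::finite + 'k) pol) \<Rightarrow> ('k + 'k) pol \<Rightarrow> ('k + 'k) pol" where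
  "Db A = der (case_sum (\<lambda>_. 0) (\<lambda>k. C (A k)))"

lemma D_simps [simp]: "D A 0 = 0" "D A 1 = 0" "D A (f + g) = D A f + D A g" "D A (- f) = - D A f"
  "D A (f - g) = D A f - D A g" "D A (cst c) = 0" "D A (cst c * f) = cst c * D A f"
  "D A (var (Inl k)) = A k" "D A (var (Inr k)) = 0"
  by (simp_all add: D_def)
lemma Db_simps [simp]: "Db A 0 = 0" "Db A 1 = 0" "Db A (f + g) = Db A f + Db A g" "Db A (- f) = - Db A f"
  "Db A (f - g) = Db A f - Db A g" "Db A (cst c) = 0" "Db A (cst c * f) = cst c * Db A f"
  "Db A (var (Inr k)) = C (A k)" "Db A (var (Inl k)) = 0"
  by (simp_all add: Db_def)
lemma D_mult: "D A (f * g) = D A f * g + f * D A g"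
  and Db_mult: "Db A (f * g) = Db A f * g + f * Db A g"
  by (simp_all add: D_def Db_def der_mult)
lemma sum_UNIV_Plus: "(\<Sum>v\<in>UNIV. f v) = (\<Sum>k\<in>UNIV. f (Inl k)) + (\<Sum>k\<in>UNIV. f (Inr k))"
  for f :: "'a::finite + 'b::finite \<Rightarrow> 'c::comm_monoid_add"
  unfolding UNIV_Plus_UNIV[symmetric] by (subst sum.Plus) auto

lemma D_pd: "D A f = (\<Sum>k\<in>UNIV. A k * pd (Inl k) f)"
  and Db_pd: "Db A f = (\<Sum>k\<in>UNIV. C (A k) * pd (Inr k) f)"
  by (simp_all add: D_def Db_def der_def sum_UNIV_Plus)

lemma C_D: "C (D A f) = Db A (C f)"
proof -
  have "C (D A (C (C f))) = Db A (C f)"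
  proof (rule derivation_eqI[where L = "\<lambda>f. C (D A (C f))"])
    fix v show "C (D A (C (var v))) = Db A (var v)"
      by (cases v) (simp_all add: D_def Db_def)
  qed (auto simp: D_mult Db_mult algebra_simps)
  then show ?thesis by simp
qed
lemma C_Db: "C (Db A f) = D A (C f)"
  by (metis C_C C_D)

lemma pd_C: "pd (Inr k) (C f) = C (pd (Inl k) f)"
proof -
  have "pd (Inr k) g = C (pd (Inl k) (C g))" for g
  proof (induction g rule: pol_induct)
    case (var v)
    then show ?case by (cases v) (auto simp: pd_var)
  qed (auto simp: pd_mult)
  from this[of "C f"] show ?thesis by simp
qed

section \<open>Holomorphic polynomials and brackets of holomorphic fields\<close>

definition holo :: "('k + 'k) pol \<Rightarrow> bool" where
  "holo f \<longleftrightarrow> (\<forall>k. pd (Inr k) f = 0)"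

lemma pd_0 [simp]: "pd v 0 = 0"
  using pd_cst[of v 0] by (simp add: cst_hom del: pd_cst)
lemma pd_1 [simp]: "pd v 1 = 0"
  using pd_cst[of v 1] by (simp add: cst_hom del: pd_cst)
lemma pd_uminus [simp]: "pd v (- f) = - pd v f"
  using pd_add[of v f "- f"] by (simp add: eq_neg_iff_add_eq_0 add.commute del: pd_add)
lemma pd_diff [simp]: "pd v (f - g) = pd v f - pd v g"
  using pd_add[of v f "- g"] by (simp del: pd_add)
lemma pd_sum [simp]: "pd v (sum f S) = (\<Sum>i\<in>S. pd v (f i))"
  by (induction S rule: infinite_finite_induct) auto

lemma pd_der:
  assumes "\<And>w. pd v (A w) = 0"
  shows "pd v (der A f) = der A (pd v f)"
  unfolding pd_eq_der by (rule der_commute) (use assms in \<open>auto simp: pd_eq_der\<close>)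

lemma pd_D: "(\<And>k. pd v (A k) = 0) \<Longrightarrow> pd v (D A f) = D A (pd v f)"
  unfolding D_def by (rule pd_der) (auto split: sum.splits)
lemma holo_simps [simp]: "holo 0" "holo 1" "holo (cst c)" "holo (var (Inl k))"
  by (auto simp: holo_def pd_var)
lemma holo_add: "holo f \<Longrightarrow> holo g \<Longrightarrow> holo (f + g)"
  and holo_mult: "holo f \<Longrightarrow> holo g \<Longrightarrow> holo (f * g)"
  and holo_uminus: "holo f \<Longrightarrow> holo (- f)"
  and holo_diff: "holo f \<Longrightarrow> holo g \<Longrightarrow> holo (f - g)"
  by (auto simp: holo_def pd_mult)
lemma holo_D: "(\<And>k. holo (A k)) \<Longrightarrow> holo f \<Longrightarrow> holo (D A f)"
  by (simp add: holo_def pd_D)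
lemma holo_pd: "holo f \<Longrightarrow> holo (pd v f)" for f :: "('k::finite + 'k) pol"
  by (simp add: holo_def pd_commute[of _ v])

lemma Db_holo: "holo f \<Longrightarrow> Db A f = 0"
  by (simp add: Db_pd holo_def)
lemma D_C_holo: "holo f \<Longrightarrow> D A (C f) = 0"
  using C_Db[of A f] by (simp add: Db_holo)

text \<open>The coefficients of each field depend only on variables that the other one leaves
  fixed.\<close>

lemma D_Db_commute:
  assumes "\<And>k. holo (A k)" "\<And>k. holo (B k)"
  shows "D A (Db B f) = Db B (D A f)"
  unfolding D_def Db_def
proof (rule der_commute)
  fix v
  show "der (case_sum A (\<lambda>_. 0)) (case_sum (\<lambda>_. 0) (\<lambda>k. C (B k)) v) =
      der (case_sum (\<lambda>_. 0) (\<lambda>k. C (B k))) (case_sum A (\<lambda>_. 0) v)"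
    using D_C_holo[OF assms(2), of A] Db_holo[OF assms(1), of B]
    by (cases v) (auto simp: D_def Db_def)
qed

definition hbrk :: "('k \<Rightarrow> ('k::finite + 'k) pol) \<Rightarrow> ('k \<Rightarrow> ('k + 'k) pol) \<Rightarrow> 'k \<Rightarrow> ('k + 'k) pol" where
  "hbrk A B k = D A (B k) - D B (A k)"

lemma D_hbrk: "D (hbrk A B) f = D A (D B f) - D B (D A f)"
proof (rule derivation_eqI[where M = "\<lambda>f. D A (D B f) - D B (D A f)"])
  fix v show "D (hbrk A B) (var v) = D A (D B (var v)) - D B (D A (var v))"
    by (cases v) (simp_all add: hbrk_def)
qed (auto simp: D_mult algebra_simps)

lemma holo_hbrk: "(\<And>k. holo (A k)) \<Longrightarrow> (\<And>k. holo (B k)) \<Longrightarrow> holo (hbrk A B k)"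
  unfolding hbrk_def by (intro holo_diff holo_D)

text \<open>The weights are counted separately in the holomorphic and the antiholomorphic variables.\<close>

definition wh :: "('k \<Rightarrow> real) \<Rightarrow> 'k + 'k \<Rightarrow> real" where "wh \<delta> = case_sum \<delta> (\<lambda>_. 0)"
definition wa :: "('k \<Rightarrow> real) \<Rightarrow> 'k + 'k \<Rightarrow> real" where "wa \<delta> = case_sum (\<lambda>_. 0) \<delta>"
lemma wha_simps [simp]: "wh \<delta> (Inl k) = \<delta> k" "wh \<delta> (Inr k) = 0" "wa \<delta> (Inl k) = 0" "wa \<delta> (Inr k) = \<delta> k"
  by (simp_all add: wh_def wa_def)

text \<open>The component k has weight l + \<delta> k because differentiation in the variable k
  lowers the weight by \<delta> k; as an operator the field then shifts weights by l.\<close>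

definition field_weight :: "('k \<Rightarrow> real) \<Rightarrow> real \<Rightarrow> ('k::finite \<Rightarrow> ('k + 'k) pol) \<Rightarrow> bool" where
  "field_weight \<delta> l A \<longleftrightarrow> (\<forall>k. whom (wh \<delta>) (l + \<delta> k) (A k))"

text \<open>The bracket of the Euler field with A is l times A, which is checked on the variables;
  Euler's identity for \<open>D A f\<close> follows.\<close>

lemma whom_D:
  assumes "field_weight \<delta> l A" "whom (wh \<delta>) a f"
  shows "whom (wh \<delta>) (a + l) (D A f)"
proof -
  have 1: "der (brk (\<lambda>v. rc (wh \<delta> v) * var v) (case_sum A (\<lambda>_. 0))) f = rc l * D A f" for f
  proof (rule derivation_eqI[where M = "\<lambda>f. rc l * D A f"])
    fix v
    show "der (brk (\<lambda>v. rc (wh \<delta> v) * var v) (case_sum A (\<lambda>_. 0))) (var v) = rc l * D A (var v)"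
      using assms(1) by (cases v) (auto simp: brk_def D_def field_weight_def whom_def Eu_def algebra_simps cst_hom der_mult)
  qed (auto simp: der_mult D_mult algebra_simps)
  have "Eu (wh \<delta>) (D A f) - D A (Eu (wh \<delta>) f) = rc l * D A f"
    using 1[of f] unfolding der_brk Eu_def D_def .
  then show ?thesis using assms(2) by (simp add: whom_def cst_hom algebra_simps D_mult)
qed

lemma Eu_wa_holo: "holo f \<Longrightarrow> Eu (wa \<delta>) f = 0"
  by (simp add: Eu_def der_def sum_UNIV_Plus holo_def cst_hom)

lemma holo_isw_wa: "holo f \<Longrightarrow> whom (wa \<delta>) 0 f"
  by (simp add: whom_def Eu_wa_holo cst_hom)

lemma whom_D_wa:
  assumes "\<And>k. holo (A k)" "whom (wa \<delta>) a f"
  shows "whom (wa \<delta>) a (D A f)"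
proof -
  have "Eu (wa \<delta>) (D A f) = D A (Eu (wa \<delta>) f)"
    unfolding Eu_def D_def
  proof (rule der_commute)
    fix v
    show "der (\<lambda>v. rc (wa \<delta> v) * var v) (case_sum A (\<lambda>_. 0) v) = der (case_sum A (\<lambda>_. 0)) (rc (wa \<delta> v) * var v)"
      using Eu_wa_holo[OF assms(1), of \<delta>] by (cases v) (auto simp: Eu_def cst_hom)
  qed
  then show ?thesis using assms(2) by (simp add: whom_def)
qed

lemma C_Eu: "C (Eu (wh \<delta>) f) = Eu (wa \<delta>) (C f)"
proof -
  have "C (Eu (wh \<delta>) (C (C f))) = Eu (wa \<delta>) (C f)"
  proof (rule derivation_eqI[where L = "\<lambda>f. C (Eu (wh \<delta>) (C f))"])
    fix v show "C (Eu (wh \<delta>) (C (var v))) = Eu (wa \<delta>) (var v)"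
      by (cases v) (simp_all add: Eu_def cst_hom)
  qed (auto simp: Eu_def der_mult algebra_simps)
  then show ?thesis by simp
qed

lemma whom_C: "whom (wa \<delta>) a (C f) \<longleftrightarrow> whom (wh \<delta>) a f"
proof -
  have "whom (wa \<delta>) a (C f) \<longleftrightarrow> C (Eu (wh \<delta>) f) = C (rc a * f)"
    by (simp add: whom_def C_Eu)
  also have "\<dots> \<longleftrightarrow> whom (wh \<delta>) a f" unfolding whom_def by (metis C_C)
  finally show ?thesis .
qed
lemma whom_C': "whom (wh \<delta>) a (C f) \<longleftrightarrow> whom (wa \<delta>) a f"
  using whom_C[of \<delta> a "C f"] by simp

lemma whom_Db_wh:
  assumes "\<And>k. holo (A k)" "whom (wh \<delta>) a f"
  shows "whom (wh \<delta>) a (Db A f)"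
  using whom_D_wa[OF assms(1), of \<delta> a "C f"] assms(2) by (simp add: whom_C C_D whom_C'[symmetric])

lemma field_weight_hbrk:
  assumes "field_weight \<delta> l A" "field_weight \<delta> l' B"
  shows "field_weight \<delta> (l + l') (hbrk A B)"
  unfolding field_weight_def hbrk_def
proof
  fix k
  show "whom (wh \<delta>) (l + l' + \<delta> k) (D A (B k) - D B (A k))"
    using whom_D[OF assms(1), of "l' + \<delta> k" "B k"] whom_D[OF assms(2), of "l + \<delta> k" "A k"] assms
    by (intro whom_diff) (auto simp: field_weight_def algebra_simps)
qed

lemma wcomp_D: "field_weight \<delta> l A \<Longrightarrow> wcomp (wh \<delta>) a (D A f) = D A (wcomp (wh \<delta>) (a - l) f)"
  by (rule wcomp_linear) (auto intro: whom_D)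
lemma wcomp_Db: "(\<And>k. holo (A k)) \<Longrightarrow> wcomp (wh \<delta>) a (Db A f) = Db A (wcomp (wh \<delta>) a f)"
  using wcomp_linear[where L = "Db A" and \<omega> = "wh \<delta>" and \<omega>' = "wh \<delta>" and l = 0 and a = a and f = f]
  by (simp add: whom_Db_wh)

lemma whom_pd: "whom (wh \<delta>) a f \<Longrightarrow> whom (wh \<delta>) (a - \<delta> k) (pd (Inl k) f)"
proof -
  assume a: "whom (wh \<delta>) a f"
  have "field_weight \<delta> (- \<delta> k) (\<lambda>j. if j = k then 1 else 0)"
    unfolding field_weight_def using whom_cst[of "wh \<delta>" 1] by (auto simp: cst_hom)
  moreover have "D (\<lambda>j. if j = k then 1 else 0) f = pd (Inl k) f"
  proof -
    have "D (\<lambda>j. if j = k then 1 else 0) f = (\<Sum>j\<in>UNIV. if j = k then pd (Inl j) f else 0)"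
      unfolding D_pd by (intro sum.cong) auto
    then show ?thesis by simp
  qed
  ultimately show ?thesis using whom_D[OF _ a, of "- \<delta> k"] by force
qed

section \<open>The local flow of a polynomial vector field\<close>

text \<open>\<open>size_bd d M f\<close>: degree at most \<open>d\<close> and sum of absolute values of the coefficients at most \<open>M\<close>.
  The bound for iterated derivatives grows like \<open>k! B^k\<close>, so the flow series has a positive radius of convergence.\<close>

inductive size_bd :: "nat \<Rightarrow> real \<Rightarrow> 'v pol \<Rightarrow> bool" where
  cst: "size_bd 0 (norm c) (cst c)"
| var: "size_bd 1 1 (var v)"
| add: "size_bd d M f \<Longrightarrow> size_bd d M' g \<Longrightarrow> size_bd d (M + M') (f + g)"
| mult: "size_bd d M f \<Longrightarrow> size_bd d' M' g \<Longrightarrow> size_bd (d + d') (M * M') (f * g)"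
| weaken: "size_bd d M f \<Longrightarrow> d \<le> d' \<Longrightarrow> M \<le> M' \<Longrightarrow> size_bd d' M' f"

lemma size_bd_nonneg: "size_bd d M f \<Longrightarrow> 0 \<le> M"
  by (induction rule: size_bd.induct) auto

lemma size_bd_exists: "\<exists>d M. size_bd d M f"
proof (induction f rule: pol_induct)
  case (add f g)
  then obtain d M d' M' where *: "size_bd d M f" "size_bd d' M' g" by blast
  have "size_bd (max d d') M f" "size_bd (max d d') M' g"
    using *[THEN size_bd.weaken] by auto
  then show ?case by (blast intro: size_bd.add)
qed (blast intro: size_bd.intros)+

lemma size_bd_0: "0 \<le> M \<Longrightarrow> size_bd d M 0"
  using size_bd.weaken[OF size_bd.cst[of 0], of d M] by (simp add: cst_hom)

lemma size_bd_der:
  assumes A: "\<And>v. size_bd (Suc e) K (A v)" and "size_bd d M f"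
  shows "size_bd (d + e) (real d * K * M) (der A f)"
  using assms(2)
proof (induction rule: size_bd.induct)
  case (cst c)
  show ?case by (simp add: size_bd_0)
next
  case (var v)
  show ?case using A[of v] by simp
next
  case (add d M f M' g)
  show ?case using size_bd.add[OF add.IH] by (simp add: algebra_simps)
next
  case (mult d M f d' M' g)
  have "size_bd (d + d' + e) (real d * K * M * M' + M * (real d' * K * M')) (der A f * g + f * der A g)"
    using size_bd.mult[OF mult.IH(1) mult.hyps(2)] size_bd.mult[OF mult.hyps(1) mult.IH(2)]
    by (intro size_bd.add) (simp_all add: ac_simps)
  then show ?case by (simp add: der_mult algebra_simps)
next
  case (weaken d M f d' M')
  have K: "0 \<le> K" using size_bd_nonneg[OF A] .
  have "real d * K * M \<le> real d' * K * M'"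
    using weaken.hyps K size_bd_nonneg[OF weaken.hyps(1)] by (intro mult_mono) auto
  then show ?case using size_bd.weaken[OF weaken.IH] weaken.hyps by simp
qed

lemma size_bd_ev:
  assumes "size_bd d M f" "\<And>v. norm (x v) \<le> R" "1 \<le> R"
  shows "norm (ev f x) \<le> M * R ^ d"
  using assms(1)
proof (induction rule: size_bd.induct)
  case (cst c)
  show ?case by simp
next
  case (var v)
  show ?case using assms by simp
next
  case (add d M f M' g)
  then show ?case by (simp add: distrib_right norm_triangle_le)
next
  case (mult d M f d' M' g)
  have "norm (ev f x) * norm (ev g x) \<le> (M * R ^ d) * (M' * R ^ d')"
    using mult size_bd_nonneg[OF mult.hyps(1)] assms(3) by (intro mult_mono) auto
  then show ?case by (simp add: norm_mult power_add algebra_simps)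
next
  case (weaken d M f d' M')
  have "M * R ^ d \<le> M' * R ^ d'"
    using weaken.hyps assms(3) size_bd_nonneg[OF weaken.hyps(1)] by (intro mult_mono power_increasing) auto
  then show ?case using weaken.IH by simp
qed

lemma size_bd_der_iter:
  assumes A: "\<And>v. size_bd (Suc e) K (A v)"
  shows "size_bd (1 + k * e) (fact k * (real (1 + e) * K) ^ k) ((der A ^^ k) (var v))"
proof (induction k)
  case 0
  show ?case using size_bd.var by simp
next
  case (Suc k)
  have K: "0 \<le> K" using size_bd_nonneg[OF A] .
  \<comment> \<open>The degree after k steps is at most 1 + k e, hence at most (k + 1)(1 + e): the
    factor k + 1 builds the factorial, and 1 + e goes into the geometric base.\<close>
  have "real (1 + k * e) \<le> real (Suc k * (1 + e))" by (subst of_nat_le_iff) auto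
  then have "real (1 + k * e) * K * (fact k * (real (1 + e) * K) ^ k)
      \<le> real (Suc k * (1 + e)) * K * (fact k * (real (1 + e) * K) ^ k)"
    using K by (intro mult_right_mono) auto
  also have "\<dots> = fact (Suc k) * (real (1 + e) * K) ^ Suc k"
    by (simp add: algebra_simps)
  finally show ?case
    using size_bd.weaken[OF size_bd_der[OF A Suc.IH]] by simp
qed

section \<open>Lie series of a polynomial field\<close>

definition flow_term :: "('v::finite \<Rightarrow> 'v pol) \<Rightarrow> ('v \<Rightarrow> complex) \<Rightarrow> complex \<Rightarrow> 'v pol \<Rightarrow> nat \<Rightarrow> complex" where
  "flow_term A x s f k = ev ((der A ^^ k) f) x * s ^ k / fact k"

lemma der_iter_add: "(der A ^^ k) (f + g) = (der A ^^ k) f + (der A ^^ k) g"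
  by (induction k) auto
lemma der_iter_0 [simp]: "(der A ^^ k) 0 = 0"
  by (induction k) auto
lemma der_iter_cst_mult: "(der A ^^ k) (cst c * f) = cst c * (der A ^^ k) f"
  by (induction k) auto

lemma der_iter_mult:
  "(der A ^^ k) (f * g) = (\<Sum>i\<le>k. of_nat (k choose i) * ((der A ^^ i) f * (der A ^^ (k - i)) g))"
proof (induction k)
  case (Suc k)
  let ?F = "\<lambda>i. (der A ^^ i) f" and ?G = "\<lambda>i. (der A ^^ i) g"
  have ofn: "der A (of_nat n * h) = of_nat n * der A h" for n h
    using der_cst_mult[of A "of_nat n" h] by (simp add: cst_hom)
  have "(der A ^^ Suc k) (f * g) = der A (\<Sum>i\<le>k. of_nat (k choose i) * (?F i * ?G (k - i)))"
    using Suc.IH by simp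
  also have "\<dots> = (\<Sum>i\<le>k. of_nat (k choose i) * (?F (Suc i) * ?G (k - i)))
      + (\<Sum>i\<le>k. of_nat (k choose i) * (?F i * ?G (Suc k - i)))"
    unfolding der_sum ofn
    by (simp add: der_mult distrib_left sum.distrib Suc_diff_le)
  also have "(\<Sum>i\<le>k. of_nat (k choose i) * (?F i * ?G (Suc k - i)))
      = ?F 0 * ?G (Suc k) + (\<Sum>i\<le>k. of_nat (k choose Suc i) * (?F (Suc i) * ?G (k - i)))"
  proof -
    have "(\<Sum>i\<le>k. of_nat (k choose i) * (?F i * ?G (Suc k - i)))
        = (\<Sum>i\<le>Suc k. of_nat (k choose i) * (?F i * ?G (Suc k - i)))"
      by (simp add: binomial_eq_0)
    also have "\<dots> = ?F 0 * ?G (Suc k) + (\<Sum>i\<le>k. of_nat (k choose Suc i) * (?F (Suc i) * ?G (k - i)))"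
      by (subst sum.atMost_Suc_shift) simp
    finally show ?thesis .
  qed
  also have "(\<Sum>i\<le>k. of_nat (k choose i) * (?F (Suc i) * ?G (k - i)))
      + (?F 0 * ?G (Suc k) + (\<Sum>i\<le>k. of_nat (k choose Suc i) * (?F (Suc i) * ?G (k - i))))
      = ?F 0 * ?G (Suc k) + (\<Sum>i\<le>k. of_nat (Suc k choose Suc i) * (?F (Suc i) * ?G (k - i)))"
    by (simp add: sum.distrib distrib_right add_ac)
  also have "\<dots> = (\<Sum>i\<le>Suc k. of_nat (Suc k choose i) * (?F i * ?G (Suc k - i)))"
    by (subst sum.atMost_Suc_shift) simp
  finally show ?case .
qed simp

lemma flow_term_mult: "flow_term A x s (f * g) k = (\<Sum>i\<le>k. flow_term A x s f i * flow_term A x s g (k - i))"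
proof -
  have "flow_term A x s (f * g) k = (\<Sum>i\<le>k. of_nat (k choose i) * (ev ((der A ^^ i) f) x * ev ((der A ^^ (k - i)) g) x)) * s ^ k / fact k"
    by (simp add: flow_term_def der_iter_mult)
  also have "\<dots> = (\<Sum>i\<le>k. flow_term A x s f i * flow_term A x s g (k - i))"
    unfolding sum_distrib_right sum_divide_distrib
  proof (rule sum.cong)
    fix i assume "i \<in> {..k}"
    then have "s ^ k = s ^ i * s ^ (k - i)" "of_nat (k choose i) = (fact k / (fact i * fact (k - i)) :: complex)"
      by (simp_all add: power_add[symmetric] binomial_fact)
    then show "of_nat (k choose i) * (ev ((der A ^^ i) f) x * ev ((der A ^^ (k - i)) g) x) * s ^ k / fact k
        = flow_term A x s f i * flow_term A x s g (k - i)"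
      by (simp add: flow_term_def field_simps)
  qed simp
  finally show ?thesis .
qed

text \<open>The exponential of a derivation is multiplicative: Leibniz' rule turns the series of a
  product into a Cauchy product. Hence the point whose coordinates are the series of the variables
  evaluates every polynomial to its own series, and the flow is obtained without solving a
  differential equation.\<close>

lemma flow_hom:
  assumes "\<And>v. summable (\<lambda>k. norm (flow_term A x s (var v) k))"
  shows "summable (\<lambda>k. norm (flow_term A x s f k)) \<and> ev f (\<lambda>v. \<Sum>k. flow_term A x s (var v) k) = (\<Sum>k. flow_term A x s f k)"
proof (induction f rule: pol_induct)
  case (cst c)
  have "(der A ^^ k) (cst c) = 0" if "k \<noteq> 0" for k
    using that by (cases k) (auto simp: funpow_Suc_right simp del: funpow.simps)
  then have "flow_term A x s (cst c) = (\<lambda>k. if k = 0 then c else 0)"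
    by (auto simp: flow_term_def)
  moreover have "(\<lambda>k. if k = 0 then c else 0) sums c" using sums_single[of 0 "\<lambda>_. c"] by simp
  moreover have "summable (\<lambda>k. norm (if k = (0::nat) then c else 0))"
    by (rule summable_finite[of "{0}"]) auto
  ultimately show ?case by (simp add: sums_unique)
next
  case (var v)
  show ?case using assms by simp
next
  case (add f g)
  have e: "flow_term A x s (f + g) k = flow_term A x s f k + flow_term A x s g k" for k
    by (simp add: flow_term_def der_iter_add add_divide_distrib distrib_right)
  have "summable (\<lambda>k. norm (flow_term A x s f k) + norm (flow_term A x s g k))"
    using add by (intro summable_add) auto
  then have "summable (\<lambda>k. norm (flow_term A x s (f + g) k))"
    by (rule summable_comparison_test'[where N = 0]) (simp add: e norm_triangle_ineq)
  moreover have "(\<Sum>k. flow_term A x s (f + g) k) = (\<Sum>k. flow_term A x s f k) + (\<Sum>k. flow_term A x s g k)"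
    unfolding e using add by (intro suminf_add[symmetric]) (auto intro: summable_norm_cancel)
  ultimately show ?case using add by simp
next
  case (mult f g)
  have "summable (\<lambda>k. \<Sum>i\<le>k. norm (flow_term A x s f i) * norm (flow_term A x s g (k - i)))"
    using mult by (intro summable_Cauchy_product) auto
  then have "summable (\<lambda>k. norm (flow_term A x s (f * g) k))"
    by (rule summable_comparison_test'[where N = 0]) (simp add: flow_term_mult sum_norm_le norm_mult)
  moreover have "(\<Sum>k. flow_term A x s (f * g) k) = (\<Sum>k. flow_term A x s f k) * (\<Sum>k. flow_term A x s g k)"
    unfolding flow_term_mult using mult by (intro Cauchy_product[symmetric]) auto
  ultimately show ?case using mult by simp
qed

lemma flow_summable:
  "\<exists>\<epsilon>>0. \<forall>s. norm s < \<epsilon> \<longrightarrow> (\<forall>v. summable (\<lambda>k. norm (flow_term A x s (var v) k)))"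
proof -
  have "\<forall>v. \<exists>d M. size_bd d M (A v)" using size_bd_exists by blast
  then obtain d M where dM: "\<And>v. size_bd (d v) (M v) (A v)" by metis
  define e where "e = (\<Sum>v\<in>UNIV. d v)"
  define K where "K = 1 + (\<Sum>v\<in>UNIV. M v)"
  define R where "R = 1 + (\<Sum>v\<in>UNIV. norm (x v))"
  have M0: "0 \<le> M v" for v using size_bd_nonneg[OF dM] .
  have A: "size_bd (Suc e) K (A v)" for v
  proof (rule size_bd.weaken[OF dM])
    show "d v \<le> Suc e" unfolding e_def using member_le_sum[of v UNIV d] by auto
    show "M v \<le> K" unfolding K_def using member_le_sum[of v UNIV M] M0 by auto
  qed
  have R: "norm (x v) \<le> R" for v
    unfolding R_def using member_le_sum[of v UNIV "\<lambda>v. norm (x v)"] by auto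
  have R1: "1 \<le> R" unfolding R_def by (simp add: sum_nonneg)
  have K0: "1 \<le> K" unfolding K_def using M0 by (simp add: sum_nonneg)
  \<comment> \<open>The radius is 1/B: by \<open>size_bd_der_iter\<close> the k-th term is at most R
    (B |s|)^k.\<close>
  define B where "B = real (1 + e) * K * R ^ e"
  have B: "0 < B" unfolding B_def using K0 R1 by (intro mult_pos_pos) auto
  show ?thesis
  proof (intro exI[of _ "1 / B"] conjI allI impI)
    show "0 < 1 / B" using B by simp
    fix s :: complex and v
    assume s: "norm s < 1 / B"
    show "summable (\<lambda>k. norm (flow_term A x s (var v) k))"
    proof (rule summable_comparison_test'[where N = 0])
      have "norm (B * norm s) < 1" using s B by (simp add: field_simps)
      then show "summable (\<lambda>k. R * (B * norm s) ^ k)"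
        by (intro summable_mult summable_geometric)
      fix k
      have "norm (ev ((der A ^^ k) (var v)) x) \<le> fact k * (real (1 + e) * K) ^ k * R ^ (1 + k * e)"
        by (rule size_bd_ev[OF size_bd_der_iter[OF A] R R1])
      also have "\<dots> = fact k * (R * B ^ k)"
        by (simp add: B_def power_mult_distrib mult_ac flip: power_mult)
      finally have "norm (ev ((der A ^^ k) (var v)) x) * norm s ^ k / fact k \<le> fact k * (R * B ^ k) * norm s ^ k / fact k"
        by (intro divide_right_mono mult_right_mono) auto
      then show "norm (norm (flow_term A x s (var v) k)) \<le> R * (B * norm s) ^ k"
        by (simp add: flow_term_def norm_mult norm_divide norm_power power_mult_distrib)
    qed
  qed
qed

abbreviation ext :: "('k \<Rightarrow> ('k + 'k) pol) \<Rightarrow> 'k + 'k \<Rightarrow> ('k + 'k) pol" where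
  "ext X \<equiv> case_sum X (\<lambda>_. 0)"

lemma ev_holo: "holo f \<Longrightarrow> ev f (case_sum y \<eta>) = ev f (case_sum y \<eta>')" for f :: "('k::finite + 'k) pol"
  by (rule ev_cong_pd[where V = "range Inl"]) (auto simp: holo_def image_iff, metis sum.exhaust)

lemma holo_D_iter: "(\<And>k. holo (X k)) \<Longrightarrow> holo f \<Longrightarrow> holo ((D X ^^ i) f)"
  by (induction i) (auto intro: holo_D)

text \<open>The field does not move the conjugate variables and its coefficients do not see them, so
  one orbit point serves for every \<eta>; the value \<open>\<eta>\<^sub>0\<close> used to write its
  coordinates is a dummy.\<close>

lemma flow_holo:
  assumes X: "\<And>k. holo (X k)"
    and s: "\<And>k. summable (\<lambda>j. norm (flow_term (ext X) (case_sum y \<eta>\<^sub>0) s (var (Inl k)) j))"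
  shows "ev f (case_sum (\<lambda>k. \<Sum>j. flow_term (ext X) (case_sum y \<eta>\<^sub>0) s (var (Inl k)) j) \<eta>) = (\<Sum>j. flow_term (ext X) (case_sum y \<eta>) s f j)"
proof -
  have e: "flow_term (ext X) (case_sum y \<eta>) s (var (Inl k)) j = flow_term (ext X) (case_sum y \<eta>\<^sub>0) s (var (Inl k)) j" for k j
    using ev_holo[OF holo_D_iter[OF X holo_simps(4)[of k], where i = j], where y = y and \<eta> = \<eta> and \<eta>' = \<eta>\<^sub>0]
    by (simp add: flow_term_def D_def)
  have z: "(der (ext X) ^^ j) (var (Inr k)) = 0" if "j \<noteq> 0" for k j
    using that by (cases j) (auto simp: funpow_Suc_right simp del: funpow.simps)
  then have r: "flow_term (ext X) (case_sum y \<eta>) s (var (Inr k)) = (\<lambda>j. if j = 0 then \<eta> k else 0)" for k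
    by (auto simp: flow_term_def)
  have "summable (\<lambda>j. norm (flow_term (ext X) (case_sum y \<eta>) s (var v) j))" for v
    using s by (cases v) (auto simp: e r intro!: summable_finite[of "{0}"] split: if_splits)
  from flow_hom[OF this] have "ev f (\<lambda>v. \<Sum>j. flow_term (ext X) (case_sum y \<eta>) s (var v) j) = (\<Sum>j. flow_term (ext X) (case_sum y \<eta>) s f j)"
    by blast
  moreover have "(\<lambda>v. \<Sum>j. flow_term (ext X) (case_sum y \<eta>) s (var v) j)
      = case_sum (\<lambda>k. \<Sum>j. flow_term (ext X) (case_sum y \<eta>\<^sub>0) s (var (Inl k)) j) \<eta>"
  proof
    fix v
    have "(\<Sum>j. if j = 0 then \<eta> k else 0) = \<eta> k" for k
      using sums_single[of 0 "\<lambda>_. \<eta> k", THEN sums_unique] by simp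
    then show "(\<Sum>j. flow_term (ext X) (case_sum y \<eta>) s (var v) j)
        = case_sum (\<lambda>k. \<Sum>j. flow_term (ext X) (case_sum y \<eta>\<^sub>0) s (var (Inl k)) j) \<eta> v"
      by (cases v) (auto simp: e r)
  qed
  ultimately show ?thesis by simp
qed

section \<open>Nilpotent functions, on which the flow is polynomial in time\<close>

definition nilp :: "('v::finite \<Rightarrow> 'v pol) \<Rightarrow> 'v pol \<Rightarrow> bool" where
  "nilp A f \<longleftrightarrow> (\<exists>N. (der A ^^ N) f = 0)"

lemma der_iter_ge: "(der A ^^ N) f = 0 \<Longrightarrow> N \<le> k \<Longrightarrow> (der A ^^ k) f = 0"
  using funpow_add[of "k - N" N "der A"] by (simp add: fun_eq_iff)

lemma nilp_der: "nilp A (der A f) \<longleftrightarrow> nilp A f"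
proof
  assume "nilp A (der A f)"
  then obtain N where "(der A ^^ Suc N) f = 0" by (auto simp: nilp_def funpow_swap1)
  then show "nilp A f" unfolding nilp_def by blast
next
  assume "nilp A f"
  then obtain N where "(der A ^^ N) f = 0" by (auto simp: nilp_def)
  then have "(der A ^^ Suc N) f = 0" by simp
  then show "nilp A (der A f)" unfolding nilp_def by (metis funpow_Suc_right o_apply)
qed

lemma nilp_iter: "nilp A f \<Longrightarrow> nilp A ((der A ^^ k) f)"
  by (induction k) (auto simp: nilp_der)

lemma nilp_add: "nilp A f \<Longrightarrow> nilp A g \<Longrightarrow> nilp A (f + g)"
proof -
  assume "nilp A f" "nilp A g"
  then obtain N M where "(der A ^^ N) f = 0" "(der A ^^ M) g = 0" by (auto simp: nilp_def)
  then have "(der A ^^ (N + M)) f = 0" "(der A ^^ (N + M)) g = 0"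
    by (auto intro: der_iter_ge)
  then show ?thesis unfolding nilp_def by (metis der_iter_add add.right_neutral)
qed

lemma der_iter_mult_0:
  assumes "(der A ^^ N) f = 0" "(der A ^^ M) g = 0" "N + M \<le> Suc k"
  shows "(der A ^^ k) (f * g) = 0"
  unfolding der_iter_mult
proof (intro sum.neutral ballI)
  fix i assume "i \<in> {..k}"
  then have "N \<le> i \<or> M \<le> k - i" using assms(3) by auto
  then have "(der A ^^ i) f = 0 \<or> (der A ^^ (k - i)) g = 0" using assms by (blast intro: der_iter_ge)
  then show "of_nat (k choose i) * ((der A ^^ i) f * (der A ^^ (k - i)) g) = 0" by auto
qed

lemma nilp_mult: "nilp A f \<Longrightarrow> nilp A g \<Longrightarrow> nilp A (f * g)"
proof -
  assume "nilp A f" "nilp A g"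
  then obtain N M where "(der A ^^ N) f = 0" "(der A ^^ M) g = 0" by (auto simp: nilp_def)
  then have "(der A ^^ (N + M)) (f * g) = 0" by (auto intro: der_iter_mult_0)
  then show ?thesis unfolding nilp_def by blast
qed

lemma nilp_0 [simp]: "nilp A 0"
  unfolding nilp_def by (metis funpow_0)
lemma nilp_cst_mult: "nilp A f \<Longrightarrow> nilp A (cst c * f)"
  unfolding nilp_def by (auto simp: der_iter_cst_mult)
lemma nilp_sum: "(\<And>i. i \<in> S \<Longrightarrow> nilp A (f i)) \<Longrightarrow> nilp A (sum f S)"
  by (induction S rule: infinite_finite_induct) (auto intro: nilp_add)

lemma flow_term_suminf:
  assumes "(der A ^^ N) f = 0"
  shows "(\<Sum>k. flow_term A x s f k) = (\<Sum>k<N. flow_term A x s f k)"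
proof (rule suminf_finite)
  fix k assume "k \<notin> {..<N}"
  then show "flow_term A x s f k = 0" using der_iter_ge[OF assms, of k] by (simp add: flow_term_def)
qed simp

text \<open>The group law of the flow, evaluated on a function killed by a power of the field.\<close>

lemma flow_term_group:
  assumes "(der A ^^ N) f = 0"
  shows "(\<Sum>j<N. (\<Sum>k<N. flow_term A x t ((der A ^^ j) f) k) * s ^ j / fact j) = (\<Sum>k<N. flow_term A x (t + s) f k)"
proof -
  define a where "a m = ev ((der A ^^ m) f) x" for m
  have a0: "a m = 0" if "N \<le> m" for m using der_iter_ge[OF assms that] by (simp add: a_def)
  define g where "g j k = a (j + k) * t ^ k / fact k * s ^ j / fact j" for j k
  have fp: "(der A ^^ k) ((der A ^^ j) f) = (der A ^^ (j + k)) f" for j k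
    by (metis add.commute comp_apply funpow_add)
  have "(\<Sum>j<N. (\<Sum>k<N. flow_term A x t ((der A ^^ j) f) k) * s ^ j / fact j) = (\<Sum>j<N. \<Sum>k<N. g j k)"
    by (simp add: flow_term_def g_def a_def sum_distrib_right sum_divide_distrib fp)
  also have "\<dots> = (\<Sum>(j, k)\<in>{..<N} \<times> {..<N}. g j k)" by (simp add: sum.cartesian_product)
  \<comment> \<open>Terms with j + k at least N vanish by nilpotency, so the square may be cut down
    to a triangle and summed along its diagonals.\<close>
  also have "\<dots> = (\<Sum>(j, k)\<in>{(j, k). j + k < N}. g j k)"
    by (rule sum.mono_neutral_right) (auto simp: g_def, metis a0 not_less)
  also have "\<dots> = (\<Sum>k<N. \<Sum>i\<le>k. g i (k - i))" by (rule sum.triangle_reindex)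
  also have "\<dots> = (\<Sum>k<N. flow_term A x (t + s) f k)"
  proof (rule sum.cong)
    fix k assume "k \<in> {..<N}"
    have "flow_term A x (t + s) f k = a k * (\<Sum>i\<le>k. of_nat (k choose i) * s ^ i * t ^ (k - i)) / fact k"
      by (simp add: flow_term_def a_def binomial_ring[of s t k, symmetric] add.commute)
    also have "\<dots> = (\<Sum>i\<le>k. g i (k - i))"
      unfolding sum_distrib_left sum_divide_distrib
    proof (rule sum.cong)
      fix i assume "i \<in> {..k}"
      then have "of_nat (k choose i) = (fact k / (fact i * fact (k - i)) :: complex)"
        by (simp add: binomial_fact)
      with \<open>i \<in> {..k}\<close> show "a k * (of_nat (k choose i) * s ^ i * t ^ (k - i)) / fact k = g i (k - i)"
        by (simp add: g_def field_simps)
    qed simp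
    finally show "(\<Sum>i\<le>k. g i (k - i)) = flow_term A x (t + s) f k" ..
  qed simp
  finally show ?thesis .
qed

lemma bounded_fun_subseq:
  fixes y :: "nat \<Rightarrow> 'k::finite \<Rightarrow> complex"
  assumes "\<And>n k. norm (y n k) \<le> R"
  shows "\<exists>\<zeta> r. strict_mono (r :: nat \<Rightarrow> nat) \<and> (\<forall>k. (\<lambda>n. y (r n) k) \<longlonglongrightarrow> \<zeta> k)"
proof -
  define Y :: "nat \<Rightarrow> complex^'k" where "Y n = (\<chi> k. y n k)" for n
  have "norm (Y n) \<le> real CARD('k) * R" for n
  proof -
    have "norm (Y n) \<le> (\<Sum>k\<in>UNIV. norm (Y n $ k))" unfolding norm_vec_def by (rule L2_set_le_sum) simp
    also have "\<dots> \<le> (\<Sum>k\<in>(UNIV::'k set). R)" by (intro sum_mono) (simp add: Y_def assms)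
    finally show ?thesis by simp
  qed
  then have "bounded (range Y)" by (auto simp: bounded_iff)
  then obtain L r where "strict_mono r" "(Y \<circ> r) \<longlonglongrightarrow> L"
    using bounded_imp_convergent_subsequence by blast
  then have "\<forall>k. (\<lambda>n. y (r n) k) \<longlonglongrightarrow> L $ k"
    using tendsto_vec_nth[of "Y \<circ> r" L sequentially] by (auto simp: Y_def o_def)
  then show ?thesis using \<open>strict_mono r\<close> by (intro exI[of _ "\<lambda>k. L $ k"] exI[of _ r]) simp
qed

section \<open>Long-time behaviour of the flow\<close>

text \<open>The index \<open>None\<close> stands for the coordinate \<open>w\<close>. The assumption \<open>null\<close> is all that is used of the absence of
  complex submanifolds in the zero set: a common zero of all components spreads to its complex weighted orbit.\<close>

locale model =
  fixes \<delta> :: "'n::finite option \<Rightarrow> real" and p :: "('n option + 'n option) pol"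
  assumes \<delta>_None: "\<delta> None = 1"
    and \<delta>_inv: "\<exists>M::nat. M \<ge> 2 \<and> real M * \<delta> (Some j) = 1"
    and p_real: "C p = p"
    and p_wfree: "pd (Inl None) p = 0"
    and p_weight: "Eu (wh \<delta>) p + Eu (wa \<delta>) p = p"
    and p_mixed: "h \<le> 0 \<or> h \<ge> 1 \<Longrightarrow> wcomp (wh \<delta>) h p = 0"
    and null: "\<zeta> None = 0 \<Longrightarrow> (\<And>h. ev (wcomp (wh \<delta>) h p) (case_sum \<zeta> (cnj \<circ> \<zeta>)) = 0) \<Longrightarrow> \<zeta> k = 0"
    and N0: "(\<And>k. holo (A k)) \<Longrightarrow> (\<And>k. pd (Inl None) (A k) = 0) \<Longrightarrow> A None = 0 \<Longrightarrow>
      D A (wcomp (wh \<delta>) (1 / 2) p) = 0 \<Longrightarrow> A k = 0"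
    and N1: "(\<And>k. holo (A k)) \<Longrightarrow> (\<And>k. pd (Inl None) (A k) = 0) \<Longrightarrow> A None = 0 \<Longrightarrow>
      D A (wcomp (wh \<delta>) 1 (p * p)) = 0 \<Longrightarrow> A k = 0"
begin

text \<open>Since \<open>p\<close> has weight 1, the component of holomorphic weight \<open>h\<close> is the one of signature \<open>2 h - 1\<close>;
  in particular \<open>P (1/2)\<close> is the balanced part.\<close>

definition P :: "real \<Rightarrow> ('n option + 'n option) pol" where "P h = wcomp (wh \<delta>) h p"

lemma \<delta>_pos: "0 < \<delta> k"
proof (cases k)
  case (Some j)
  then show ?thesis using \<delta>_inv[of j] by (metis of_nat_0_le_iff zero_less_mult_pos zero_less_one le_less mult_zero_left zero_neq_one)
qed (simp add: \<delta>_None)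

lemma \<delta>_le: "\<delta> (Some j) \<le> 1 / 2"
proof -
  obtain M :: nat where M: "M \<ge> 2" "real M * \<delta> (Some j) = 1" using \<delta>_inv by blast
  have "2 * \<delta> (Some j) \<le> real M * \<delta> (Some j)"
    using M(1) \<delta>_pos[of "Some j"] by (intro mult_right_mono) auto
  then show ?thesis using M(2) by simp
qed

lemma wh_nonneg: "0 \<le> wh \<delta> v" and wa_nonneg: "0 \<le> wa \<delta> v"
  using \<delta>_pos by (cases v; simp add: less_imp_le)+

lemma whom_P: "whom (wh \<delta>) h (P h)"
  unfolding P_def by (rule whom_cmp)

lemma P_0: "h \<le> 0 \<or> 1 \<le> h \<Longrightarrow> P h = 0"
  unfolding P_def by (rule p_mixed)

lemma p_wfree': "pd (Inr None) p = 0"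
  using pd_C[of None p] p_wfree p_real by simp

lemma Eu_add: "Eu \<omega> (f + g) = Eu \<omega> f + Eu \<omega> g"
  by (simp add: Eu_def)

lemma Eu_wa_wh: "Eu (wa \<delta>) (Eu (wh \<delta>) f) = Eu (wh \<delta>) (Eu (wa \<delta>) f)"
  unfolding Eu_def by (rule der_commute) (auto simp: der_mult)

lemma whom_P_wa: "whom (wa \<delta>) (1 - h) (P h)"
proof -
  have 1: "wcomp (wh \<delta>) h (Eu (wa \<delta>) p) = Eu (wa \<delta>) (P h)"
    unfolding P_def
    using wcomp_linear[where L = "Eu (wa \<delta>)" and \<omega> = "wh \<delta>" and \<omega>' = "wh \<delta>" and l = 0 and a = h and f = p]
    by (simp add: Eu_add whom_def Eu_wa_wh[symmetric]) (simp add: Eu_def)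
  have 2: "wcomp (wh \<delta>) h (Eu (wh \<delta>) p) = rc h * P h"
    using wcomp_linear[where L = "Eu (wh \<delta>)" and \<omega> = "wh \<delta>" and \<omega>' = "wh \<delta>" and l = 0 and a = h and f = p]
      whom_P[of h]
    by (simp add: Eu_add whom_def P_def) (simp add: Eu_def)
  have "P h = rc h * P h + Eu (wa \<delta>) (P h)"
    using arg_cong[OF p_weight, of "wcomp (wh \<delta>) h"] 1 2 by (simp add: P_def)
  then show ?thesis by (simp add: whom_def cst_hom algebra_simps)
qed

lemma P_finite: "finite {h. P h \<noteq> 0}"
  unfolding P_def by (rule wcomp_finite)

lemma P_sum: "(\<Sum>h | P h \<noteq> 0. P h) = p"
  unfolding P_def by (rule wcomp_sum_all) (auto simp: wcomp_finite)

lemma C_P: "C (P h) = P (1 - h)"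
proof -
  have "P (1 - h) = wcomp (wh \<delta>) (1 - h) (C p)" by (simp add: P_def p_real)
  also have "C p = (\<Sum>h | P h \<noteq> 0. C (P h))" using arg_cong[OF P_sum, of C] by simp
  also have "wcomp (wh \<delta>) (1 - h) \<dots> = (\<Sum>g | P g \<noteq> 0. if g = h then C (P g) else 0)"
    unfolding wcomp_sum
  proof (rule sum.cong)
    fix g
    have "whom (wh \<delta>) (1 - g) (C (P g))" using whom_P_wa by (simp add: whom_C')
    then show "wcomp (wh \<delta>) (1 - h) (C (P g)) = (if g = h then C (P g) else 0)"
      by (auto simp: wcomp_hom)
  qed simp
  also have "\<dots> = C (P h)" using P_finite by (auto simp: sum.delta)
  finally show ?thesis ..
qed

lemma P_wfree: "pd (Inl None) (P h) = 0"
proof -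
  define A :: "'n option \<Rightarrow> ('n option + 'n option) pol" where "A = (\<lambda>k. if k = None then 1 else 0)"
  have DA: "D A f = pd (Inl None) f" for f
  proof -
    have "D A f = (\<Sum>k\<in>UNIV. if k = None then pd (Inl k) f else 0)"
      unfolding D_pd by (rule sum.cong) (auto simp: A_def)
    then show ?thesis by simp
  qed
  have "field_weight \<delta> (- 1) A"
    unfolding field_weight_def A_def using whom_cst[of "wh \<delta>" 1] by (auto simp: \<delta>_None cst_hom)
  from wcomp_D[OF this, of "h - 1" p] show ?thesis by (simp add: DA p_wfree P_def)
qed

text \<open>By homogeneity and compactness, the absence of common zeros makes the components coercive.\<close>

lemma P_coercive:
  fixes y :: "nat \<Rightarrow> 'n option \<Rightarrow> complex"
  assumes y0: "\<And>n. y n None = 0"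
    and b: "\<And>h \<eta>. \<exists>B. \<forall>n. norm (ev (P h) (case_sum (y n) \<eta>)) \<le> B"
  shows "\<exists>R. \<forall>n k. norm (y n k) \<le> R"
proof (rule ccontr)
  assume unb: "\<not> ?thesis"
  \<comment> \<open>A weighted gauge: multiplying each coordinate k by t^(\<delta> k) multiplies it
    by t, so dilation by its inverse brings every point to gauge 1.\<close>
  define \<rho> where "\<rho> n = (\<Sum>k\<in>UNIV. norm (y n k) powr (1 / \<delta> k))" for n
  have \<rho>k: "norm (y n k) powr (1 / \<delta> k) \<le> \<rho> n" for n k
    unfolding \<rho>_def by (rule member_le_sum) auto
  have "\<exists>n. \<rho> n > real m" for m
  proof (rule ccontr)
    assume "\<not> ?thesis"
    then have le: "\<rho> n \<le> real m" for n by (simp add: not_less)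
    have "norm (y n k) \<le> (\<Sum>k\<in>UNIV. real m powr \<delta> k)" for n k
    proof -
      have "norm (y n k) = (norm (y n k) powr (1 / \<delta> k)) powr \<delta> k"
        using \<delta>_pos[of k] by (simp add: powr_powr)
      also have "\<dots> \<le> real m powr \<delta> k"
        using \<rho>k[of n k] le[of n] \<delta>_pos[of k] by (intro powr_mono2) auto
      also have "\<dots> \<le> (\<Sum>k\<in>UNIV. real m powr \<delta> k)" by (rule member_le_sum) auto
      finally show ?thesis .
    qed
    then show False using unb by blast
  qed
  then obtain s where s: "\<And>m. \<rho> (s m) > real m" by metis
  define \<xi> where "\<xi> m k = exp (of_real (\<delta> k) * of_real (- ln (\<rho> (s m)))) * y (s m) k" for m k
  have pos: "0 < \<rho> (s m)" for m using s[of m] by (meson of_nat_0_le_iff order_le_less_trans)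
  have \<xi>_norm: "norm (\<xi> m k) powr (1 / \<delta> k) = norm (y (s m) k) powr (1 / \<delta> k) / \<rho> (s m)" for m k
  proof -
    have "norm (\<xi> m k) = \<rho> (s m) powr (- \<delta> k) * norm (y (s m) k)"
      using pos[of m] by (simp add: \<xi>_def norm_mult powr_def norm_exp_eq_Re flip: of_real_mult)
    then have "norm (\<xi> m k) powr (1 / \<delta> k) = (\<rho> (s m) powr (- \<delta> k)) powr (1 / \<delta> k) * norm (y (s m) k) powr (1 / \<delta> k)"
      by (simp add: powr_mult)
    also have "(\<rho> (s m) powr (- \<delta> k)) powr (1 / \<delta> k) = 1 / \<rho> (s m)"
      unfolding powr_powr using \<delta>_pos[of k] pos[of m] by (simp add: powr_minus_divide)
    finally show ?thesis by simp
  qed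
  have sum1: "(\<Sum>k\<in>UNIV. norm (\<xi> m k) powr (1 / \<delta> k)) = 1" for m
    unfolding \<xi>_norm using pos[of m] by (simp add: sum_divide_distrib[symmetric] flip: \<rho>_def)
  have "norm (\<xi> m k) \<le> 1" for m k
  proof -
    have "norm (\<xi> m k) powr (1 / \<delta> k) \<le> (\<Sum>k\<in>UNIV. norm (\<xi> m k) powr (1 / \<delta> k))"
      by (rule member_le_sum) auto
    then have "norm (\<xi> m k) powr (1 / \<delta> k) \<le> 1" using sum1[of m] by simp
    then have "(norm (\<xi> m k) powr (1 / \<delta> k)) powr \<delta> k \<le> 1 powr \<delta> k"
      using \<delta>_pos[of k] by (intro powr_mono2) auto
    then show ?thesis using \<delta>_pos[of k] by (simp add: powr_powr)
  qed
  then obtain \<zeta> r where r: "strict_mono r" "\<And>k. (\<lambda>n. \<xi> (r n) k) \<longlonglongrightarrow> \<zeta> k"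
    using bounded_fun_subseq[of \<xi> 1] by blast
  have "(\<lambda>n. \<Sum>k\<in>UNIV. norm (\<xi> (r n) k) powr (1 / \<delta> k)) \<longlonglongrightarrow> (\<Sum>k\<in>UNIV. norm (\<zeta> k) powr (1 / \<delta> k))"
    using \<delta>_pos by (intro tendsto_sum tendsto_powr2 tendsto_norm r tendsto_const) auto
  then have one: "(\<Sum>k\<in>UNIV. norm (\<zeta> k) powr (1 / \<delta> k)) = 1"
    by (simp add: sum1 LIMSEQ_const_iff)
  \<comment> \<open>After normalisation a component of weight h > 0 carries the factor \<rho>^(-h),
    which tends to 0 against the assumed bound; for h \<le> 0 the component is zero.\<close>
  have "ev (P h) (case_sum \<zeta> \<eta>) = 0" for h \<eta>
  proof (cases "h \<le> 0")
    case True
    then show ?thesis by (simp add: P_0)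
  next
    case False
    obtain B where B: "\<And>n. norm (ev (P h) (case_sum (y n) \<eta>)) \<le> B" using b by blast
    have e: "ev (P h) (case_sum (\<xi> m) \<eta>) = exp (of_real h * of_real (- ln (\<rho> (s m)))) * ev (P h) (case_sum (y (s m)) \<eta>)" for m
    proof -
      have "(\<lambda>v. exp (of_real (wh \<delta> v) * of_real (- ln (\<rho> (s m)))) * case_sum (y (s m)) \<eta> v) = case_sum (\<xi> m) \<eta>"
        by (auto simp: \<xi>_def split: sum.splits)
      then show ?thesis using whom_scale[OF whom_P, of h "of_real (- ln (\<rho> (s m)))" "case_sum (y (s m)) \<eta>"] by simp
    qed
    have le: "norm (ev (P h) (case_sum (\<xi> m) \<eta>)) \<le> \<rho> (s m) powr (- h) * B" for m
    proof -
      have "norm (ev (P h) (case_sum (\<xi> m) \<eta>)) = \<rho> (s m) powr (- h) * norm (ev (P h) (case_sum (y (s m)) \<eta>))"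
        unfolding e using pos[of m] by (simp add: norm_mult powr_def norm_exp_eq_Re flip: of_real_mult)
      also have "\<dots> \<le> \<rho> (s m) powr (- h) * B" by (intro mult_left_mono B) simp
      finally show ?thesis .
    qed
    have "filterlim (\<lambda>m. \<rho> (s (r m))) at_top sequentially"
    proof (rule filterlim_at_top_mono[OF filterlim_real_sequentially], rule always_eventually, rule allI)
      fix m
      have "real m \<le> real (r m)" using seq_suble[OF r(1)] by simp
      then show "real m \<le> \<rho> (s (r m))" using s[of "r m"] by linarith
    qed
    then have "(\<lambda>m. \<rho> (s (r m)) powr (- h) * B) \<longlonglongrightarrow> 0 * B"
      using False by (intro tendsto_intros tendsto_neg_powr) auto
    then have "(\<lambda>m. ev (P h) (case_sum (\<xi> (r m)) \<eta>)) \<longlonglongrightarrow> 0"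
      by (intro Lim_null_comparison[OF always_eventually[OF allI[OF le]]]) simp
    moreover have "(\<lambda>m. ev (P h) (case_sum (\<xi> (r m)) \<eta>)) \<longlonglongrightarrow> ev (P h) (case_sum \<zeta> \<eta>)"
      by (intro continuous_ev) (auto split: sum.splits intro: r)
    ultimately show ?thesis using LIMSEQ_unique by blast
  qed
  then have "\<zeta> k = 0" for k
    using null[of \<zeta>] r(2)[of None] by (auto simp: P_def \<xi>_def y0 LIMSEQ_const_iff)
  then show False using one \<delta>_pos by simp
qed

lemma nilp_var_None: "X None = 0 \<Longrightarrow> (der (ext X) ^^ 1) (var (Inl None)) = 0"
  by simp

text \<open>A polynomial field may blow up in finite time. Here it cannot: the components of p are
  nilpotent, hence bounded on bounded time intervals, and they are coercive. The attainable times
  form a nonempty open and closed subset of the half line.\<close>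

lemma flow_global:
  assumes X: "\<And>k. holo (X k)" "X None = 0" and nil: "\<And>h. nilp (ext X) (P h)"
    and z: "z None = 0" and t: "0 \<le> t"
  shows "\<exists>y. \<forall>f \<eta>. nilp (ext X) f \<longrightarrow> ev f (case_sum y \<eta>) = (\<Sum>k. flow_term (ext X) (case_sum z \<eta>) (of_real t) f k)"
proof -
  \<comment> \<open>A point is tied to the time t only through its values on nilpotent functions;
    these are polynomials in t and therefore pass to limits.\<close>
  define \<Phi> where "\<Phi> t y \<longleftrightarrow> (\<forall>f \<eta>. nilp (ext X) f \<longrightarrow>
    ev f (case_sum y \<eta>) = (\<Sum>k. flow_term (ext X) (case_sum z \<eta>) (of_real t) f k))" for t :: real and y
  define T where "T = {t. 0 \<le> t \<and> (\<exists>y. \<Phi> t y)}"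
  have yN: "y None = 0" if "\<Phi> t y" for t y
  proof -
    have v: "(der (ext X) ^^ 1) (var (Inl None)) = 0" using nilp_var_None[of X, OF X(2)] .
    then have "ev (var (Inl None)) (case_sum y z) = (\<Sum>k. flow_term (ext X) (case_sum z z) (of_real t) (var (Inl None)) k)"
      using that unfolding \<Phi>_def nilp_def by blast
    also have "\<dots> = 0" unfolding flow_term_suminf[OF v] using z by (simp add: flow_term_def)
    finally show ?thesis by simp
  qed
  have op: "\<exists>\<epsilon>>0. \<forall>u. dist u t < \<epsilon> \<longrightarrow> (\<exists>y. \<Phi> u y)" if ty: "\<Phi> t y" for t y
  proof -
    obtain \<epsilon> where \<epsilon>: "\<epsilon> > 0 \<and> (\<forall>s. norm s < \<epsilon> \<longrightarrow> (\<forall>v. summable (\<lambda>k. norm (flow_term (ext X) (case_sum y (\<lambda>_. 0)) s (var v) k))))"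
      using flow_summable[of "ext X" "case_sum y (\<lambda>_. 0)"] ..
    have "\<exists>y. \<Phi> u y" if u: "dist u t < \<epsilon>" for u
    proof -
      define s where "s = complex_of_real (u - t)"
      have "norm s < \<epsilon>" using u by (simp add: s_def dist_real_def flip: of_real_diff)
      then have sb: "\<And>k. summable (\<lambda>j. norm (flow_term (ext X) (case_sum y (\<lambda>_. 0)) s (var (Inl k)) j))" using \<epsilon> by simp
      define y' where "y' = (\<lambda>k. \<Sum>j. flow_term (ext X) (case_sum y (\<lambda>_. 0)) s (var (Inl k)) j)"
      have "\<Phi> u y'" unfolding \<Phi>_def
      proof (intro allI impI)
        fix f \<eta> assume nf: "nilp (ext X) f"
        then obtain N where N: "(der (ext X) ^^ N) f = 0" by (auto simp: nilp_def)
        have Nj: "(der (ext X) ^^ N) ((der (ext X) ^^ j) f) = 0" for j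
          using der_iter_ge[OF N, of "N + j"] by (simp add: funpow_add)
        have "ev f (case_sum y' \<eta>) = (\<Sum>j. flow_term (ext X) (case_sum y \<eta>) s f j)"
          unfolding y'_def by (rule flow_holo[OF X(1) sb])
        also have "\<dots> = (\<Sum>j<N. ev ((der (ext X) ^^ j) f) (case_sum y \<eta>) * s ^ j / fact j)"
          unfolding flow_term_suminf[OF N] by (simp add: flow_term_def)
        also have "\<dots> = (\<Sum>j<N. (\<Sum>k<N. flow_term (ext X) (case_sum z \<eta>) (of_real t) ((der (ext X) ^^ j) f) k) * s ^ j / fact j)"
          using ty nilp_iter[OF nf] unfolding \<Phi>_def by (simp add: flow_term_suminf[OF Nj])
        also have "\<dots> = (\<Sum>k. flow_term (ext X) (case_sum z \<eta>) (of_real u) f k)"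
          unfolding flow_term_group[OF N] flow_term_suminf[OF N] by (simp add: s_def)
        finally show "ev f (case_sum y' \<eta>) = (\<Sum>k. flow_term (ext X) (case_sum z \<eta>) (of_real u) f k)" .
      qed
      then show ?thesis by blast
    qed
    then show ?thesis using \<epsilon> by blast
  qed
  have lim: "(\<lambda>n. \<Sum>k. flow_term (ext X) x (of_real (u n)) f k) \<longlonglongrightarrow> (\<Sum>k. flow_term (ext X) x (of_real l) f k)"
    if nf: "nilp (ext X) f" and ul: "u \<longlonglongrightarrow> l" for f x l and u :: "nat \<Rightarrow> real"
  proof -
    obtain N where N: "(der (ext X) ^^ N) f = 0" using nf by (auto simp: nilp_def)
    show ?thesis unfolding flow_term_suminf[OF N] unfolding flow_term_def
      by (intro tendsto_intros ul) auto
  qed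
  have "closed T"
    unfolding closed_sequential_limits
  proof (intro allI impI, elim conjE)
    fix u l assume uT: "\<forall>n. u n \<in> T" and ul: "u \<longlonglongrightarrow> l"
    then obtain y where y: "\<And>n. \<Phi> (u n) (y n)" unfolding T_def by simp metis
    have "\<exists>R. \<forall>n k. norm (y n k) \<le> R"
    proof (rule P_coercive)
      show "y n None = 0" for n using yN y by blast
      fix h \<eta>
      have "convergent (\<lambda>n. \<Sum>k. flow_term (ext X) (case_sum z \<eta>) (of_real (u n)) (P h) k)"
        using lim[OF nil ul] by (auto simp: convergent_def)
      then have "Bseq (\<lambda>n. ev (P h) (case_sum (y n) \<eta>))"
        using y nil unfolding \<Phi>_def by (simp add: convergent_imp_Bseq)
      then show "\<exists>B. \<forall>n. norm (ev (P h) (case_sum (y n) \<eta>)) \<le> B" by (auto simp: Bseq_def)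
    qed
    then obtain \<zeta> r where r: "strict_mono (r :: nat \<Rightarrow> nat)" "\<And>k. (\<lambda>n. y (r n) k) \<longlonglongrightarrow> \<zeta> k"
      using bounded_fun_subseq[of y] by blast
    have "\<Phi> l \<zeta>" unfolding \<Phi>_def
    proof (intro allI impI)
      fix f \<eta> assume nf: "nilp (ext X) f"
      have "(\<lambda>n. ev f (case_sum (y (r n)) \<eta>)) \<longlonglongrightarrow> ev f (case_sum \<zeta> \<eta>)"
        by (intro continuous_ev) (auto split: sum.splits intro: r)
      moreover have "(\<lambda>n. ev f (case_sum (y (r n)) \<eta>)) \<longlonglongrightarrow> (\<Sum>k. flow_term (ext X) (case_sum z \<eta>) (of_real l) f k)"
        using lim[OF nf LIMSEQ_subseq_LIMSEQ[OF ul r(1)], of "case_sum z \<eta>"] y nf unfolding \<Phi>_def by simp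
      ultimately show "ev f (case_sum \<zeta> \<eta>) = (\<Sum>k. flow_term (ext X) (case_sum z \<eta>) (of_real l) f k)"
        using LIMSEQ_unique by blast
    qed
    moreover have "0 \<le> l" using uT by (intro LIMSEQ_le_const[OF ul]) (auto simp: T_def)
    ultimately show "l \<in> T" unfolding T_def by blast
  qed
  then have cl: "closedin (top_of_set {0..}) T"
    by (auto simp: closedin_closed T_def intro!: exI[of _ T])
  have opn: "openin (top_of_set {0..}) T"
    unfolding openin_euclidean_subtopology_iff
  proof (intro conjI ballI)
    show "T \<subseteq> {0..}" by (auto simp: T_def)
    fix t assume "t \<in> T"
    then obtain y where "\<Phi> t y" by (auto simp: T_def)
    from op[OF this] show "\<exists>e>0. \<forall>x'\<in>{0..}. dist x' t < e \<longrightarrow> x' \<in> T"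
      by (auto simp: T_def)
  qed
  have "\<Phi> 0 z" unfolding \<Phi>_def
  proof (intro allI impI)
    fix f \<eta>
    have "flow_term (ext X) (case_sum z \<eta>) 0 f = (\<lambda>k. if k = 0 then ev f (case_sum z \<eta>) else 0)"
      by (auto simp: flow_term_def)
    moreover have "(\<Sum>k. if k = 0 then ev f (case_sum z \<eta>) else 0) = ev f (case_sum z \<eta>)"
      using sums_single[of 0 "\<lambda>_. ev f (case_sum z \<eta>)", THEN sums_unique] by simp
    ultimately show "ev f (case_sum z \<eta>) = (\<Sum>k. flow_term (ext X) (case_sum z \<eta>) (of_real 0) f k)"
      by simp
  qed
  then have "T \<noteq> {}" by (auto simp: T_def)
  moreover have "connected {0::real..}" by (intro convex_connected) simp
  ultimately have "T = {0..}" using cl opn unfolding connected_clopen by blast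
  then show ?thesis using t unfolding T_def \<Phi>_def by auto
qed

definition lead where "lead X \<alpha> z \<zeta> \<longleftrightarrow>
  (\<forall>f a \<eta> L. whom (wh \<delta>) a f \<longrightarrow> (\<forall>k. \<alpha> * a < real k \<longrightarrow> (D X ^^ k) f = 0) \<longrightarrow>
    (\<forall>i. real i = \<alpha> * a \<longrightarrow> ev ((D X ^^ i) f) (case_sum z \<eta>) / fact i = L) \<longrightarrow>
    ((\<nexists>i. real i = \<alpha> * a) \<longrightarrow> L = 0) \<longrightarrow> ev f (case_sum \<zeta> \<eta>) = L)"

lemma leadD:
  assumes "lead X \<alpha> z \<zeta>" "whom (wh \<delta>) a f" "\<And>k. \<alpha> * a < real k \<Longrightarrow> (D X ^^ k) f = 0"
    "\<And>i. real i = \<alpha> * a \<Longrightarrow> ev ((D X ^^ i) f) (case_sum z \<eta>) / fact i = L"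
    "(\<nexists>i. real i = \<alpha> * a) \<Longrightarrow> L = 0"
  shows "ev f (case_sum \<zeta> \<eta>) = L"
  using assms unfolding lead_def by simp

text \<open>Rescaled orbits accumulate at a point where each suitably bounded function takes the value of
  its leading coefficient along the orbit.\<close>

lemma flow_limit:
  assumes X: "\<And>k. holo (X k)" "X None = 0" and \<alpha>: "0 < \<alpha>"
    and nil: "\<And>h k. \<alpha> * h < real k \<Longrightarrow> (D X ^^ k) (P h) = 0"
    and z: "z None = 0"
  shows "\<exists>\<zeta>. \<zeta> None = 0 \<and> lead X \<alpha> z \<zeta>"
proof -
  have nilp: "nilp (ext X) f" if "\<And>k. \<alpha> * a < real k \<Longrightarrow> (D X ^^ k) f = 0" for f a
  proof -
    obtain k where "\<alpha> * a < real k" using reals_Archimedean2 by blast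
    then show ?thesis using that unfolding nilp_def D_def by blast
  qed
  have nilP: "nilp (ext X) (P h)" for h by (rule nilp[of h]) (rule nil)
  have "\<forall>n. \<exists>y. \<forall>f \<eta>. nilp (ext X) f \<longrightarrow>
      ev f (case_sum y \<eta>) = (\<Sum>k. flow_term (ext X) (case_sum z \<eta>) (of_real (real (Suc n))) f k)"
    using flow_global[where X = X and z = z, OF X nilP z] by (metis of_nat_0_le_iff)
  then obtain y where y: "\<And>n f \<eta>. nilp (ext X) f \<Longrightarrow>
      ev f (case_sum (y n) \<eta>) = (\<Sum>k. flow_term (ext X) (case_sum z \<eta>) (of_real (real (Suc n))) f k)" by metis
  have yN: "y n None = 0" for n
  proof -
    have v: "(der (ext X) ^^ 1) (var (Inl None)) = 0" using nilp_var_None[of X, OF X(2)] .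
    then have "ev (var (Inl None)) (case_sum (y n) z) = (\<Sum>k. flow_term (ext X) (case_sum z z) (of_real (real (Suc n))) (var (Inl None)) k)"
      using v by (intro y) (unfold nilp_def, blast)
    also have "\<dots> = 0" unfolding flow_term_suminf[OF v] using z by (simp add: flow_term_def)
    finally show ?thesis by simp
  qed
  \<comment> \<open>The point at time n + 1, contracted by (n + 1)^(-\<alpha> \<delta> k); the shift
    by one avoids the logarithm of 0.\<close>
  define \<xi> where "\<xi> n k = exp (of_real (\<delta> k) * of_real (- \<alpha> * ln (real (Suc n)))) * y n k" for n k
  have main: "(\<lambda>n. ev f (case_sum (\<xi> n) \<eta>)) \<longlonglongrightarrow> L"
    if f: "whom (wh \<delta>) a f" "\<And>k. \<alpha> * a < real k \<Longrightarrow> (D X ^^ k) f = 0"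
      "\<And>i. real i = \<alpha> * a \<Longrightarrow> ev ((D X ^^ i) f) (case_sum z \<eta>) / fact i = L" "(\<nexists>i. real i = \<alpha> * a) \<Longrightarrow> L = 0"
    for f a \<eta> L
  proof -
    define c where "c k = ev ((D X ^^ k) f) (case_sum z \<eta>) / fact k" for k
    obtain N where N: "\<alpha> * a < real N" using reals_Archimedean2 by blast
    then have N0: "(der (ext X) ^^ N) f = 0" using f(2) by (simp add: D_def)
    have nf: "nilp (ext X) f" by (rule nilp[of a]) (rule f(2))
    have e: "ev f (case_sum (\<xi> n) \<eta>) = (\<Sum>k<N. c k * of_real (real (Suc n) powr (real k - \<alpha> * a)))" for n
    proof -
      have "(\<lambda>v. exp (of_real (wh \<delta> v) * of_real (- \<alpha> * ln (real (Suc n)))) * case_sum (y n) \<eta> v) = case_sum (\<xi> n) \<eta>"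
        by (auto simp: \<xi>_def split: sum.splits)
      then have "ev f (case_sum (\<xi> n) \<eta>) = exp (of_real a * of_real (- \<alpha> * ln (real (Suc n)))) * ev f (case_sum (y n) \<eta>)"
        using whom_scale[OF f(1), of "of_real (- \<alpha> * ln (real (Suc n)))" "case_sum (y n) \<eta>"] by simp
      also have "exp (of_real a * of_real (- \<alpha> * ln (real (Suc n)))) = complex_of_real (real (Suc n) powr (- (\<alpha> * a)))"
        by (simp add: powr_def exp_of_real[symmetric] mult_ac)
      also have "ev f (case_sum (y n) \<eta>) = (\<Sum>k<N. c k * of_real (real (Suc n) powr real k))"
        unfolding y[OF nf] flow_term_suminf[OF N0]
        by (simp add: flow_term_def c_def D_def powr_realpow)
      finally show ?thesis
        by (simp add: sum_distrib_left powr_diff powr_minus field_simps)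
    qed
    \<comment> \<open>The k-th term carries the power k - \<alpha> a of the time: positive powers
      are excluded by the degree bound, negative ones die, and only k = \<alpha> a survives.\<close>
    have "(\<lambda>n. \<Sum>k<N. c k * of_real (real (Suc n) powr (real k - \<alpha> * a))) \<longlonglongrightarrow>
        (\<Sum>k<N. if real k = \<alpha> * a then c k else 0)"
    proof (rule tendsto_sum)
      fix k assume "k \<in> {..<N}"
      consider "real k = \<alpha> * a" | "real k < \<alpha> * a" | "\<alpha> * a < real k" by linarith
      then show "(\<lambda>n. c k * of_real (real (Suc n) powr (real k - \<alpha> * a))) \<longlonglongrightarrow> (if real k = \<alpha> * a then c k else 0)"
      proof cases
        case 1
        then show ?thesis by simp
      next
        case 2
        have "(\<lambda>n. real (Suc n) powr (real k - \<alpha> * a)) \<longlonglongrightarrow> 0"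
          using 2 by (intro tendsto_neg_powr filterlim_compose[OF filterlim_real_sequentially filterlim_Suc]) auto
        then have "(\<lambda>n. c k * of_real (real (Suc n) powr (real k - \<alpha> * a))) \<longlonglongrightarrow> c k * of_real 0"
          by (intro tendsto_intros)
        then show ?thesis using 2 by simp
      next
        case 3
        then show ?thesis using f(2) by (simp add: c_def)
      qed
    qed
    also have "(\<Sum>k<N. if real k = \<alpha> * a then c k else 0) = L"
    proof (cases "\<exists>i. real i = \<alpha> * a")
      case True
      then obtain i where i: "real i = \<alpha> * a" by blast
      then have "(\<Sum>k<N. if real k = \<alpha> * a then c k else 0) = (\<Sum>k<N. if k = i then c k else 0)"
        by (intro sum.cong) (auto simp flip: i)
      also have "\<dots> = c i" using N i by simp
      finally show ?thesis using f(3)[OF i] by (simp add: c_def)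
    next
      case False
      then show ?thesis using f(4) by (auto intro: sum.neutral)
    qed
    finally show ?thesis by (simp add: e)
  qed
  have "\<exists>R. \<forall>n k. norm (\<xi> n k) \<le> R"
  proof (rule P_coercive)
    show "\<xi> n None = 0" for n by (simp add: \<xi>_def yN)
    fix h \<eta>
    define L where "L = (if \<exists>i. real i = \<alpha> * h then ev ((D X ^^ (THE i. real i = \<alpha> * h)) (P h)) (case_sum z \<eta>) / fact (THE i. real i = \<alpha> * h) else 0)"
    have "(THE i. real i = \<alpha> * h) = i" if "real i = \<alpha> * h" for i
      by (rule the_equality[where P = "\<lambda>i. real i = \<alpha> * h", OF that]) (metis that of_nat_eq_iff)
    then have "(\<lambda>n. ev (P h) (case_sum (\<xi> n) \<eta>)) \<longlonglongrightarrow> L"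
      by (intro main[OF whom_P nil]) (auto simp: L_def)
    then have "Bseq (\<lambda>n. ev (P h) (case_sum (\<xi> n) \<eta>))"
      by (intro convergent_imp_Bseq) (auto simp: convergent_def)
    then show "\<exists>B. \<forall>n. norm (ev (P h) (case_sum (\<xi> n) \<eta>)) \<le> B" by (auto simp: Bseq_def)
  qed
  then obtain \<zeta> r where r: "strict_mono (r :: nat \<Rightarrow> nat)" "\<And>k. (\<lambda>n. \<xi> (r n) k) \<longlonglongrightarrow> \<zeta> k"
    using bounded_fun_subseq[of \<xi>] by blast
  show ?thesis
    unfolding lead_def
  proof (intro exI[of _ \<zeta>] conjI allI impI)
    show "\<zeta> None = 0" using r(2)[of None] by (simp add: \<xi>_def yN LIMSEQ_const_iff)
    fix f a \<eta> L
    assume f: "whom (wh \<delta>) a f" "\<forall>k. \<alpha> * a < real k \<longrightarrow> (D X ^^ k) f = 0"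
      "\<forall>i. real i = \<alpha> * a \<longrightarrow> ev ((D X ^^ i) f) (case_sum z \<eta>) / fact i = L" "(\<nexists>i. real i = \<alpha> * a) \<longrightarrow> L = 0"
    have "(\<lambda>n. ev f (case_sum (\<xi> n) \<eta>)) \<longlonglongrightarrow> L"
      using f by (intro main[OF f(1)]) auto
    from LIMSEQ_subseq_LIMSEQ[OF this r(1)] have "(\<lambda>n. ev f (case_sum (\<xi> (r n)) \<eta>)) \<longlonglongrightarrow> L"
      by (simp add: o_def)
    moreover have "(\<lambda>n. ev f (case_sum (\<xi> (r n)) \<eta>)) \<longlonglongrightarrow> ev f (case_sum \<zeta> \<eta>)"
      by (intro continuous_ev) (auto split: sum.splits intro: r)
    ultimately show "ev f (case_sum \<zeta> \<eta>) = L" using LIMSEQ_unique by blast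
  qed
qed

end

lemma ev_C_case_sum: "ev (C f) (case_sum x y) = cnj (ev f (case_sum (cnj \<circ> y) (cnj \<circ> x)))"
proof -
  have "(\<lambda>v. cnj (case_sum x y (swp v))) = case_sum (cnj \<circ> y) (cnj \<circ> x)"
    by (auto simp: fun_eq_iff split: sum.splits)
  then show ?thesis by (simp add: ev_C)
qed

lemma D_iter_Db_commute:
  assumes "\<And>k. holo (A k)"
  shows "(D A ^^ i) ((Db A ^^ j) f) = (Db A ^^ j) ((D A ^^ i) f)"
proof -
  have 1: "(D A ^^ i) (Db A f) = Db A ((D A ^^ i) f)" for f
    by (induction i) (auto simp: D_Db_commute[OF assms assms])
  show ?thesis by (induction j) (auto simp: 1)
qed

lemma C_D_iter: "C ((D A ^^ i) f) = (Db A ^^ i) (C f)"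
  by (induction i) (auto simp: C_D)

lemma whom_D_iter:
  assumes "field_weight \<delta> l A" "whom (wh \<delta>) a f"
  shows "whom (wh \<delta>) (a + real k * l) ((D A ^^ k) f)"
proof (induction k)
  case (Suc k)
  then show ?case using whom_D[OF assms(1) Suc.IH] by (simp add: algebra_simps)
qed (simp add: assms)

lemma whom_Db_iter_wh:
  assumes "\<And>k. holo (A k)" "whom (wh \<delta>) a f"
  shows "whom (wh \<delta>) a ((Db A ^^ k) f)"
  by (induction k) (auto intro: whom_Db_wh assms)

lemma D_iter_linear: "(D A ^^ k) (f + g) = (D A ^^ k) f + (D A ^^ k) g" "(D A ^^ k) (- f) = - (D A ^^ k) f"
  "(D A ^^ k) (cst c * f) = cst c * (D A ^^ k) f" "(D A ^^ k) 0 = 0"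
  by (induction k) auto

lemma Db_iter_linear: "(Db A ^^ k) (- f) = - (Db A ^^ k) f" "(Db A ^^ k) 0 = 0"
  by (induction k) auto

lemma D_iter_sum: "(D A ^^ k) (sum f S) = (\<Sum>i\<in>S. (D A ^^ k) (f i))"
  by (induction S rule: infinite_finite_induct) (auto simp: D_iter_linear)

lemma pd_D_iter: "(\<And>k. pd v (A k) = 0) \<Longrightarrow> pd v f = 0 \<Longrightarrow> pd v ((D A ^^ k) f) = 0"
  by (induction k) (auto simp: pd_D)

text \<open>The last exponent for which the iterated derivation is nonzero; it is 0 for \<open>f = 0\<close> and for \<open>f\<close> not nilpotent
  it carries no information.\<close>

definition nil_degree :: "('v::finite \<Rightarrow> 'v pol) \<Rightarrow> 'v pol \<Rightarrow> nat" where
  "nil_degree A f = (LEAST N. (der A ^^ N) f = 0) - 1"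

lemma nil_degree:
  assumes "nilp A f" "f \<noteq> 0"
  shows "(der A ^^ nil_degree A f) f \<noteq> 0" "nil_degree A f < k \<Longrightarrow> (der A ^^ k) f = 0"
proof -
  define N where "N = (LEAST N. (der A ^^ N) f = 0)"
  have N: "(der A ^^ N) f = 0" unfolding N_def using assms(1) by (auto simp: nilp_def intro: LeastI_ex)
  then have "N \<noteq> 0" using assms(2) by (metis funpow_0)
  then have e: "nil_degree A f = N - 1" "N - 1 < N" by (auto simp: nil_degree_def N_def)
  then show "(der A ^^ nil_degree A f) f \<noteq> 0" unfolding N_def using not_less_Least by metis
  show "(der A ^^ k) f = 0" if "nil_degree A f < k"
    using that e by (intro der_iter_ge[OF N]) simp
qed

lemma der_iter_mult_top:
  assumes "(der A ^^ Suc N) f = 0" "(der A ^^ Suc M) g = 0"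
  shows "(der A ^^ (N + M)) (f * g) = of_nat ((N + M) choose N) * ((der A ^^ N) f * (der A ^^ M) g)"
proof -
  have "(der A ^^ (N + M)) (f * g) = (\<Sum>i\<le>N + M. if i = N then of_nat ((N + M) choose N) * ((der A ^^ N) f * (der A ^^ M) g) else 0)"
    unfolding der_iter_mult
  proof (rule sum.cong)
    fix i assume "i \<in> {..N + M}"
    then consider "i = N" | "Suc N \<le> i" | "Suc M \<le> N + M - i" by (auto simp: not_le le_less_Suc_eq) linarith
    then show "of_nat ((N + M) choose i) * ((der A ^^ i) f * (der A ^^ (N + M - i)) g) =
       (if i = N then of_nat ((N + M) choose N) * ((der A ^^ N) f * (der A ^^ M) g) else 0)"
    proof cases
      case 2
      then show ?thesis using der_iter_ge[OF assms(1) 2] by simp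
    next
      case 3
      then show ?thesis using der_iter_ge[OF assms(2) 3] by auto
    qed simp
  qed simp
  then show ?thesis by simp
qed

lemma of_nat_pol_eq_0 [simp]: "(of_nat n :: 'v pol) = 0 \<longleftrightarrow> n = 0"
  by (metis cst_eq_0_iff cst_hom(7) of_nat_eq_0_iff)

section \<open>Growth rates along the flow and blow-up limits\<close>

context model
begin

text \<open>\<alpha> is the largest ratio of nilpotency degree to weight, the steepest slope in the
  sense of a Newton polygon: at this rate every rescaled component stays bounded and at least one
  keeps a nonzero leading coefficient.\<close>

lemma slope_exists:
  assumes nil: "\<And>h. nilp (ext X) (P h)" and ne: "P h0 \<noteq> 0"
  shows "\<exists>\<alpha> h i. 0 \<le> \<alpha> \<and> (\<forall>h k. \<alpha> * h < real k \<longrightarrow> (D X ^^ k) (P h) = 0) \<and>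
    0 < h \<and> h < 1 \<and> real i = \<alpha> * h \<and> (D X ^^ i) (P h) \<noteq> 0"
proof -
  define s where "s h = real (nil_degree (ext X) (P h)) / h" for h
  define \<alpha> where "\<alpha> = Max (s ` {h. P h \<noteq> 0})"
  have fin: "finite (s ` {h. P h \<noteq> 0})" using P_finite by simp
  have pos: "0 < h \<and> h < 1" if "P h \<noteq> 0" for h using that P_0[of h] by force
  have "\<alpha> \<in> s ` {h. P h \<noteq> 0}" unfolding \<alpha>_def using fin ne by (intro Max_in) auto
  then obtain h where h: "P h \<noteq> 0" "\<alpha> = s h" by blast
  have "(D X ^^ k) (P g) = 0" if "\<alpha> * g < real k" for g k
  proof (cases "P g = 0")
    case False
    then have "s g \<le> \<alpha>" unfolding \<alpha>_def using fin by (intro Max_ge) auto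
    then have "real (nil_degree (ext X) (P g)) \<le> \<alpha> * g" using pos[OF False] by (simp add: s_def field_simps)
    then show ?thesis using that nil_degree(2)[OF nil False, of k] by (simp add: D_def)
  qed (simp add: D_iter_linear)
  moreover have "0 \<le> \<alpha>" using h pos[OF h(1)] by (simp add: s_def)
  moreover have "real (nil_degree (ext X) (P h)) = \<alpha> * h" using h pos[OF h(1)] by (simp add: s_def)
  moreover have "(D X ^^ nil_degree (ext X) (P h)) (P h) \<noteq> 0" using nil_degree(1)[OF nil h(1)] by (simp add: D_def)
  ultimately show ?thesis using pos[OF h(1)] by blast
qed

text \<open>The start z is chosen where the top derivative of P h is nonzero, so P h does not vanish
  at the limit \<zeta> for some \<eta>, and \<zeta> is not 0. The hypothesis on common zeros then
  applies at the real point of \<zeta>.\<close>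

lemma blowup:
  assumes X: "\<And>k. holo (X k)" "X None = 0" "\<And>k. pd (Inl None) (X k) = 0" and \<alpha>: "0 < \<alpha>"
    and nil: "\<And>h k. \<alpha> * h < real k \<Longrightarrow> (D X ^^ k) (P h) = 0"
    and top: "0 < h" "real i = \<alpha> * h" "(D X ^^ i) (P h) \<noteq> 0"
  shows "\<exists>\<zeta> z. (\<exists>h. ev (P h) (case_sum \<zeta> (cnj \<circ> \<zeta>)) \<noteq> 0) \<and>
    lead X \<alpha> z \<zeta>"
proof -
  obtain x where x: "ev ((D X ^^ i) (P h)) x \<noteq> 0" using pol_nonzero_point[OF top(3)] by blast
  \<comment> \<open>Nothing here depends on w, so its coordinate may be set to 0, as
    \<open>flow_limit\<close> demands.\<close>
  define z where "z = (x \<circ> Inl)(None := 0)"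
  define \<eta>\<^sub>0 where "\<eta>\<^sub>0 = x \<circ> Inr"
  have "ev ((D X ^^ i) (P h)) x = ev ((D X ^^ i) (P h)) (case_sum z \<eta>\<^sub>0)"
    by (rule ev_cong_pd[where V = "UNIV - {Inl None}"])
      (auto simp: pd_D_iter[OF X(3) P_wfree] z_def \<eta>\<^sub>0_def split: sum.splits)
  then have nz: "ev ((D X ^^ i) (P h)) (case_sum z \<eta>\<^sub>0) \<noteq> 0" using x by simp
  have zN: "z None = 0" by (simp add: z_def)
  obtain \<zeta> where \<zeta>: "\<zeta> None = 0" "lead X \<alpha> z \<zeta>"
    using flow_limit[where X = X and z = z and \<alpha> = \<alpha>, OF X(1,2) \<alpha> nil zN] by blast
  have "ev (P h) (case_sum \<zeta> \<eta>\<^sub>0) = ev ((D X ^^ i) (P h)) (case_sum z \<eta>\<^sub>0) / fact i"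
  proof (rule leadD[OF \<zeta>(2) whom_P])
    show "(D X ^^ k) (P h) = 0" if "\<alpha> * h < real k" for k using nil that .
    fix j assume "real j = \<alpha> * h"
    then have "j = i" using top(2) by linarith
    then show "ev ((D X ^^ j) (P h)) (case_sum z \<eta>\<^sub>0) / fact j = ev ((D X ^^ i) (P h)) (case_sum z \<eta>\<^sub>0) / fact i" by simp
  qed (use top(2) in blast)
  then have "ev (P h) (case_sum \<zeta> \<eta>\<^sub>0) \<noteq> 0" using nz by simp
  then have "\<exists>k. \<zeta> k \<noteq> 0"
    using whom_ev_0[OF whom_P, of h "case_sum \<zeta> \<eta>\<^sub>0"] top(1) by (force split: sum.splits)
  then have "\<exists>h. ev (P h) (case_sum \<zeta> (cnj \<circ> \<zeta>)) \<noteq> 0"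
    using null[where \<zeta> = \<zeta>, OF \<zeta>(1)] unfolding P_def by blast
  then show ?thesis using \<zeta>(2) by blast
qed

text \<open>Otherwise \<zeta> would be a common zero: \<open>lead\<close> turns P h at (\<zeta>, cnj
  \<zeta>) into D^i (P h) at (z, cnj \<zeta>); conjugation makes this Db^i of P (1 - h) at (\<zeta>,
  cnj z), and a second use of \<open>lead\<close> produces the mixed derivative D^j Db^i of P (1 -
  h).\<close>

lemma two_sided:
  assumes X: "\<And>k. holo (X k)" "X None = 0" "\<And>k. pd (Inl None) (X k) = 0" and \<alpha>: "0 < \<alpha>"
    and nil: "\<And>h k. \<alpha> * h < real k \<Longrightarrow> (D X ^^ k) (P h) = 0"
    and top: "0 < h" "real i = \<alpha> * h" "(D X ^^ i) (P h) \<noteq> 0"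
  shows "\<exists>h i j. 0 < h \<and> h < 1 \<and> real i = \<alpha> * h \<and> real j = \<alpha> * (1 - h) \<and> (D X ^^ i) ((Db X ^^ j) (P h)) \<noteq> 0"
proof (rule ccontr)
  assume neg: "\<not> ?thesis"
  have neg': "(D X ^^ i) ((Db X ^^ j) (P h)) = 0"
    if "0 < h" "h < 1" "real i = \<alpha> * h" "real j = \<alpha> * (1 - h)" for h i j
    using neg that by blast
  obtain \<zeta> z where \<zeta>: "\<exists>h. ev (P h) (case_sum \<zeta> (cnj \<circ> \<zeta>)) \<noteq> 0" "lead X \<alpha> z \<zeta>"
    using blowup[where X = X and \<alpha> = \<alpha>, OF X \<alpha> nil top] by blast
  have "ev (P h) (case_sum \<zeta> (cnj \<circ> \<zeta>)) = 0" for h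
  proof (cases "0 < h \<and> h < 1")
    case False
    then have "P h = 0" by (intro P_0) auto
    then show ?thesis by simp
  next
    case True
    have "ev ((D X ^^ i) (P h)) (case_sum z (cnj \<circ> \<zeta>)) = 0" if i: "real i = \<alpha> * h" for i
    proof -
      define g where "g = (Db X ^^ i) (P (1 - h))"
      have g: "g = C ((D X ^^ i) (P h))" by (simp add: g_def C_D_iter C_P)
      have "ev g (case_sum \<zeta> (cnj \<circ> z)) = 0"
      proof (rule leadD[OF \<zeta>(2)])
        show "whom (wh \<delta>) (1 - h) g" unfolding g_def by (rule whom_Db_iter_wh[OF X(1) whom_P])
        show "(D X ^^ k) g = 0" if "\<alpha> * (1 - h) < real k" for k
          unfolding g_def D_iter_Db_commute[where A = X, OF X(1)] nil[OF that] by (simp add: Db_iter_linear)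
        fix j assume "real j = \<alpha> * (1 - h)"
        then have "(D X ^^ j) g = 0"
          unfolding g_def using i True by (intro neg') auto
        then show "ev ((D X ^^ j) g) (case_sum z (cnj \<circ> z)) / fact j = 0" by simp
      qed simp
      then show ?thesis by (simp add: g ev_C_case_sum o_def)
    qed
    then show ?thesis by (intro leadD[OF \<zeta>(2) whom_P nil]) auto
  qed
  then show False using \<zeta>(1) by blast
qed

text \<open>D X raises the holomorphic weight by l and Db X keeps it, so weight h + l of the
  relation couples two neighbouring components. The pure term a has weight 1 + l and its conjugate
  weight 0, so each of them shows up at a single h.\<close>

lemma field_component:
  assumes X: "\<And>k. holo (X k)" "field_weight \<delta> l X"
    and a: "holo a" "whom (wh \<delta>) (1 + l) a"
    and eq: "D X p + C (D X p) + a + C a = 0"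
  shows "D X (P h) + Db X (P (h + l)) + (if h = 1 then a else 0) + (if h = - l then C a else 0) = 0"
proof -
  have "whom (wh \<delta>) 0 (C a)" using holo_isw_wa[OF a(1)] by (simp add: whom_C')
  then have "wcomp (wh \<delta>) (h + l) (C a) = (if h = - l then C a else 0)" by (auto simp: wcomp_hom)
  moreover have "wcomp (wh \<delta>) (h + l) a = (if h = 1 then a else 0)" using a(2) by (auto simp: wcomp_hom)
  moreover have "wcomp (wh \<delta>) (h + l) (D X p) = D X (P h)" using wcomp_D[OF X(2), where a = "h + l" and f = p] by (simp add: P_def)
  moreover have "wcomp (wh \<delta>) (h + l) (C (D X p)) = Db X (P (h + l))"
    using wcomp_Db[where A = X and \<delta> = \<delta> and a = "h + l" and f = p, OF X(1)] by (simp add: C_D p_real P_def)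
  ultimately show ?thesis using arg_cong[OF eq, of "wcomp (wh \<delta>) (h + l)"] by simp
qed

text \<open>Along the flow of such a field every top coefficient that could survive in the limit is forced
  to vanish by the relation between neighbouring components, contradicting the absence of common zeros.\<close>

lemma no_field:
  assumes X: "\<And>k. holo (X k)" "X None = 0" "\<And>k. pd (Inl None) (X k) = 0" "field_weight \<delta> l X" "l \<noteq> 0"
    and X0: "\<And>k. ev (X k) (\<lambda>_. 0) = 0"
    and a: "holo a" "whom (wh \<delta>) (1 + l) a"
    and eq: "D X p + C (D X p) + a + C a = 0"
  shows "X k = 0"
proof (rule ccontr)
  assume "X k \<noteq> 0"
  \<comment> \<open>Condition (N) for the balanced part supplies a component on which X acts
    nontrivially; this also makes \<alpha> positive below.\<close>
  then have ne: "D X (P (1/2)) \<noteq> 0" using N0[of X k] X unfolding P_def by blast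
  then have ne': "P (1/2) \<noteq> 0" by auto
  note R = field_component[OF X(1,4) a eq]
  \<comment> \<open>For l < 0 iteration ends in negative weight. For l > 0 the induction descends
    from weight 1, where the components vanish: the relation trades D X (P h) for Db X (P (h + l)),
    and Db X commutes with D X.\<close>
  have nil: "nilp (ext X) (P h)" for h
  proof (cases "l < 0")
    case True
    obtain k where "h / - l < real k" using reals_Archimedean2 by blast
    then have "h + real k * l < 0" using True by (simp add: field_simps)
    then have "(D X ^^ k) (P h) = 0"
      by (rule whom_neg[OF whom_D_iter[OF X(4) whom_P]]) (rule wh_nonneg)
    then show ?thesis unfolding nilp_def D_def by blast
  next
    case False
    then have l: "l > 0" using X(5) by simp
    have "nilp (ext X) (P h)" if "1 \<le> h + real n * l" for n h
      using that
    proof (induction n arbitrary: h)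
      case 0
      then show ?case by (simp add: P_0)
    next
      case (Suc n)
      show ?case
      proof (cases "0 < h \<and> h < 1")
        case True
        then have "D X (P h) = - Db X (P (h + l))"
          using R[of h] l by (simp add: eq_neg_iff_add_eq_0)
        moreover have "nilp (ext X) (Db X (P (h + l)))"
        proof -
          have "nilp (ext X) (P (h + l))" using Suc by (simp add: algebra_simps)
          then obtain N where "(D X ^^ N) (P (h + l)) = 0" by (auto simp: nilp_def D_def)
          then have "(D X ^^ N) (Db X (P (h + l))) = 0"
            using D_iter_Db_commute[where A = X and i = N and j = 1, OF X(1)] by simp
          then show ?thesis unfolding nilp_def D_def by blast
        qed
        ultimately have "nilp (ext X) (D X (P h))"
          using nilp_cst_mult[of "ext X" _ "-1"] by (simp add: cst_hom)
        then show ?thesis by (simp add: nilp_der D_def)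
      next
        case False
        then have "P h = 0" by (intro P_0) auto
        then show ?thesis by simp
      qed
    qed
    moreover obtain n where "(1 - h) / l \<le> real n" using real_arch_simple by blast
    ultimately show ?thesis using l by (simp add: field_simps)
  qed
  obtain \<alpha> g i where s: "0 \<le> \<alpha>" "\<And>h k. \<alpha> * h < real k \<Longrightarrow> (D X ^^ k) (P h) = 0"
    "0 < g" "g < 1" "real i = \<alpha> * g" "(D X ^^ i) (P g) \<noteq> 0"
    using slope_exists[OF nil ne'] by blast
  have \<alpha>: "0 < \<alpha>"
  proof (rule ccontr)
    assume "\<not> 0 < \<alpha>"
    then have "(D X ^^ 1) (P (1/2)) = 0" using s(1) by (intro s(2)) auto
    then show False using ne by simp
  qed
  obtain h i' j where Z: "0 < h" "h < 1" "real i' = \<alpha> * h" "real j = \<alpha> * (1 - h)"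
    "(D X ^^ i') ((Db X ^^ j) (P h)) \<noteq> 0"
    using two_sided[where X = X and \<alpha> = \<alpha>, OF X(1-3) \<alpha> s(2,3,5,6)] by blast
  have Dbn: "(Db X ^^ k) (P h) = 0" if "\<alpha> * (1 - h) < real k" for h k
    using s(2)[OF that] C_D_iter[of k X "P (1 - h)"] by (simp add: C_P)
  show False
  proof (cases "l < 0")
    case False
    then have l: "l > 0" using X(5) by simp
    \<comment> \<open>Trading one D for a Db moves the weight up by l, and j + 1 derivatives Db
      exceed the bound \<alpha> (1 - h - l).\<close>
    obtain i'' where i'': "i' = Suc i''" using Z(1,3) \<alpha> by (cases i') auto
    have "(D X ^^ i') ((Db X ^^ j) (P h)) = (D X ^^ i'') ((Db X ^^ j) (D X (P h)))"
      unfolding i'' funpow_Suc_right o_apply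
      using D_iter_Db_commute[where A = X and i = 1, OF X(1)] by simp
    also have "D X (P h) = - Db X (P (h + l))" using R[of h] l Z by (simp add: eq_neg_iff_add_eq_0)
    also have "(Db X ^^ j) (- Db X (P (h + l))) = - (Db X ^^ Suc j) (P (h + l))"
      unfolding Db_iter_linear funpow_Suc_right o_apply ..
    also have "(Db X ^^ Suc j) (P (h + l)) = 0"
    proof (rule Dbn)
      have "\<alpha> * (1 - (h + l)) < \<alpha> * (1 - h)" using \<alpha> l by (intro mult_strict_left_mono) auto
      then show "\<alpha> * (1 - (h + l)) < real (Suc j)" using Z(4) by simp
    qed
    finally show False using Z(5) by (simp add: D_iter_linear)
  next
    case True
    \<comment> \<open>Otherwise the top derivative of P g would have holomorphic weight 0, negative
      weight being impossible; it could then be evaluated at z = 0, where X vanishes.\<close>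
    have \<alpha>l: "- (\<alpha> * l) < 1"
    proof (rule ccontr)
      assume c: "\<not> - (\<alpha> * l) < 1"
      have i: "whom (wh \<delta>) (g + real i * l) ((D X ^^ i) (P g))" by (rule whom_D_iter[OF X(4) whom_P])
      have "g + real i * l \<ge> 0" using whom_neg[OF i] s(6) wh_nonneg by (metis not_le)
      moreover have "g * 1 \<le> g * - (\<alpha> * l)" using c s(3) by (intro mult_left_mono) auto
      then have "g + real i * l \<le> 0" using s(5) by (simp add: algebra_simps)
      ultimately have "g + real i * l = 0" by simp
      with i have i0: "whom (wh \<delta>) 0 ((D X ^^ i) (P g))" by simp
      obtain i1 where i1: "i = Suc i1" using s(3,5) \<alpha> by (cases i) auto
      have "(D X ^^ i) (P g) = 0"
      proof (rule pol_eqI)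
        fix x :: "'n option + 'n option \<Rightarrow> complex"
        define x0 where "x0 = (\<lambda>v. if wh \<delta> v = 0 then x v else 0)"
        have "ev (X k) x0 = ev (X k) (\<lambda>_. 0)" for k
          by (rule ev_cong_pd[where V = "range Inl"])
            (use X(1)[of k] \<delta>_pos in \<open>auto simp: holo_def x0_def image_iff\<close>, metis sum.exhaust, metis less_irrefl)
        then have "ev (D X f) x0 = 0" for f by (simp add: D_pd X0)
        moreover have "ev ((D X ^^ i) (P g)) x = ev ((D X ^^ i) (P g)) x0"
          unfolding x0_def by (rule whom_const[OF i0 wh_nonneg])
        ultimately show "ev ((D X ^^ i) (P g)) x = ev 0 x" by (simp add: i1)
      qed
      then show False using s(6) by simp
    qed
    obtain j' where j': "j = Suc j'" using Z(2,4) \<alpha> by (cases j) auto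
    \<comment> \<open>At h = 1 + l the pure term a would enter the relation; there j = -\<alpha> l <
      1 contradicts j > 0.\<close>
    have "h \<noteq> 1 + l"
    proof
      assume "h = 1 + l"
      then have "real j < 1" using Z(4) \<alpha>l by (simp add: algebra_simps)
      then show False using j' by simp
    qed
    then have "Db X (P h) = - D X (P (h - l))"
      using R[of "h - l"] Z by (simp add: eq_neg_iff_add_eq_0 add.commute)
    then have "(D X ^^ i') ((Db X ^^ j) (P h)) = (Db X ^^ j') ((D X ^^ i') (- D X (P (h - l))))"
      unfolding j' funpow_Suc_right o_apply D_iter_Db_commute[where A = X, OF X(1)] by simp
    also have "(D X ^^ i') (- D X (P (h - l))) = - (D X ^^ Suc i') (P (h - l))"
      unfolding D_iter_linear funpow_Suc_right o_apply ..
    also have "(D X ^^ Suc i') (P (h - l)) = 0"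
      using Z(3) \<alpha>l by (intro s(2)) (simp add: algebra_simps)
    finally show False using Z(5) by (simp add: Db_iter_linear)
  qed
qed

end

section \<open>Fields relating the components of p to those of its square\<close>

lemma two_pol_neq_0 [simp]: "(2 :: 'v pol) \<noteq> 0"
  by (metis of_nat_numeral of_nat_pol_eq_0 zero_neq_numeral)

context model
begin

lemma P_square: "wcomp (wh \<delta>) s (p * p) = (\<Sum>a | P a \<noteq> 0. P a * P (s - a))"
proof -
  have "p * p = (\<Sum>a | P a \<noteq> 0. P a * p)"
    using P_sum by (metis sum_distrib_right)
  then show ?thesis
    by (simp add: wcomp_sum wcomp_mult_hom[OF whom_P] P_def[symmetric])
qed

text \<open>Comparing nilpotency degrees on both sides of the quadratic relation shows that the components
  of holomorphic weight at least 1/2 grow strictly slower than the maximal rate along the flow, so that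
  the limiting direction of an orbit is a common zero.\<close>

lemma no_square_field:
  assumes X: "\<And>k. holo (X k)" "X None = 0" "\<And>k. pd (Inl None) (X k) = 0" and c: "c \<noteq> 0"
    and rel: "\<And>h. 0 < h \<Longrightarrow> D X (P h) = cst (c * of_real h) * wcomp (wh \<delta>) (1 + h) (p * p)"
  shows "1 / 2 < h \<Longrightarrow> P h = 0"
proof (rule ccontr)
  assume h12: "1 / 2 < h" and Ph: "P h \<noteq> 0"
  have pos: "0 < h \<and> h < 1" if "P h \<noteq> 0" for h using that P_0[of h] by force
  \<comment> \<open>In a nonzero product P a P (1 + h - a) both weights lie below 1, hence both
    exceed h, so the induction runs downwards over the nonzero components.\<close>
  have nil: "nilp (ext X) (P h)" for h
  proof (induction "card {a. P a \<noteq> 0 \<and> h < a}" arbitrary: h rule: less_induct)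
    case less
    show ?case
    proof (cases "P h = 0")
      case False
      have IH: "nilp (ext X) (P a)" if "P a \<noteq> 0" "h < a" for a
      proof (rule less)
        show "card {b. P b \<noteq> 0 \<and> a < b} < card {b. P b \<noteq> 0 \<and> h < b}"
          by (rule psubset_card_mono) (use that P_finite in \<open>auto elim: finite_subset[rotated]\<close>)
      qed
      have "nilp (ext X) (P a * P (1 + h - a))" for a
      proof (cases "P a = 0 \<or> P (1 + h - a) = 0")
        case True
        then show ?thesis by auto
      next
        case False
        then show ?thesis using pos[of a] pos[of "1 + h - a"] by (intro nilp_mult IH) auto
      qed
      then have "nilp (ext X) (D X (P h))"
        unfolding rel[OF conjunct1[OF pos[OF False]]] P_square by (intro nilp_cst_mult nilp_sum)
      then show ?thesis by (simp add: nilp_der D_def)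
    qed simp
  qed
  define d where "d h = nil_degree (ext X) (P h)" for h
  have d: "(D X ^^ d h) (P h) \<noteq> 0" if "P h \<noteq> 0" for h
    using nil_degree(1)[OF nil that] by (simp add: d_def D_def)
  have d0: "(D X ^^ k) (P h) = 0" if "d h < k" for h k
    using nil_degree(2)[OF nil, of h k] that by (cases "P h = 0") (auto simp: d_def D_def)
  obtain \<alpha> g i where s: "0 \<le> \<alpha>" "\<And>h k. \<alpha> * h < real k \<Longrightarrow> (D X ^^ k) (P h) = 0"
    "0 < g" "g < 1" "real i = \<alpha> * g" "(D X ^^ i) (P g) \<noteq> 0"
    using slope_exists[OF nil Ph] by blast
  have dle: "real (d h) \<le> \<alpha> * h" if "P h \<noteq> 0" for h
    using s(2) d[OF that] by (meson not_le)
  have mult0: "(D X ^^ k) (P a * P b) = 0"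
    if "P a \<noteq> 0 \<Longrightarrow> P b \<noteq> 0 \<Longrightarrow> real (d a) + real (d b) < real k" for a b k
  proof (cases "P a = 0 \<or> P b = 0")
    case True
    then show ?thesis by (auto simp: D_iter_linear)
  next
    case False
    then have "Suc (d a) + Suc (d b) \<le> Suc k" using that by auto
    moreover have "(der (ext X) ^^ Suc (d a)) (P a) = 0" "(der (ext X) ^^ Suc (d b)) (P b) = 0"
      using d0 lessI unfolding D_def by blast+
    ultimately show ?thesis unfolding D_def by (intro der_iter_mult_0)
  qed
  have multtop: "(D X ^^ (d a + d b)) (P a * P b) = of_nat ((d a + d b) choose d a) * ((D X ^^ d a) (P a) * (D X ^^ d b) (P b))" for a b
    using der_iter_mult_top[of "d a" "ext X" "P a" "d b" "P b"] d0 unfolding D_def by blast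
  \<comment> \<open>The relation exchanges one D X for the quadratic sum, so k derivatives of the
    sum already vanish when k + 1 exceeds \<alpha> h.\<close>
  have sq: "(D X ^^ k) (\<Sum>a | P a \<noteq> 0. P a * P (1 + h - a)) = 0" if "0 < h" "\<alpha> * h < real (Suc k)" for h k
  proof -
    have "(D X ^^ k) (D X (P h)) = 0" using s(2)[OF that(2)] by (simp add: funpow_swap1)
    then have "cst (c * of_real h) * (D X ^^ k) (wcomp (wh \<delta>) (1 + h) (p * p)) = 0"
      unfolding rel[OF that(1)] by (simp add: D_iter_linear)
    then show ?thesis using c that(1) by (simp add: P_square)
  qed
  \<comment> \<open>At the largest index b with equality, weight h = 2 b - 1 is used: in every other
    product of the sum one index exceeds b and is strictly slower, so only the square of the top
    derivative of P b survives.\<close>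
  have claim1: "real (d h) < \<alpha> * h" if h: "1 / 2 < h" "P h \<noteq> 0" for h
  proof (rule ccontr)
    assume "\<not> real (d h) < \<alpha> * h"
    define B where "B = {h. P h \<noteq> 0 \<and> 1 / 2 < h \<and> real (d h) = \<alpha> * h}"
    have fB: "finite B" using P_finite by (rule finite_subset[rotated]) (auto simp: B_def)
    have "h \<in> B" using \<open>\<not> real (d h) < \<alpha> * h\<close> dle[OF h(2)] h by (auto simp: B_def)
    define b where "b = Max B"
    have b: "b \<in> B" unfolding b_def using fB \<open>h \<in> B\<close> by (intro Max_in) auto
    then have b': "P b \<noteq> 0" "1 / 2 < b" "real (d b) = \<alpha> * b" by (auto simp: B_def)
    have lt: "real (d a) < \<alpha> * a" if "b < a" "P a \<noteq> 0" for a
    proof -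
      have "a \<notin> B" using that(1) Max_ge[OF fB, of a] by (auto simp: b_def)
      then show ?thesis using dle[OF that(2)] that b' by (auto simp: B_def)
    qed
    have "(D X ^^ (d b + d b)) (\<Sum>a | P a \<noteq> 0. P a * P (1 + (2 * b - 1) - a)) = 0"
    proof (rule sq)
      have "\<alpha> * b * 2 = real (d b + d b)" using b'(3) by simp
      then show "\<alpha> * (2 * b - 1) < real (Suc (d b + d b))" using s(1) by (simp add: algebra_simps)
    qed (use b' in simp)
    also have "(D X ^^ (d b + d b)) (\<Sum>a | P a \<noteq> 0. P a * P (1 + (2 * b - 1) - a))
        = (\<Sum>a | P a \<noteq> 0. if a = b then (D X ^^ (d b + d b)) (P b * P b) else 0)"
      unfolding D_iter_sum
    proof (rule sum.cong)
      fix a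
      show "(D X ^^ (d b + d b)) (P a * P (1 + (2 * b - 1) - a)) = (if a = b then (D X ^^ (d b + d b)) (P b * P b) else 0)"
      proof (cases "a = b")
        case False
        have "(D X ^^ (d b + d b)) (P a * P (2 * b - a)) = 0"
        proof (rule mult0)
          assume nz: "P a \<noteq> 0" "P (2 * b - a) \<noteq> 0"
          have "real (d a) + real (d (2 * b - a)) < \<alpha> * a + \<alpha> * (2 * b - a)"
            using False dle[OF nz(1)] dle[OF nz(2)] lt[OF _ nz(1)] lt[OF _ nz(2)] by (cases "a < b") auto
          then show "real (d a) + real (d (2 * b - a)) < real (d b + d b)" using b'(3) by (simp add: algebra_simps)
        qed
        then show ?thesis using False by simp
      qed simp
    qed simp
    also have "\<dots> = (D X ^^ (d b + d b)) (P b * P b)" using P_finite b' by simp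
    finally show False unfolding multtop using d[OF b'(1)] by simp
  qed
  have \<alpha>: "0 < \<alpha>" using claim1[OF h12 Ph] s(1) by (cases "\<alpha> = 0") auto
  \<comment> \<open>If P (1/2) attained the rate \<alpha>, take the steepest line from (1/2,
    \<alpha>/2) to a point (h, d h) with h > 1/2, and the first index b on it. In weight h = b - 1/2
    only the two equal products of P (1/2) and P b reach degree K.\<close>
  have claim2: "real (d (1/2)) < \<alpha> / 2" if P12: "P (1/2) \<noteq> 0"
  proof (rule ccontr)
    assume "\<not> real (d (1/2)) < \<alpha> / 2"
    then have d12: "real (d (1/2)) = \<alpha> / 2" using dle[OF P12] by simp
    define S where "S = {h. P h \<noteq> 0 \<and> 1 / 2 < h}"
    define f where "f h = (real (d h) - \<alpha> / 2) / (h - 1 / 2)" for h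
    define \<kappa> where "\<kappa> = Max (f ` S)"
    have fS: "finite S" using P_finite by (rule finite_subset[rotated]) (auto simp: S_def)
    have hS: "h \<in> S" using h12 Ph by (simp add: S_def)
    have "\<kappa> \<in> f ` S" unfolding \<kappa>_def using fS hS by (intro Max_in) auto
    then have ne: "{h \<in> S. f h = \<kappa>} \<noteq> {}" by auto
    define b where "b = Min {h \<in> S. f h = \<kappa>}"
    have "b \<in> {h \<in> S. f h = \<kappa>}" unfolding b_def using fS ne by (intro Min_in) auto
    then have b: "P b \<noteq> 0" "1 / 2 < b" "f b = \<kappa>" by (auto simp: S_def)
    have db: "real (d b) = \<alpha> / 2 + \<kappa> * (b - 1 / 2)" using b(2) by (simp add: f_def b(3)[symmetric])
    \<comment> \<open>This is what \<open>claim1\<close> gives for b; it controls the products with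
      one index below 1/2.\<close>
    have \<kappa>\<alpha>: "\<kappa> < \<alpha>"
    proof -
      have "real (d b) - \<alpha> / 2 < \<alpha> * (b - 1 / 2)" using claim1[OF b(2,1)] by (simp add: algebra_simps)
      then show ?thesis using b(2) unfolding b(3)[symmetric] f_def by (simp add: pos_divide_less_eq)
    qed
    have le: "real (d a) \<le> \<alpha> / 2 + \<kappa> * (a - 1 / 2)" if "P a \<noteq> 0" "1 / 2 < a" for a
    proof -
      have "f a \<le> \<kappa>" unfolding \<kappa>_def using fS that by (intro Max_ge) (auto simp: S_def)
      then show ?thesis using that(2) by (simp add: f_def pos_divide_le_eq)
    qed
    have lt: "real (d a) < \<alpha> / 2 + \<kappa> * (a - 1 / 2)" if "P a \<noteq> 0" "1 / 2 < a" "a < b" for a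
    proof -
      have "a \<notin> {h \<in> S. f h = \<kappa>}"
      proof
        assume "a \<in> {h \<in> S. f h = \<kappa>}"
        then have "b \<le> a" unfolding b_def using fS by (intro Min_le) auto
        then show False using that by simp
      qed
      then have "f a \<noteq> \<kappa>" using that by (auto simp: S_def)
      then have "real (d a) \<noteq> \<alpha> / 2 + \<kappa> * (a - 1 / 2)" using that(2) by (auto simp: f_def)
      then show ?thesis using le[OF that(1,2)] by simp
    qed
    define K where "K = d (1/2) + d b"
    have K: "real K = \<alpha> + \<kappa> * (b - 1 / 2)" using d12 db by (simp add: K_def)
    have "(D X ^^ K) (\<Sum>a | P a \<noteq> 0. P a * P (1 + (b - 1/2) - a)) = 0"
    proof (rule sq)
      have "b < 1" using pos[OF b(1)] by simp
      then have "\<alpha> * (b - 1 / 2) < \<alpha> * (1 / 2)" using \<alpha> by (intro mult_strict_left_mono) auto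
      then show "\<alpha> * (b - 1/2) < real (Suc K)" using d12 by (simp add: K_def)
    qed (use b in simp)
    also have "(D X ^^ K) (\<Sum>a | P a \<noteq> 0. P a * P (1 + (b - 1/2) - a))
        = (\<Sum>a | P a \<noteq> 0. (if a = 1/2 then (D X ^^ K) (P (1/2) * P b) else 0) + (if a = b then (D X ^^ K) (P (1/2) * P b) else 0))"
      unfolding D_iter_sum
    proof (rule sum.cong)
      fix a
      show "(D X ^^ K) (P a * P (1 + (b - 1/2) - a)) =
        (if a = 1/2 then (D X ^^ K) (P (1/2) * P b) else 0) + (if a = b then (D X ^^ K) (P (1/2) * P b) else 0)"
      proof (cases "a = 1/2 \<or> a = b")
        case True
        then show ?thesis
        proof
          assume a: "a = 1/2"
          have e: "1 + (b - 1/2) - 1/2 = b" by simp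
          show ?thesis unfolding a e using b(2) by simp
        next
          assume a: "a = b"
          have e: "1 + (b - 1/2) - b = 1/2" by simp
          show ?thesis unfolding a e using b(2) by (simp add: mult.commute)
        qed
      next
        case False
        define e where "e = b + 1/2 - a"
        have "(D X ^^ K) (P a * P e) = 0"
        proof (rule mult0)
          assume nz: "P a \<noteq> 0" "P e \<noteq> 0"
          have *: "real (d a') + real (d e') < real K"
            if "P a' \<noteq> 0" "P e' \<noteq> 0" "a' + e' = b + 1/2" "a' < 1/2" for a' e'
          proof -
            have "0 < (\<alpha> - \<kappa>) * (1/2 - a')" using \<kappa>\<alpha> that by simp
            moreover have "real (d a') \<le> \<alpha> * a'" using dle[OF that(1)] .
            moreover have "real (d e') \<le> \<alpha> / 2 + \<kappa> * (b - a')"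
            proof -
              have e: "e' - 1 / 2 = b - a'" using that(3) by simp
              show ?thesis using le[OF that(2)] that(3,4) b(2) unfolding e by simp
            qed
            ultimately show ?thesis using K by (simp add: algebra_simps diff_divide_distrib)
          qed
          consider "a < 1/2" | "e < 1/2" | "1/2 < a" "1/2 < e" using False e_def by force
          then show "real (d a) + real (d e) < real K"
          proof cases
            case 1
            then show ?thesis using *[OF nz] by (simp add: e_def)
          next
            case 2
            then show ?thesis using *[OF nz(2,1)] by (simp add: e_def)
          next
            case 3
            then have "real (d a) < \<alpha> / 2 + \<kappa> * (a - 1 / 2)" "real (d e) < \<alpha> / 2 + \<kappa> * (e - 1 / 2)"
              using lt[OF nz(1)] lt[OF nz(2)] by (auto simp: e_def)
            then show ?thesis using K by (simp add: e_def algebra_simps)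
          qed
        qed
        then show ?thesis using False by (simp add: e_def add.commute add_diff_eq)
      qed
    qed simp
    also have "\<dots> = (D X ^^ K) (P (1/2) * P b) + (D X ^^ K) (P (1/2) * P b)"
      unfolding sum.distrib sum.delta[OF P_finite] using P12 b(1) by simp
    also have "\<dots> = of_nat 2 * (D X ^^ K) (P (1/2) * P b)" by simp
    finally show False unfolding K_def multtop using d[OF b(1)] d[OF P12] by simp
  qed
  obtain \<zeta> z where \<zeta>: "\<exists>h. ev (P h) (case_sum \<zeta> (cnj \<circ> \<zeta>)) \<noteq> 0" "lead X \<alpha> z \<zeta>"
    using blowup[where X = X and \<alpha> = \<alpha>, OF X \<alpha> s(2,3,5,6)] by blast
  \<comment> \<open>Strictly slower components have no term of order \<alpha> h, so they vanish at
    \<zeta> for every \<eta>; conjugation then takes care of the weights below 1/2.\<close>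
  have z: "ev (P h) (case_sum \<zeta> \<eta>) = 0" if "1/2 \<le> h" for h \<eta>
  proof (cases "P h = 0")
    case False
    have "real (d h) < \<alpha> * h"
    proof (cases "1/2 < h")
      case True
      then show ?thesis using claim1 False by blast
    next
      case h: False
      then have h: "h = 1/2" using that by simp
      show ?thesis using claim2 False unfolding h by simp
    qed
    then have "(D X ^^ i) (P h) = 0" if "real i = \<alpha> * h" for i
      using that by (intro d0) simp
    then show ?thesis by (intro leadD[OF \<zeta>(2) whom_P s(2)]) auto
  qed simp
  have "ev (P h) (case_sum \<zeta> (cnj \<circ> \<zeta>)) = 0" for h
  proof (cases "1/2 \<le> h")
    case False
    then have "ev (P (1 - h)) (case_sum \<zeta> (cnj \<circ> \<zeta>)) = 0" by (intro z) simp
    then show ?thesis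
      using ev_C_case_sum[of "P (1 - h)" \<zeta> "cnj \<circ> \<zeta>"] by (simp add: C_P o_def)
  qed (rule z)
  then show False using \<zeta>(1) by blast
qed

end

lemma ev_numeral [simp]: "ev (numeral n) x = numeral n"
  by (metis ev_of_nat of_nat_numeral)

lemma pd_D_general: "pd v (D A f) = D (\<lambda>k. pd v (A k)) f + D A (pd v f)"
  by (simp add: D_pd pd_mult sum.distrib pd_commute[of v])

lemma pd_hbrk: "pd v (hbrk A B k) = hbrk (\<lambda>k. pd v (A k)) B k + hbrk A (\<lambda>k. pd v (B k)) k"
  by (simp add: hbrk_def pd_D_general)

lemma D_zero_field: "D (\<lambda>_. 0) f = 0"
  by (simp add: D_pd)

lemma hbrk_zero: "hbrk (\<lambda>_. 0) B k = 0" "hbrk A (\<lambda>_. 0) k = 0"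
  by (simp_all add: hbrk_def D_zero_field)

lemma Db_hbrk: "Db (hbrk A B) f = Db A (Db B f) - Db B (Db A f)"
proof -
  have "Db (hbrk A B) f = C (D (hbrk A B) (C f))" by (simp add: C_D)
  also have "\<dots> = Db A (Db B f) - Db B (Db A f)" by (simp add: D_hbrk C_D)
  finally show ?thesis .
qed

lemma holo_const:
  assumes "holo f" "whom (wh \<delta>) 0 f" "\<And>k. 0 < \<delta> k"
  shows "\<exists>c. f = cst c"
proof (intro exI pol_eqI)
  fix x :: "'a + 'a \<Rightarrow> complex"
  have "0 \<le> wh \<delta> v" for v using assms(3) by (cases v) (auto simp: less_imp_le)
  then have "ev f x = ev f (\<lambda>v. if wh \<delta> v = 0 then x v else 0)" by (rule whom_const[OF assms(2)])
  also have "\<dots> = ev f (\<lambda>_. 0)"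
  proof (rule ev_cong_pd[where V = "range Inl"])
    fix v :: "'a + 'a" assume "v \<notin> range Inl"
    then show "pd v f = 0" using assms(1) by (cases v) (auto simp: holo_def)
  next
    fix v :: "'a + 'a" assume "v \<in> range Inl"
    then show "(if wh \<delta> v = 0 then x v else 0) = 0" using assms(3) by (auto simp: less_le)
  qed
  finally show "ev f x = ev (cst (ev f (\<lambda>_. 0))) x" by simp
qed

lemma D_lincomb: "D (\<lambda>k. g * A k + B k) f = g * D A f + D B f"
  by (simp add: D_pd distrib_right sum.distrib sum_distrib_left mult.assoc)

section \<open>Tangential fields\<close>

context model
begin

abbreviation "w \<equiv> (var (Inl None) :: ('n option + 'n option) pol)"
abbreviation "wb \<equiv> (var (Inr None) :: ('n option + 'n option) pol)"
abbreviation "hi \<equiv> (cst (1 / (2 * \<i>)) :: ('n option + 'n option) pol)"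

text \<open>The polarised form of v + p, with v = (w - wb) / (2 i).\<close>

definition r :: "('n option + 'n option) pol" where "r = hi * (w - wb) + p"

text \<open>Vanishing on the hypersurface is replaced by divisibility by r, which makes stability
  under d/dw and under brackets a computation; \<open>r_dvd\<close> links it to the geometric
  condition.\<close>

definition tang :: "('n option \<Rightarrow> ('n option + 'n option) pol) \<Rightarrow> bool" where
  "tang A \<longleftrightarrow> r dvd D A r + Db A r"

definition wfree :: "('n option + 'n option) pol \<Rightarrow> bool" where
  "wfree f \<longleftrightarrow> pd (Inl None) f = 0 \<and> pd (Inr None) f = 0"

lemma wfree_add: "wfree f \<Longrightarrow> wfree g \<Longrightarrow> wfree (f + g)"
  and wfree_diff: "wfree f \<Longrightarrow> wfree g \<Longrightarrow> wfree (f - g)"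
  and wfree_mult: "wfree f \<Longrightarrow> wfree g \<Longrightarrow> wfree (f * g)"
  and wfree_cst [simp]: "wfree (cst c)"
  and wfree_p [simp]: "wfree p"
  by (auto simp: wfree_def pd_mult p_wfree p_wfree')

lemma wfree_C: "wfree f \<Longrightarrow> wfree (C f)"
  using pd_C[of None f] pd_C[of None "C f"] by (simp add: wfree_def)

lemma wfree_holo: "holo f \<Longrightarrow> pd (Inl None) f = 0 \<Longrightarrow> wfree f"
  by (simp add: wfree_def holo_def)

lemma wfree_D: "(\<And>k. wfree (A k)) \<Longrightarrow> wfree f \<Longrightarrow> wfree (D A f)"
  by (simp add: wfree_def pd_D)

lemma whom_w: "whom (wh \<delta>) 1 w"
  using whom_var[of "wh \<delta>" "Inl None"] by (simp add: \<delta>_None)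

lemma C_hi: "C hi = - hi"
  by (rule pol_eqI) (simp add: ev_C)

lemma C_r: "C r = r"
  unfolding r_def C_simps(3,4,6,8,9) C_hi p_real by (simp add: algebra_simps)

lemma C_D_r: "C (D A r) = Db A r"
  by (simp add: C_D C_r)

lemma D_r: "D A r = hi * A None + D A p"
  by (simp add: r_def)

lemma pd_r: "pd (Inl None) r = hi" "pd (Inr None) r = - hi"
  by (simp_all add: r_def pd_mult pd_var p_wfree p_wfree')

text \<open>The equation r = 0 can be solved for w at any values of the other variables, and F does
  not notice the change of w.\<close>

lemma wfree_dvd:
  assumes "wfree F" "r dvd F"
  shows "F = 0"
proof (rule pol_eqI)
  fix x
  define x' where "x' = x(Inl None := x (Inr None) - 2 * \<i> * ev p x)"
  have e: "ev f x = ev f x'" if "wfree f" for f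
    by (rule ev_cong_pd[where V = "UNIV - {Inl None}"]) (use that in \<open>auto simp: wfree_def x'_def\<close>)
  have "ev r x' = 0" using e[OF wfree_p] by (simp add: r_def x'_def field_simps)
  then have "ev F x' = 0" using assms(2) by (auto elim!: dvdE)
  then show "ev F x = ev 0 x" using e[OF assms(1)] by simp
qed

text \<open>The model is invariant under real translations of w: the sum of d/dw and d/dwb kills r,
  so applying it to D A r + Db A r = r g keeps the factor r.\<close>

lemma tang_pd:
  assumes "\<And>k. holo (A k)" "tang A"
  shows "tang (\<lambda>k. pd (Inl None) (A k))"
proof -
  obtain g where g: "D A r + Db A r = r * g" using assms(2) by (auto simp: tang_def elim: dvdE)
  let ?dA = "\<lambda>k. pd (Inl None) (A k)"
  have 1: "D ?dA r = pd (Inl None) (D A r)"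
    by (simp add: pd_D_general pd_r)
  have 2: "pd (Inr None) (D A r) = 0"
    using assms(1) by (simp add: pd_D_general pd_r holo_def D_zero_field)
  have 3: "Db ?dA r = pd (Inr None) (Db A r)"
    using pd_C[of None "D A r"] 1 by (simp add: C_D_r[symmetric])
  have 4: "pd (Inl None) (Db A r) = 0"
    using pd_C[of None "Db A r"] 2 by (simp add: C_D_r[symmetric])
  have "D ?dA r + Db ?dA r = pd (Inl None) (D A r + Db A r) + pd (Inr None) (D A r + Db A r)"
    by (simp add: 1 2 3 4)
  also have "\<dots> = r * (pd (Inl None) g + pd (Inr None) g)"
    unfolding g by (simp add: pd_mult pd_r algebra_simps)
  finally show ?thesis unfolding tang_def by simp
qed

lemma tang_hbrk:
  assumes "\<And>k. holo (A k)" "\<And>k. holo (B k)" "tang A" "tang B"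
  shows "tang (hbrk A B)"
proof -
  obtain g h where gh: "D A r + Db A r = r * g" "D B r + Db B r = r * h"
    using assms(3,4) by (auto simp: tang_def elim!: dvdE)
  have e: "D F (r * f) + Db F (r * f) = (D F r + Db F r) * f + r * (D F f + Db F f)" for F f
    by (simp add: D_mult Db_mult algebra_simps)
  have "D (hbrk A B) r + Db (hbrk A B) r
      = (D A (D B r + Db B r) + Db A (D B r + Db B r)) - (D B (D A r + Db A r) + Db B (D A r + Db A r))"
    using D_Db_commute[of A B r, OF assms(1,2)] D_Db_commute[of B A r, OF assms(2,1)]
    by (simp add: D_hbrk Db_hbrk)
  also have "\<dots> = r * (D A h + Db A h - D B g - Db B g)"
    unfolding gh e by (simp add: algebra_simps)
  finally show ?thesis unfolding tang_def by simp
qed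

lemma tang_wfree:
  assumes "\<And>k. holo (A k)" "\<And>k. pd (Inl None) (A k) = 0" "tang A"
  shows "D A r + Db A r = 0"
proof (rule wfree_dvd)
  have w: "wfree (A k)" for k using assms(1,2) by (rule wfree_holo)
  have "wfree (D A r)" unfolding D_r by (intro wfree_add wfree_mult wfree_cst wfree_D w wfree_p)
  then show "wfree (D A r + Db A r)" unfolding C_D_r[symmetric] by (intro wfree_add wfree_C)
qed (use assms(3) in \<open>simp add: tang_def\<close>)

definition zpart :: "('n option \<Rightarrow> ('n option + 'n option) pol) \<Rightarrow> 'n option \<Rightarrow> ('n option + 'n option) pol" where
  "zpart A k = (if k = None then 0 else A k)"

lemma D_zpart: "pd (Inl None) f = 0 \<Longrightarrow> D (zpart A) f = D A f"
  unfolding D_pd zpart_def by (intro sum.cong) auto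

lemma zpart_simps [simp]: "zpart A None = 0" "zpart A (Some j) = A (Some j)"
  by (simp_all add: zpart_def)

lemma zpart_holo: "(\<And>k. holo (A k)) \<Longrightarrow> holo (zpart A k)"
  and zpart_pd: "(\<And>k. pd v (A k) = 0) \<Longrightarrow> pd v (zpart A k) = 0"
  and zpart_fhom: "field_weight \<delta> l A \<Longrightarrow> field_weight \<delta> l (zpart A)"
  by (auto simp: zpart_def field_weight_def)

text \<open>\<open>no_field\<close> removes the z-components. Then \<open>hi * A None\<close> equals
  minus its own conjugate, so it is both holomorphic and antiholomorphic, hence of weight 0, against
  its weight 1 + l.\<close>

lemma wfree_field_zero:
  assumes A: "\<And>k. holo (A k)" "\<And>k. pd (Inl None) (A k) = 0" "tang A" "field_weight \<delta> l A" "l \<noteq> 0" "l \<noteq> - 1"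
    and A0: "\<And>j. ev (A (Some j)) (\<lambda>_. 0) = 0"
  shows "A k = 0"
proof -
  have eq: "D (zpart A) p + C (D (zpart A) p) + hi * A None + C (hi * A None) = 0"
    using tang_wfree[OF A(1-3)]
    by (simp add: D_zpart p_wfree C_D_r[symmetric] D_r algebra_simps del: C_simps(7))
  have a: "holo (hi * A None)" "whom (wh \<delta>) (1 + l) (hi * A None)"
    using A(1) A(4)[unfolded field_weight_def, rule_format, of None]
    by (auto intro!: holo_mult whom_cst_mult simp: \<delta>_None add.commute)
  have z: "zpart A k = 0" for k
  proof (rule no_field[OF zpart_holo[OF A(1)] _ zpart_pd[OF A(2)] zpart_fhom[OF A(4)] A(5) _ a eq])
    show "ev (zpart A k) (\<lambda>_. 0) = 0" for k using A0 by (cases k) auto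
  qed simp
  then have zf: "zpart A = (\<lambda>_. 0)" by auto
  define a' where "a' = hi * A None"
  have e: "a' = - C a'"
    using eq unfolding zf D_zero_field a'_def by (simp add: eq_neg_iff_add_eq_0 del: C_simps(4,7))
  have "whom (wh \<delta>) 0 (C a')" using holo_isw_wa[OF a(1)] by (simp add: whom_C' a'_def del: C_simps(4,7))
  then have "whom (wh \<delta>) 0 (- C a')" by (rule whom_uminus)
  then have "whom (wh \<delta>) 0 a'" by (subst e)
  then have "a' = 0" using whom_unique[OF a(2)] A(6) by (force simp: a'_def)
  then have "A None = 0" by (simp add: a'_def)
  then show ?thesis using z[of k] by (cases k) auto
qed

text \<open>The comparison field for condition (N) on p^2; w is left out because that condition
  concerns fields in z alone.\<close>

definition euler :: "'n option \<Rightarrow> ('n option + 'n option) pol" where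
  "euler = zpart (\<lambda>k. rc (\<delta> k) * var (Inl k))"

lemma D_euler: "pd (Inl None) f = 0 \<Longrightarrow> D euler f = Eu (wh \<delta>) f"
  unfolding euler_def by (simp add: D_zpart) (simp add: D_pd Eu_def der_def sum_UNIV_Plus cst_hom)

lemma holo_euler: "holo (euler k)" and pd_euler: "pd (Inl None) (euler k) = 0"
  unfolding euler_def by (auto simp: zpart_def pd_mult pd_var intro: holo_mult)

text \<open>A field of weight 1 has the form \<open>(c w^2 / 2 + e) d/dw + w B' + E\<close>. Modulo \<open>r\<close> the tangency relation is free of \<open>w\<close>;
  its component of signature 0 and \<open>N1\<close> identify \<open>B'\<close> with \<open>c\<close> times the Euler field, and the components of positive
  signature then say that \<open>E\<close> maps \<open>P h\<close> to a multiple of the corresponding component of \<open>p\<^sup>2\<close>.\<close>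

lemma weight_one:
  assumes Q: "\<And>k. holo (Q k)" "field_weight \<delta> 1 Q" "tang Q" and ne: "pd (Inl None) (Q k0) \<noteq> 0"
  shows "h \<noteq> 1 / 2 \<Longrightarrow> P h = 0"
proof -
  define B where "B k = pd (Inl None) (Q k)" for k
  have Bh: "holo (B k)" for k unfolding B_def by (rule holo_pd[OF Q(1)])
  have Bt: "tang B" unfolding B_def by (rule tang_pd[OF Q(1,3)])
  have Bf: "field_weight \<delta> 0 B" unfolding field_weight_def
  proof
    fix k
    have "whom (wh \<delta>) (1 + \<delta> k) (Q k)" using Q(2) by (simp add: field_weight_def)
    from whom_pd[OF this, of None] show "whom (wh \<delta>) (0 + \<delta> k) (B k)" by (simp add: B_def \<delta>_None)
  qed
  define B1 where "B1 k = pd (Inl None) (B k)" for k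
  have B1h: "holo (B1 k)" for k unfolding B1_def by (rule holo_pd[OF Bh])
  have B1t: "tang B1" unfolding B1_def by (rule tang_pd[OF Bh Bt])
  have B1f: "whom (wh \<delta>) (\<delta> k - 1) (B1 k)" for k
    using whom_pd[of \<delta> "\<delta> k" "B k" None] Bf by (simp add: field_weight_def B1_def \<delta>_None)
  \<comment> \<open>Two w-derivatives leave weight \<delta> j - 1, which is at most -1/2.\<close>
  have B1s: "B1 (Some j) = 0" for j
    by (rule whom_neg[OF B1f _ wh_nonneg]) (use \<delta>_le[of j] in simp)
  have "whom (wh \<delta>) 0 (B1 None)" using B1f[of None] by (simp add: \<delta>_None)
  then obtain c where c: "B1 None = cst c" using holo_const[where \<delta> = \<delta> and f = "B1 None", OF B1h _ \<delta>_pos] by blast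
  have B1w: "pd (Inl None) (B1 k) = 0" for k using B1s c by (cases k) auto
  have "zpart B1 k = 0" for k using B1s by (cases k) auto
  then have "zpart B1 = (\<lambda>_. 0)" by auto
  then have "D B1 p = 0" using D_zpart[OF p_wfree, of B1] by (simp add: D_zero_field)
  then have D1: "D B1 r = hi * cst c" by (simp add: D_r c)
  have cr: "cnj c = c"
  proof -
    have "hi * cst c + C (hi * cst c) = 0"
      using tang_wfree[OF B1h B1w B1t] unfolding C_D_r[symmetric] D1 .
    from arg_cong[OF this, of "\<lambda>f. ev f (\<lambda>_. 0)"] show ?thesis by (simp add: field_simps)
  qed
  have Bn1: "whom (wh \<delta>) 1 (B None)"
    using Bf[unfolded field_weight_def, rule_format, of None] by (simp add: \<delta>_None)
  define b where "b = B None - cst c * w"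
  have b: "holo b" "pd (Inl None) b = 0" "whom (wh \<delta>) 1 b"
    using Bh Bf c by (auto simp: b_def pd_mult pd_var B1_def field_weight_def \<delta>_None intro!: holo_diff holo_mult whom_diff whom_cst_mult whom_w Bn1)
  have Bn: "B None = cst c * w + b" by (simp add: b_def)
  define B' where "B' = zpart B"
  have B'h: "holo (B' k)" for k unfolding B'_def by (rule zpart_holo[OF Bh])
  have B'w: "pd (Inl None) (B' k) = 0" for k using B1s unfolding B'_def by (cases k) (auto simp: B1_def)
  have B'f: "field_weight \<delta> 0 B'" unfolding B'_def by (rule zpart_fhom[OF Bf])
  define \<beta> where "\<beta> = D B' p"
  have \<beta>: "D B p = \<beta>" by (simp add: \<beta>_def B'_def D_zpart p_wfree)
  have wB': "wfree (B' k)" for k using B'h B'w by (rule wfree_holo)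
  have w\<beta>: "wfree \<beta>" unfolding \<beta>_def by (intro wfree_D wB' wfree_p)
  \<comment> \<open>Since hi (w - wb) = r - p, the term c w of the w-component leaves -c p modulo
    r.\<close>
  have G0: "hi * b + C (hi * b) + \<beta> + C \<beta> - cst c * p = 0"
  proof (rule wfree_dvd)
    show "wfree (hi * b + C (hi * b) + \<beta> + C \<beta> - cst c * p)"
      by (intro wfree_add wfree_diff wfree_C wfree_mult wfree_cst wfree_p w\<beta> wfree_holo b)
    have "D B r + Db B r = (hi * b + C (hi * b) + \<beta> + C \<beta> - cst c * p) + r * cst c"
      unfolding C_D_r[symmetric] D_r \<beta> Bn
      by (rule pol_eqI) (simp add: ev_C r_def cr field_simps)
    then show "r dvd hi * b + C (hi * b) + \<beta> + C \<beta> - cst c * p"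
      using Bt unfolding tang_def by (metis dvd_add_left_iff dvd_triv_left)
  qed
  have hib: "holo (hi * b)" by (intro holo_mult b) simp
  have cC: "wcomp (wh \<delta>) a (C f) = (if a = 0 then C f else 0)" if "holo f" for f a
    using holo_isw_wa[OF that, of \<delta>] by (intro wcomp_hom) (simp add: whom_C')
  have cmpB: "wcomp (wh \<delta>) a \<beta> = D B' (P a)" for a
    using wcomp_D[OF B'f, where a = a and f = p] by (simp add: \<beta>_def P_def)
  have cmpCB: "wcomp (wh \<delta>) a (C \<beta>) = Db B' (P a)" for a
    using wcomp_Db[where A = B' and \<delta> = \<delta> and a = a and f = p, OF B'h] by (simp add: \<beta>_def P_def C_D p_real)
  \<comment> \<open>In holomorphic weight 1 the components of p vanish, and only hi * b is
    left.\<close>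
  have "hi * b = 0"
  proof -
    have "wcomp (wh \<delta>) 1 (hi * b) = hi * b" using b(3) by (simp add: wcomp_hom)
    then show ?thesis
      using arg_cong[OF G0, of "wcomp (wh \<delta>) 1"] cC[OF hib, of 1] cmpB[of 1] cmpCB[of 1] P_0[of 1]
      by (simp add: P_def[symmetric] del: C_simps(4,7) wcomp_cst_mult) (simp add: P_def[symmetric])
  qed
  then have b0: "b = 0" by simp
  have C\<beta>: "C \<beta> = cst c * p - \<beta>" using G0 b0 by (simp add: algebra_simps)
  define e where "e = Q None - cst (c / 2) * (w * w)"
  define E where "E k = zpart Q k - w * B' k" for k
  have Eh: "holo (E k)" for k unfolding E_def by (intro holo_diff holo_mult zpart_holo Q(1) B'h) simp
  have EN: "E None = 0" by (simp add: E_def B'_def)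
  have Ew: "pd (Inl None) (E k) = 0" for k
    using B'w[of k] by (cases k) (auto simp: E_def B'_def pd_mult pd_var B_def)
  have Ef: "field_weight \<delta> 1 E" unfolding field_weight_def E_def
  proof
    fix k
    have "whom (wh \<delta>) (\<delta> None + (0 + \<delta> k)) (w * B' k)"
      using B'f whom_var[of "wh \<delta>" "Inl None"] unfolding field_weight_def by (intro whom_mult) auto
    then show "whom (wh \<delta>) (1 + \<delta> k) (zpart Q k - w * B' k)"
      using zpart_fhom[OF Q(2)] by (intro whom_diff) (auto simp: field_weight_def \<delta>_None)
  qed
  have eh: "holo e" unfolding e_def by (intro holo_diff holo_mult Q(1)) auto
  have ew: "pd (Inl None) e = 0"
  proof -
    have "pd (Inl None) e = B None - cst (c / 2) * (w + w)"
      by (simp add: e_def pd_mult pd_var B_def)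
    also have "cst (c / 2) * (w + w) = cst c * w" by (rule pol_eqI) simp
    finally show ?thesis using Bn b0 by simp
  qed
  have Qn: "Q None = cst (c / 2) * (w * w) + e" by (simp add: e_def)
  have "D Q p = D (\<lambda>k. w * B' k + E k) p"
    unfolding D_zpart[OF p_wfree, of Q, symmetric] by (simp add: E_def)
  then have DQp: "D Q p = w * \<beta> + D E p" unfolding D_lincomb \<beta>_def .
  define \<epsilon> where "\<epsilon> = D E p"
  have wE: "wfree (E k)" for k using Eh Ew by (rule wfree_holo)
  have w\<epsilon>: "wfree \<epsilon>" unfolding \<epsilon>_def by (intro wfree_D wE wfree_p)
  \<comment> \<open>The remainder of D Q r + Db Q r after replacing w - wb by -2i p and
    \<open>C \<beta>\<close> by c p - \<beta>; the surviving w + wb stands in the multiple of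
    r.\<close>
  define G where "G = cst (\<i> * c) * (p * p) - cst (2 * \<i>) * (p * \<beta>) + hi * e + C (hi * e) + \<epsilon> + C \<epsilon>"
  have G: "G = 0"
  proof (rule wfree_dvd)
    show "wfree G" unfolding G_def
      by (intro wfree_add wfree_diff wfree_C wfree_mult wfree_cst wfree_p w\<beta> w\<epsilon> wfree_holo eh ew)
    have C\<beta>': "cnj (ev \<beta> (\<lambda>v. cnj (x (swp v)))) = c * ev p x - ev \<beta> x" for x
      using arg_cong[OF C\<beta>, of "\<lambda>f. ev f x"] by (simp add: ev_C)
    have "D Q r + Db Q r = G + r * (cst (c / 2) * (w + wb) - cst (\<i> * c) * p + cst (2 * \<i>) * \<beta>)"
      unfolding C_D_r[symmetric] D_r DQp \<epsilon>_def[symmetric] Qn G_def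
      by (rule pol_eqI) (simp add: ev_C r_def cr C\<beta>' field_simps)
    then show "r dvd G" using Q(3) unfolding tang_def by (metis dvd_add_left_iff dvd_triv_left)
  qed
  have pb: "cst (2 * \<i>) * (p * \<beta>) = cst \<i> * D B' (p * p)"
    by (rule pol_eqI) (simp add: D_mult \<beta>_def)
  have e2: "whom (wh \<delta>) 2 (hi * e)" unfolding e_def
  proof (intro whom_cst_mult whom_diff)
    show "whom (wh \<delta>) 2 (Q None)" using Q(2)[unfolded field_weight_def, rule_format, of None] by (simp add: \<delta>_None)
    show "whom (wh \<delta>) 2 (w * w)" using whom_mult[OF whom_var whom_var, of "wh \<delta>" "Inl None" "Inl None"] by (simp add: \<delta>_None)
  qed
  have hie: "holo (hi * e)" by (intro holo_mult eh) simp
  have cmpG: "cst (\<i> * c) * wcomp (wh \<delta>) a (p * p) - cst \<i> * D B' (wcomp (wh \<delta>) a (p * p))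
      + (if a = 2 then hi * e else 0) + (if a = 0 then C (hi * e) else 0) + D E (P (a - 1)) + Db E (P a) = 0" for a
  proof -
    have 1: "wcomp (wh \<delta>) a (D B' (p * p)) = D B' (wcomp (wh \<delta>) a (p * p))"
      using wcomp_D[OF B'f, where a = a and f = "p * p"] by simp
    have 2: "wcomp (wh \<delta>) a (hi * e) = (if a = 2 then hi * e else 0)" by (rule wcomp_hom[OF e2])
    have 3: "wcomp (wh \<delta>) a (C (hi * e)) = (if a = 0 then C (hi * e) else 0)" by (rule cC[OF hie])
    have 4: "wcomp (wh \<delta>) a \<epsilon> = D E (P (a - 1))"
      using wcomp_D[OF Ef, where a = a and f = p] by (simp add: \<epsilon>_def P_def)
    have 5: "wcomp (wh \<delta>) a (C \<epsilon>) = Db E (P a)"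
      using wcomp_Db[where A = E and \<delta> = \<delta> and a = a and f = p, OF Eh] by (simp add: \<epsilon>_def P_def C_D p_real)
    have "wcomp (wh \<delta>) a G = cst (\<i> * c) * wcomp (wh \<delta>) a (p * p) - cst \<i> * wcomp (wh \<delta>) a (D B' (p * p))
      + wcomp (wh \<delta>) a (hi * e) + wcomp (wh \<delta>) a (C (hi * e)) + wcomp (wh \<delta>) a \<epsilon> + wcomp (wh \<delta>) a (C \<epsilon>)"
      unfolding G_def pb wcomp_add wcomp_diff by (simp only: wcomp_cst_mult)
    then show ?thesis unfolding 1 2 3 4 5 G by simp
  qed
  define S where "S = wcomp (wh \<delta>) 1 (p * p)"
  \<comment> \<open>In weight 1, which is the balanced part of p^2, E contributes only through P 0
    and P 1, and these are zero; so B' and c times the Euler field agree on S.\<close>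
  have "cst \<i> * (cst c * S - D B' S) = 0"
    using cmpG[of 1] P_0[of 0] P_0[of 1] by (simp add: S_def cst_hom algebra_simps)
  then have DBS: "D B' S = cst c * S" by simp
  have Sw: "pd (Inl None) S = 0" unfolding S_def P_square by (simp add: pd_mult P_wfree)
  have "D euler S = S" unfolding D_euler[OF Sw] using whom_cmp[of "wh \<delta>" 1 "p * p"] by (simp add: whom_def S_def cst_hom)
  then have DA: "D (\<lambda>k. - cst c * euler k + B' k) S = 0" unfolding D_lincomb by (simp add: DBS)
  have A0: "- cst c * euler k + B' k = 0" for k
  proof (rule N1[of "\<lambda>k. - cst c * euler k + B' k"])
    show "holo (- cst c * euler k + B' k)" for k by (intro holo_add holo_mult holo_uminus holo_euler B'h) simp
    show "pd (Inl None) (- cst c * euler k + B' k) = 0" for k by (simp add: pd_mult pd_euler B'w)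
    show "- cst c * euler None + B' None = 0" by (simp add: euler_def B'_def)
  qed (use DA in \<open>simp add: S_def\<close>)
  then have B'e: "B' = (\<lambda>k. cst c * euler k + 0)" by (auto simp: fun_eq_iff algebra_simps)
  have c0: "c \<noteq> 0"
  proof
    assume "c = 0"
    then have "B k = 0" for k
      using Bn b0 A0[of k] by (cases k) (auto simp: B'_def cst_hom)
    then show False using ne by (simp add: B_def)
  qed
  \<comment> \<open>In weight 1 + h the Euler field multiplies by 1 + h, which exceeds 1 by h; this
    is the origin of the coefficient i c h. Weight 2, where e enters, is settled separately.\<close>
  have rel: "D E (P h) = cst ((\<i> * c) * of_real h) * wcomp (wh \<delta>) (1 + h) (p * p)" if h: "0 < h" for h
  proof (cases "h = 1")
    case True
    have "wcomp (wh \<delta>) 2 (p * p) = 0" unfolding P_square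
    proof (intro sum.neutral ballI)
      fix a
      show "P a * P (2 - a) = 0" using P_0[of a] P_0[of "2 - a"] by (cases "a \<ge> 1") auto
    qed
    then show ?thesis using True P_0[of 1] by simp
  next
    case False
    define T where "T = wcomp (wh \<delta>) (1 + h) (p * p)"
    have Tw: "pd (Inl None) T = 0" unfolding T_def P_square by (simp add: pd_mult P_wfree)
    have "D B' T = cst c * (rc (1 + h) * T)"
      unfolding B'e D_lincomb D_zero_field D_euler[OF Tw]
      using whom_cmp[of "wh \<delta>" "1 + h" "p * p"] by (simp add: whom_def T_def)
    then have "cst (\<i> * c) * T - cst \<i> * (cst c * (rc (1 + h) * T)) + D E (P h) = 0"
      using cmpG[of "1 + h"] False h P_0[of "1 + h"] by (simp add: T_def)
    moreover have "cst (\<i> * c) * T - cst \<i> * (cst c * (rc (1 + h) * T)) = - (cst ((\<i> * c) * of_real h) * T)"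
      by (rule pol_eqI) (simp add: algebra_simps)
    ultimately show ?thesis by (simp add: T_def)
  qed
  have up: "P h = 0" if "1 / 2 < h" for h
    by (rule no_square_field[OF Eh EN Ew _ rel that]) (use c0 in simp)
  assume "h \<noteq> 1 / 2"
  then consider "1 / 2 < h" | "1 / 2 < 1 - h" by linarith
  then show "P h = 0"
  proof cases
    case 2
    then show ?thesis using up[OF 2] C_P[of h] by (metis C_eq_0_iff)
  qed (rule up)
qed

end

lemma D_iter_diff: "(D A ^^ k) (f - g) = (D A ^^ k) f - (D A ^^ k) g"
  by (induction k) auto

context model
begin

text \<open>A field of negative weight that does not vanish at the origin is nilpotent, and its time-one map
  moves the origin to a nonzero point; were \<open>\<kappa>\<close> zero, that point would be a common zero.\<close>

lemma kappa_nonzero: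
  assumes T: "\<And>k. holo (T k)" "\<And>k. pd (Inl None) (T k) = 0" "field_weight \<delta> (- \<nu>) T"
    and \<nu>: "0 < \<nu>" "real M * \<nu> = 1" "\<delta> (Some j0) = \<nu>"
    and T0: "ev (T (Some j0)) (\<lambda>_. 0) \<noteq> 0"
    and sk: "D T r + Db T r = 0"
  shows "(D T ^^ M) r \<noteq> 0"
proof
  assume \<kappa>: "(D T ^^ M) r = 0"
  define X where "X = zpart T"
  have X: "holo (X k)" "pd (Inl None) (X k) = 0" for k
    unfolding X_def by (rule zpart_holo[OF T(1)], rule zpart_pd[OF T(2)])
  have Xf: "field_weight \<delta> (- \<nu>) X" unfolding X_def by (rule zpart_fhom[OF T(3)])
  have XN: "X None = 0" by (simp add: X_def)
  have DX: "D X f = D T f" if "pd (Inl None) f = 0" for f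
    unfolding X_def by (rule D_zpart[OF that])
  have DXi: "(D X ^^ i) f = (D T ^^ i) f" if "pd (Inl None) f = 0" for f i
    by (induction i) (simp_all add: DX pd_D_iter[OF T(2) that])
  have neg: "(D X ^^ k) f = 0" if "whom (wh \<delta>) a f" "a < real k * \<nu>" for f a k
    by (rule whom_neg[OF whom_D_iter[OF Xf that(1)] _ wh_nonneg, of k]) (use that in simp)
  \<comment> \<open>The image of the origin at time one; the series is finite because X has negative
    weight.\<close>
  define \<zeta> where "\<zeta> k = (\<Sum>j. flow_term (ext X) (case_sum (\<lambda>_. 0) (\<lambda>_. 0)) 1 (var (Inl k)) j)" for k
  have ev\<zeta>: "ev f (case_sum \<zeta> \<eta>) = (\<Sum>j. flow_term (ext X) (case_sum (\<lambda>_. 0) \<eta>) 1 f j)" for f \<eta>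
    unfolding \<zeta>_def
  proof (rule flow_holo[OF X(1)])
    fix k
    obtain N where N: "\<delta> k / \<nu> < real N" using reals_Archimedean2 by blast
    show "summable (\<lambda>j. norm (flow_term (ext X) (case_sum (\<lambda>_. 0) (\<lambda>_. 0)) 1 (var (Inl k)) j))"
    proof (rule summable_finite[of "{..<N}"])
      fix j assume "j \<notin> {..<N}"
      then have "\<delta> k / \<nu> < real j" using N by simp
      then have "\<delta> k < real j * \<nu>" using \<nu>(1) by (simp add: field_simps)
      then have "(D X ^^ j) (var (Inl k)) = 0" using whom_var[of "wh \<delta>" "Inl k"] by (intro neg[of "\<delta> k"]) auto
      then show "norm (flow_term (ext X) (case_sum (\<lambda>_. 0) (\<lambda>_. 0)) 1 (var (Inl k)) j) = 0"
        by (simp add: flow_term_def D_def)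
    qed simp
  qed
  \<comment> \<open>At z = 0 only derivatives of holomorphic weight 0 can be nonzero, and at most
    one exponent produces that weight.\<close>
  have ev0: "ev f (case_sum \<zeta> \<eta>) = 0"
    if f: "whom (wh \<delta>) a f" "\<And>i. a = real i * \<nu> \<Longrightarrow> ev ((D X ^^ i) f) (case_sum (\<lambda>_. 0) \<eta>) = 0" for f a \<eta>
  proof -
    have "flow_term (ext X) (case_sum (\<lambda>_. 0) \<eta>) 1 f j = 0" for j
    proof (cases "a = real j * \<nu>")
      case True
      then show ?thesis using f(2) by (simp add: flow_term_def D_def)
    next
      case False
      have "ev ((D X ^^ j) f) (case_sum (\<lambda>_. 0) \<eta>) = 0"
        by (rule whom_ev_0[OF whom_D_iter[OF Xf f(1)]]) (use False in \<open>auto split: sum.splits\<close>)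
      then show ?thesis by (simp add: flow_term_def D_def)
    qed
    then show ?thesis by (simp add: ev\<zeta>)
  qed
  have \<zeta>N: "\<zeta> None = 0"
  proof -
    have "ev w (case_sum \<zeta> (\<lambda>_. 0)) = 0"
    proof (rule ev0[OF whom_w])
      fix i assume "1 = real i * \<nu>"
      then obtain i' where "i = Suc i'" by (cases i) auto
      then show "ev ((D X ^^ i) w) (case_sum (\<lambda>_. 0) (\<lambda>_. 0)) = 0"
        by (simp add: funpow_swap1 XN D_iter_linear)
    qed
    then show ?thesis by simp
  qed
  have Dbr: "(Db T ^^ i) r = cst ((-1) ^ i) * (D T ^^ i) r" for i
  proof (induction i)
    case (Suc i)
    have "Db T ((D T ^^ i) r) = (D T ^^ i) (Db T r)"
      using D_iter_Db_commute[where A = T and i = i and j = 1 and f = r, OF T(1)] by simp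
    also have "Db T r = - D T r" using sk by (simp add: eq_neg_iff_add_eq_0 add.commute)
    also have "(D T ^^ i) (- D T r) = - (D T ^^ Suc i) r"
      by (simp add: D_iter_linear funpow_swap1)
    finally show ?case using Suc by (simp add: cst_hom)
  qed (simp add: cst_hom)
  \<comment> \<open>Tangency makes Db act on r as -D, so the mixed derivative is D^M r up to sign;
    the terms coming from w are pure and disappear once both exponents are positive.\<close>
  have zero: "(D X ^^ j) ((Db X ^^ i) p) = 0" if ij: "0 < i" "0 < j" "i + j = M" for i j
  proof -
    obtain i' where i': "i = Suc i'" using ij(1) by (cases i) auto
    obtain j' where j': "j = Suc j'" using ij(2) by (cases j) auto
    define h where "h = (D T ^^ i') (hi * T None)"
    have hh: "holo h" unfolding h_def by (intro holo_D_iter T(1) holo_mult) simp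
    have "(D T ^^ i) r = h + (D X ^^ i) p"
      unfolding DXi[OF p_wfree] unfolding i' funpow_Suc_right o_apply D_r by (simp add: D_iter_linear h_def)
    then have 1: "(Db T ^^ i) r = C h + (Db X ^^ i) p"
      using C_D_iter[of i T r] C_D_iter[of i X p] by (simp add: C_r p_real)
    have w: "pd (Inl None) ((Db X ^^ i) p) = 0"
    proof -
      have "pd (Inr None) ((D X ^^ i) p) = 0"
        by (rule pd_D_iter) (use X(1) p_wfree' in \<open>auto simp: holo_def\<close>)
      then have "pd (Inl None) (C ((D X ^^ i) p)) = 0"
        using pd_C[of None "C ((D X ^^ i) p)"] by simp
      then show ?thesis by (simp add: C_D_iter p_real)
    qed
    have "(D T ^^ j) ((Db T ^^ i) r) = (D X ^^ j) ((Db X ^^ i) p)"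
      unfolding 1 DXi[OF w] by (simp add: D_iter_linear j' funpow_swap1 D_C_holo[OF hh])
    moreover have "(D T ^^ j) ((Db T ^^ i) r) = cst ((-1) ^ i) * (D T ^^ M) r"
      unfolding Dbr D_iter_linear ij(3)[symmetric] by (simp add: funpow_add[symmetric] add.commute flip: o_apply[where f = "D T ^^ j"])
    ultimately show ?thesis using \<kappa> by simp
  qed
  have "ev (P h) (case_sum \<zeta> (cnj \<circ> \<zeta>)) = 0" for h
  proof (cases "0 < h \<and> h < 1")
    case False
    then have "P h = 0" by (intro P_0) auto
    then show ?thesis by simp
  next
    case True
    show ?thesis
    proof (rule ev0[OF whom_P])
      fix i assume i: "h = real i * \<nu>"
      define g where "g = (Db X ^^ i) (P (1 - h))"
      have g: "g = C ((D X ^^ i) (P h))" by (simp add: g_def C_D_iter C_P)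
      have "ev g (case_sum \<zeta> (\<lambda>_. 0)) = 0"
      proof (rule ev0)
        show "whom (wh \<delta>) (1 - h) g" unfolding g_def by (rule whom_Db_iter_wh[OF X(1) whom_P])
        fix j assume j: "1 - h = real j * \<nu>"
        have "real (i + j) * \<nu> = real M * \<nu>" using i j \<nu>(2) by (simp add: algebra_simps)
        then have "i + j = M" using \<nu>(1) by (simp flip: of_nat_add)
        moreover have "0 < i" "0 < j" using i j True by (auto intro: Nat.gr0I)
        ultimately have z: "(D X ^^ j) ((Db X ^^ i) p) = 0" using zero by blast
        have c1: "wcomp (wh \<delta>) a ((Db X ^^ i) f) = (Db X ^^ i) (wcomp (wh \<delta>) a f)" for a f
          by (induction i) (auto simp: wcomp_Db[where A = X, OF X(1)])
        have c2: "wcomp (wh \<delta>) a ((D X ^^ j) f) = (D X ^^ j) (wcomp (wh \<delta>) (a + real j * \<nu>) f)" for a f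
          by (induction j arbitrary: a) (auto simp: wcomp_D[OF Xf] algebra_simps)
        have "wcomp (wh \<delta>) 0 ((D X ^^ j) ((Db X ^^ i) p)) = (D X ^^ j) g"
          unfolding c2 c1 g_def by (simp add: P_def j)
        then show "ev ((D X ^^ j) g) (case_sum (\<lambda>_. 0) (\<lambda>_. 0)) = 0" using z by simp
      qed
      then show "ev ((D X ^^ i) (P h)) (case_sum (\<lambda>_. 0) (cnj \<circ> \<zeta>)) = 0"
        by (simp add: g ev_C_case_sum o_def)
    qed
  qed
  then have "\<zeta> (Some j0) = 0" using null[where \<zeta> = \<zeta>, OF \<zeta>N] unfolding P_def by blast
  \<comment> \<open>This coordinate has weight \<nu>, so a second derivative along X vanishes and
    the value at time one is the first-order term at the origin.\<close>
  moreover have "\<zeta> (Some j0) = ev (T (Some j0)) (\<lambda>_. 0)"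
  proof -
    have "(D X ^^ 2) (var (Inl (Some j0))) = 0"
      using whom_var[of "wh \<delta>" "Inl (Some j0)"] \<nu> by (intro neg[of \<nu>]) auto
    then have "\<zeta> (Some j0) = (\<Sum>j<2. flow_term (ext X) (case_sum (\<lambda>_. 0) (\<lambda>_. 0)) 1 (var (Inl (Some j0))) j)"
      unfolding \<zeta>_def by (intro flow_term_suminf) (simp add: D_def)
    moreover have "case_sum (\<lambda>_. 0) (\<lambda>_. 0) = (\<lambda>_::'n option + 'n option. 0::complex)" by (auto split: sum.splits)
    ultimately show ?thesis by (simp add: flow_term_def numeral_2_eq_2 X_def)
  qed
  ultimately show False using T0 by simp
qed

text \<open>With \<open>T\<close> the w-derivative of \<open>Q\<close> and \<open>\<eta> = T r\<close>, tangency becomes \<open>(Q + Qb) r = 2 i r \<eta>\<close>. If \<open>M > 2\<close>, the bracket of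
  \<open>T\<close> and \<open>Q\<close> has positive weight, hence vanishes, and applying \<open>T\<close> to this identity \<open>2 M - 1\<close> times gives a contradiction.
  If \<open>M = 2\<close>, iterated brackets of \<open>T\<close> and \<open>Q\<close> produce a field \<open>Q''\<close> of weight 1 to which the previous case applies.\<close>

lemma weight_fraction:
  assumes Q: "\<And>k. holo (Q k)" "field_weight \<delta> \<mu> Q" "tang Q" and \<mu>: "0 < \<mu>" "\<mu> < 1"
    and top: "\<And>k. pd (Inl None) (pd (Inl None) (Q k)) = 0" and ne: "pd (Inl None) (Q k0) \<noteq> 0"
  shows "h \<noteq> 1 / 2 \<Longrightarrow> P h = 0"
proof -
  define \<nu> where "\<nu> = 1 - \<mu>"
  have \<nu>: "0 < \<nu>" "\<nu> < 1" using \<mu> by (auto simp: \<nu>_def)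
  define T where "T k = pd (Inl None) (Q k)" for k
  have Th: "holo (T k)" for k unfolding T_def by (rule holo_pd[OF Q(1)])
  have Tt: "tang T" unfolding T_def by (rule tang_pd[OF Q(1,3)])
  have Tw: "pd (Inl None) (T k) = 0" for k unfolding T_def by (rule top)
  have Tf: "field_weight \<delta> (- \<nu>) T" unfolding field_weight_def
  proof
    fix k
    have "whom (wh \<delta>) (\<mu> + \<delta> k) (Q k)" using Q(2) by (simp add: field_weight_def)
    from whom_pd[OF this, of None] show "whom (wh \<delta>) (- \<nu> + \<delta> k) (T k)"
      by (simp add: T_def \<delta>_None \<nu>_def algebra_simps)
  qed
  have sk: "D T r + Db T r = 0" by (rule tang_wfree[OF Th Tw Tt])
  \<comment> \<open>A nonzero w-free field of this weight must have a component j0 that does not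
    vanish at the origin; by weight this forces \<delta> j0 = \<nu>, so 1/\<nu> is an integer
    M.\<close>
  obtain j0 where j0: "ev (T (Some j0)) (\<lambda>_. 0) \<noteq> 0"
    using wfree_field_zero[OF Th Tw Tt Tf, of k0] \<nu> ne by (auto simp: T_def)
  have \<delta>j: "\<delta> (Some j0) = \<nu>"
  proof (rule ccontr)
    assume "\<delta> (Some j0) \<noteq> \<nu>"
    then have "ev (T (Some j0)) (\<lambda>_. 0) = 0"
      using Tf by (intro whom_ev_0[of "wh \<delta>" "- \<nu> + \<delta> (Some j0)"]) (auto simp: field_weight_def)
    then show False using j0 by simp
  qed
  obtain M :: nat where M: "2 \<le> M" "real M * \<nu> = 1" using \<delta>_inv[of j0] unfolding \<delta>j by blast
  have kap: "(D T ^^ M) r \<noteq> 0" by (rule kappa_nonzero[OF Th Tw Tf \<nu>(1) M(2) \<delta>j j0 sk])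
  \<comment> \<open>M steps lower the holomorphic weight by 1, so they kill every component of p as
    well as wb; what survives of r comes from w and is a constant \<kappa>.\<close>
  have DTw: "(D T ^^ M) r = (D T ^^ M) (hi * w)"
  proof -
    obtain M' where M': "M = Suc M'" using M(1) by (cases M) auto
    have "(D T ^^ M) (P h) = 0" for h
    proof (cases "h < 1")
      case True
      show ?thesis by (rule whom_neg[OF whom_D_iter[OF Tf whom_P] _ wh_nonneg]) (use True M(2) in simp)
    qed (simp add: P_0 D_iter_linear)
    then have "(D T ^^ M) p = 0" using P_sum by (metis (no_types, lifting) D_iter_sum sum.neutral)
    moreover have "r = hi * w + (- hi) * wb + p" by (simp add: r_def algebra_simps)
    moreover have "(D T ^^ M) ((- hi) * wb) = 0"
      by (simp add: M' funpow_swap1 D_mult D_iter_linear)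
    ultimately show ?thesis by (simp add: D_iter_linear D_iter_diff)
  qed
  have "whom (wh \<delta>) 0 ((D T ^^ M) (hi * w))"
    using whom_D_iter[OF Tf whom_cst_mult[OF whom_w], of M] M(2) by simp
  moreover have "holo ((D T ^^ M) (hi * w))" by (intro holo_D_iter Th holo_mult) auto
  ultimately obtain \<kappa> where \<kappa>: "(D T ^^ M) r = cst \<kappa>"
    unfolding DTw using holo_const[where \<delta> = \<delta> and f = "(D T ^^ M) (hi * w)", OF _ _ \<delta>_pos] by blast
  have \<kappa>0: "\<kappa> \<noteq> 0" using kap \<kappa> by auto
  define \<eta> where "\<eta> = D T r"
  have Dbr: "Db T r = - \<eta>" using sk by (simp add: \<eta>_def eq_neg_iff_add_eq_0 add.commute)
  have C\<eta>: "C \<eta> = - \<eta>" using Dbr C_D_r[of T] by (simp add: \<eta>_def)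
  define q where "q k = Q k - w * T k" for k
  have qh: "holo (q k)" for k unfolding q_def by (intro holo_diff holo_mult Q(1) Th) simp
  have qw: "pd (Inl None) (q k) = 0" for k by (simp add: q_def pd_mult pd_var T_def top)
  have Tw': "wfree (T k)" and qw': "wfree (q k)" for k
    using Th Tw qh qw by (auto intro: wfree_holo)
  have Qq: "Q = (\<lambda>k. w * T k + q k)" by (auto simp: q_def)
  have DQ: "D Q f = w * D T f + D q f" for f by (subst Qq) (rule D_lincomb)
  have w\<eta>: "wfree \<eta>" unfolding \<eta>_def D_r by (intro wfree_add wfree_mult wfree_cst wfree_D Tw' wfree_p)
  have wq: "wfree (D q r)" unfolding D_r by (intro wfree_add wfree_mult wfree_cst wfree_D qw' wfree_p)
  have wr: "w - wb = cst (2 * \<i>) * (r - p)" by (rule pol_eqI) (simp add: r_def)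
  have F: "D Q r + Db Q r = (w - wb) * \<eta> + (D q r + Db q r)"
    unfolding C_D_r[symmetric] DQ by (simp add: C\<eta> \<eta>_def[symmetric] algebra_simps)
  have f: "D q r + Db q r - cst (2 * \<i>) * (p * \<eta>) = 0"
  proof (rule wfree_dvd)
    show "wfree (D q r + Db q r - cst (2 * \<i>) * (p * \<eta>))"
      unfolding C_D_r[symmetric] by (intro wfree_add wfree_diff wfree_C wfree_mult wfree_cst wfree_p wq w\<eta>)
    have "D Q r + Db Q r = (D q r + Db q r - cst (2 * \<i>) * (p * \<eta>)) + r * (cst (2 * \<i>) * \<eta>)"
      unfolding F wr by (simp add: algebra_simps)
    then show "r dvd D q r + Db q r - cst (2 * \<i>) * (p * \<eta>)"
      using Q(3) unfolding tang_def by (metis dvd_add_left_iff dvd_triv_left)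
  qed
  have main: "D Q r + Db Q r = cst (2 * \<i>) * (r * \<eta>)"
    unfolding F wr using f by (simp add: algebra_simps)
  define G where "G = hbrk T Q"
  have Gh: "holo (G k)" for k unfolding G_def by (rule holo_hbrk[OF Th Q(1)])
  have Gt: "tang G" unfolding G_def by (rule tang_hbrk[OF Th Q(1) Tt Q(3)])
  have Gf: "field_weight \<delta> (\<mu> - \<nu>) G" using field_weight_hbrk[OF Tf Q(2)] by (simp add: G_def add.commute)
  have Gw: "pd (Inl None) (G k) = 0" for k
    unfolding G_def pd_hbrk T_def[symmetric] Tw by (simp add: hbrk_zero) (simp add: hbrk_def)
  have TQ: "D T (D Q f) = D Q (D T f) + D G f" for f by (simp add: G_def D_hbrk)
  have TQb: "D T (Db Q f) = Db Q (D T f)" for f by (rule D_Db_commute[OF Th Q(1)])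
  have "M = 2"
  proof (rule ccontr)
    assume "M \<noteq> 2"
    then have "2 < real M" using M(1) by simp
    then have "2 * \<nu> < 1" using M(2) \<nu>(1) by (metis mult_less_cancel_right_pos)
    then have l: "0 < \<mu> - \<nu>" by (simp add: \<nu>_def)
    have "G k = 0" for k
    proof (rule wfree_field_zero[OF Gh Gw Gt Gf])
      show "ev (G (Some j)) (\<lambda>_. 0) = 0" for j
        using Gf l \<delta>_pos[of "Some j"] by (intro whom_ev_0[of "wh \<delta>" "\<mu> - \<nu> + \<delta> (Some j)"]) (auto simp: field_weight_def)
    qed (use l in auto)
    then have G0: "D G f = 0" for f by (simp add: D_pd)
    have comm: "(D T ^^ k) (D Q f + Db Q f) = D Q ((D T ^^ k) f) + Db Q ((D T ^^ k) f)" for k f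
      by (induction k) (simp_all add: TQ TQb G0)
    have T0: "(D T ^^ Suc M) r = 0" using \<kappa> by simp
    have ge: "(D T ^^ k) r = 0" if "Suc M \<le> k" for k
      using der_iter_ge[of "Suc M" "ext T" r k] T0 that unfolding D_def by blast
    \<comment> \<open>N = 2 M - 1 is at least M + 1, enough to kill r on the left of
      \<open>main\<close>; on the right T (r^2) = 2 r \<eta>, so N applications of T give half of
      T^(2 M) (r^2), its top derivative.\<close>
    obtain N where N: "2 * M = Suc N" "Suc M \<le> N" using M(1) by (cases "2 * M") auto
    have "(D T ^^ N) (cst (2 * \<i>) * (r * \<eta>)) = 0"
      unfolding main[symmetric] comm ge[OF N(2)] by simp
    then have "(D T ^^ N) (r * \<eta>) = 0" by (simp add: D_iter_linear)
    moreover have "D T (r * r) = cst 2 * (r * \<eta>)" by (rule pol_eqI) (simp add: D_mult \<eta>_def)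
    ultimately have "(D T ^^ (M + M)) (r * r) = 0"
      using N(1) by (simp add: mult_2[symmetric] funpow_swap1 D_iter_linear)
    moreover have "(D T ^^ (M + M)) (r * r) = of_nat ((M + M) choose M) * (cst \<kappa> * cst \<kappa>)"
      using der_iter_mult_top[of M "ext T" r M r] T0 \<kappa> unfolding D_def by simp
    ultimately show False using \<kappa>0 by simp
  qed
  then have \<nu>12: "\<nu> = 1/2" "\<mu> = 1/2" using M(2) by (auto simp: \<nu>_def)
  define K where "K = (cst \<kappa> :: ('n option + 'n option) pol)"
  have T\<eta>: "D T \<eta> = K" using \<kappa> \<open>M = 2\<close> by (simp add: \<eta>_def K_def numeral_2_eq_2)
  have DK: "D A K = 0" "Db A K = 0" for A by (simp_all add: K_def)
  \<comment> \<open>G has weight 0, T' weight -1/2, Q' weight 1/2 and Q'' weight 1. Since d/dw maps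
    Q to T and kills T, G and T', two w-derivatives turn Q'' into 2 [T, T'].\<close>
  define T' where "T' = hbrk T G"
  define Q' where "Q' = hbrk Q G"
  define Q'' where "Q'' = hbrk Q Q'"
  have Q'h: "holo (Q' k)" for k unfolding Q'_def by (rule holo_hbrk[OF Q(1) Gh])
  have Q''h: "holo (Q'' k)" for k unfolding Q''_def by (rule holo_hbrk[OF Q(1) Q'h])
  have Q''t: "tang Q''" unfolding Q''_def Q'_def
    by (intro tang_hbrk Q holo_hbrk Gh Gt)
  have Q''f: "field_weight \<delta> 1 Q''"
    using field_weight_hbrk[OF Q(2) field_weight_hbrk[OF Q(2) Gf]] by (simp add: Q''_def Q'_def \<nu>12)
  have TG: "D T (D G f) = D G (D T f) + D T' f" for f by (simp add: T'_def D_hbrk)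
  \<comment> \<open>Applying T, and later its conjugate, to \<open>main\<close> determines [T, T'] r
    without explicit knowledge of G or T'.\<close>
  have e1: "D Q \<eta> + D G r + Db Q \<eta> = cst (2 * \<i>) * (\<eta> * \<eta> + r * K)"
    using arg_cong[OF main, of "D T"] by (simp add: TQ TQb \<eta>_def[symmetric] D_mult T\<eta> algebra_simps)
  have e2: "cst 2 * D G \<eta> + D T' r = cst (6 * \<i>) * (K * \<eta>)"
  proof -
    have "D T (D Q \<eta> + D G r + Db Q \<eta>) = D G \<eta> + (D G \<eta> + D T' r)"
      by (simp add: TQ TQb TG T\<eta> DK \<eta>_def[symmetric])
    moreover have "D T (cst (2 * \<i>) * (\<eta> * \<eta> + r * K)) = cst (6 * \<i>) * (K * \<eta>)"
      by (rule pol_eqI) (simp add: D_mult T\<eta> DK \<eta>_def[symmetric] algebra_simps)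
    moreover have "D G \<eta> + (D G \<eta> + D T' r) = cst 2 * D G \<eta> + D T' r"
      by (rule pol_eqI) simp
    ultimately show ?thesis using e1 by metis
  qed
  have T'h: "holo (T' k)" for k unfolding T'_def by (rule holo_hbrk[OF Th Gh])
  have Tb\<eta>: "Db T \<eta> = - K"
    using D_Db_commute[of T T r, OF Th Th] by (simp add: \<eta>_def[symmetric] Dbr T\<eta>)
  have e3: "D T' \<eta> = cst (6 * \<i>) * (K * K)"
  proof -
    have "Db T (D G \<eta>) = 0"
      using D_Db_commute[of G T \<eta>, OF Gh Th] by (simp add: Tb\<eta> DK)
    moreover have "Db T (D T' r) = - D T' \<eta>"
      using D_Db_commute[of T' T r, OF T'h Th] by (simp add: Dbr)
    moreover have "Db T (K * \<eta>) = - (K * K)" by (simp add: Db_mult DK Tb\<eta>)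
    ultimately show ?thesis using arg_cong[OF e2, of "Db T"] by simp
  qed
  have e4: "D T (D T' r) = - (cst (6 * \<i>) * (K * K))"
  proof -
    have "D T (D G \<eta>) = D T' \<eta>" by (simp add: TG T\<eta> DK)
    moreover have "D T (K * \<eta>) = K * K" by (simp add: D_mult DK T\<eta>)
    ultimately have "cst 2 * (cst (6 * \<i>) * (K * K)) + D T (D T' r) = cst (6 * \<i>) * (K * K)"
      using arg_cong[OF e2, of "D T"] by (simp add: e3)
    moreover have "cst 2 * (cst (6 * \<i>) * (K * K)) = cst (6 * \<i>) * (K * K) + cst (6 * \<i>) * (K * K)"
      by (rule pol_eqI) simp
    ultimately have "cst (6 * \<i>) * (K * K) + cst (6 * \<i>) * (K * K) + D T (D T' r) = cst (6 * \<i>) * (K * K)" by simp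
    then have "D T (D T' r) = cst (6 * \<i>) * (K * K) - (cst (6 * \<i>) * (K * K) + cst (6 * \<i>) * (K * K))"
      by (metis add_diff_cancel_left')
    then show ?thesis by simp
  qed
  have "D (hbrk T T') r = - (cst (12 * \<i>) * (K * K))"
    unfolding D_hbrk e4 \<eta>_def[symmetric] e3 by (rule pol_eqI) simp
  then have ne2: "D (hbrk T T') r \<noteq> 0" using \<kappa>0 by (simp add: K_def)
  have "\<exists>k. pd (Inl None) (Q'' k) \<noteq> 0"
  proof (rule ccontr)
    assume "\<not> ?thesis"
    then have z: "pd (Inl None) (Q'' k) = 0" for k by simp
    have dG: "(\<lambda>k. pd (Inl None) (G k)) = (\<lambda>_. 0)" and dT: "(\<lambda>k. pd (Inl None) (T k)) = (\<lambda>_. 0)"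
      and dQ: "(\<lambda>k. pd (Inl None) (Q k)) = T"
      using Gw Tw by (auto simp: T_def)
    have dT': "(\<lambda>k. pd (Inl None) (T' k)) = (\<lambda>_. 0)" by (simp add: T'_def pd_hbrk dG dT hbrk_zero)
    have dQ': "(\<lambda>k. pd (Inl None) (Q' k)) = T'" unfolding Q'_def pd_hbrk dG dQ by (auto simp: hbrk_zero T'_def)
    have dQ'': "pd (Inl None) (Q'' k) = hbrk T Q' k + hbrk Q T' k" for k
      unfolding Q''_def pd_hbrk dQ dQ' ..
    have "pd (Inl None) (pd (Inl None) (Q'' k)) = hbrk T T' k + hbrk T T' k" for k
      unfolding dQ'' pd_add pd_hbrk dQ dQ' dT dT' by (simp add: hbrk_zero)
    then have "of_nat 2 * hbrk T T' k = 0" for k using z by simp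
    then have "hbrk T T' k = 0" for k by simp
    then show False using ne2 by (simp add: D_pd)
  qed
  then show "h \<noteq> 1 / 2 \<Longrightarrow> P h = 0" using weight_one[OF Q''h Q''f Q''t] by blast
qed

text \<open>Homogeneity bounds the weight of the last nonzero w-derivative below by -1. As \<mu> >
  0, weight 0 has a predecessor of weight 1 one step back, weight -1 has one two steps back, and a
  weight strictly between comes one step after a field of weight in (0, 1).\<close>

lemma tangential_imp_balanced:
  assumes Q: "\<And>k. holo (Q k)" "field_weight \<delta> \<mu> Q" "tang Q" and \<mu>: "0 < \<mu>" and ne: "Q k0 \<noteq> 0"
  shows "h \<noteq> 1 / 2 \<Longrightarrow> P h = 0"
proof -
  define A where "A i k = (pd (Inl None) ^^ i) (Q k)" for i k
  have A_Suc: "A (Suc i) = (\<lambda>k. pd (Inl None) (A i k))" for i by (auto simp: A_def)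
  have A: "(\<forall>k. holo (A i k)) \<and> field_weight \<delta> (\<mu> - real i) (A i) \<and> tang (A i)" for i
  proof (induction i)
    case 0
    then show ?case using Q by (simp add: A_def)
  next
    case (Suc i)
    have "field_weight \<delta> (\<mu> - real (Suc i)) (A (Suc i))"
      unfolding field_weight_def A_Suc
    proof
      fix k
      have "whom (wh \<delta>) (\<mu> - real i + \<delta> k) (A i k)" using Suc by (simp add: field_weight_def)
      from whom_pd[OF this, of None] show "whom (wh \<delta>) (\<mu> - real (Suc i) + \<delta> k) (pd (Inl None) (A i k))"
        by (simp add: \<delta>_None algebra_simps)
    qed
    moreover have "tang (A (Suc i))" unfolding A_Suc using Suc by (intro tang_pd) auto
    ultimately show ?case using Suc by (simp add: A_Suc holo_pd)
  qed
  have \<delta>1: "\<delta> k \<le> 1" for k using \<delta>_le \<delta>_None by (cases k) (auto intro: order_trans[OF \<delta>_le])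
  have zero: "A i k = 0" if "\<mu> + 1 < real i" for i k
  proof (rule whom_neg[of "wh \<delta>" "\<mu> - real i + \<delta> k"])
    show "whom (wh \<delta>) (\<mu> - real i + \<delta> k) (A i k)" using A by (simp add: field_weight_def)
    show "\<mu> - real i + \<delta> k < 0" using that \<delta>1[of k] by simp
  qed (rule wh_nonneg)
  obtain N0 where "\<mu> + 1 < real N0" using reals_Archimedean2 by blast
  then have expo: "\<exists>N. \<forall>k. A N k = 0" using zero by blast
  define N where "N = (LEAST N. \<forall>k. A N k = 0)"
  have N: "\<forall>k. A N k = 0" unfolding N_def using expo by (rule LeastI_ex)
  have "N \<noteq> 0"
  proof
    assume "N = 0"
    then have "A 0 k0 = 0" using N by simp
    then show False using ne by (simp add: A_def)
  qed
  then obtain d where d: "N = Suc d" by (cases N) auto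
  have nd: "\<not> (\<forall>k. A d k = 0)" using not_less_Least[of d "\<lambda>N. \<forall>k. A N k = 0"] d N_def by auto
  have Aw: "pd (Inl None) (A d k) = 0" for k using N by (simp add: d A_Suc)
  note Ah = A[THEN conjunct1, rule_format] and Af = A[THEN conjunct2, THEN conjunct1] and At = A[THEN conjunct2, THEN conjunct2]
  define l where "l = \<mu> - real d"
  consider "0 < l" | "l = 0" | "-1 < l" "l < 0" | "l = -1" | "l < -1" by linarith
  then show "P h = 0" if h: "h \<noteq> 1 / 2"
  proof cases
    case 1
    have "A d k = 0" for k
    proof (rule wfree_field_zero[OF Ah Aw At Af])
      show "ev (A d (Some j)) (\<lambda>_. 0) = 0" for j
        using Af[of d] 1 \<delta>_pos[of "Some j"] by (intro whom_ev_0[of "wh \<delta>" "l + \<delta> (Some j)"]) (auto simp: field_weight_def l_def)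
    qed (use 1 in \<open>auto simp: l_def\<close>)
    then show ?thesis using nd by blast
  next
    case 2
    then obtain i where i: "d = Suc i" using \<mu> by (cases d) (auto simp: l_def)
    have "field_weight \<delta> 1 (A i)" using Af[of i] 2 by (simp add: l_def i algebra_simps)
    moreover obtain k where "pd (Inl None) (A i k) \<noteq> 0" using nd by (auto simp: i A_Suc)
    ultimately show ?thesis using weight_one[OF Ah _ At] h by blast
  next
    case 3
    then obtain i where i: "d = Suc i" using \<mu> by (cases d) (auto simp: l_def)
    have f: "field_weight \<delta> (l + 1) (A i)" using Af[of i] by (simp add: l_def i algebra_simps)
    obtain k where k: "pd (Inl None) (A i k) \<noteq> 0" using nd by (auto simp: i A_Suc)
    have z: "pd (Inl None) (pd (Inl None) (A i k)) = 0" for k using Aw by (simp add: i A_Suc)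
    show ?thesis by (rule weight_fraction[OF Ah f At _ _ z k h]) (use 3 in auto)
  next
    case 4
    then have "1 < d" using \<mu> by (auto simp: l_def)
    then obtain i where i: "d = Suc (Suc i)" using less_imp_Suc_add[of 1 d] by auto
    have "field_weight \<delta> 1 (A i)" using Af[of i] 4 by (simp add: l_def i algebra_simps)
    moreover have "\<exists>k. pd (Inl None) (A i k) \<noteq> 0"
      using nd unfolding i A_Suc by force
    ultimately show ?thesis using weight_one[OF Ah _ At] h by blast
  next
    case 5
    have "A d k = 0" for k
    proof (rule whom_neg[of "wh \<delta>" "l + \<delta> k"])
      show "whom (wh \<delta>) (l + \<delta> k) (A d k)" using Af[of d] by (simp add: field_weight_def l_def)
      show "l + \<delta> k < 0" using 5 \<delta>1[of k] by simp
    qed (rule wh_nonneg)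
    then show ?thesis using nd by blast
  qed
qed

end

section \<open>Polynomials given by coefficients\<close>

definition cv :: "complex \<times> (complex^'n) \<Rightarrow> 'n option \<Rightarrow> complex" where
  "cv \<zeta> k = (case k of None \<Rightarrow> fst \<zeta> | Some j \<Rightarrow> snd \<zeta> $ j)"

text \<open>The real points of the polarised space.\<close>

definition pt :: "complex \<times> (complex^'n) \<Rightarrow> 'n option + 'n option \<Rightarrow> complex" where
  "pt \<zeta> = case_sum (cv \<zeta>) (cnj \<circ> cv \<zeta>)"

lemma cv_simps [simp]: "cv \<zeta> None = fst \<zeta>" "cv \<zeta> (Some j) = snd \<zeta> $ j"
  by (simp_all add: cv_def)

lemma pt_simps [simp]: "pt \<zeta> (Inl k) = cv \<zeta> k" "pt \<zeta> (Inr k) = cnj (cv \<zeta> k)"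
  by (simp_all add: pt_def)

lemma ev_C_pt: "ev (C f) (pt \<zeta>) = cnj (ev f (pt \<zeta>))"
proof -
  have "(\<lambda>v. cnj (pt \<zeta> (swp v))) = pt \<zeta>"
  proof
    fix v show "cnj (pt \<zeta> (swp v)) = pt \<zeta> v" by (cases v) auto
  qed
  then show ?thesis by (simp add: ev_C)
qed

definition expo :: "'n midx \<Rightarrow> 'n option \<Rightarrow> nat" where
  "expo J k = (case k of None \<Rightarrow> fst J | Some j \<Rightarrow> snd J j)"

definition monomial :: "('v::finite \<Rightarrow> nat) \<Rightarrow> 'v pol" where
  "monomial E = (\<Prod>v\<in>UNIV. var v ^ E v)"

definition hm :: "'n::finite midx \<Rightarrow> ('n option + 'n option) pol" where
  "hm J = monomial (case_sum (expo J) (\<lambda>_. 0))"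
definition am :: "'n::finite midx \<Rightarrow> ('n option + 'n option) pol" where
  "am K = monomial (case_sum (\<lambda>_. 0) (expo K))"

lemma monomial_add: "monomial (\<lambda>v. E v + F v) = monomial E * monomial F"
  by (simp add: monomial_def power_add prod.distrib)

lemma hm_am: "hm J * am K = monomial (case_sum (expo J) (expo K))"
  unfolding hm_def am_def monomial_add[symmetric] by (rule arg_cong[where f = monomial]) (auto split: sum.splits)

lemma whom_mm: "whom \<omega> (\<Sum>v\<in>UNIV. real (E v) * \<omega> v) (monomial E)"
  unfolding monomial_def by (intro whom_prod whom_power whom_var) auto

lemma sum_option_UNIV: "(\<Sum>k\<in>UNIV. f k) = f None + (\<Sum>j\<in>UNIV. f (Some j))"
  for f :: "'n::finite option \<Rightarrow> 'c::comm_monoid_add"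
  unfolding UNIV_option_conv by (subst sum.insert) (auto simp: sum.reindex)

lemma prod_option_UNIV: "(\<Prod>k\<in>UNIV. f k) = f None * (\<Prod>j\<in>UNIV. f (Some j))"
  for f :: "'n::finite option \<Rightarrow> 'c::comm_monoid_mult"
  unfolding UNIV_option_conv by (subst prod.insert) (auto simp: prod.reindex)

lemma prod_UNIV_Plus: "(\<Prod>v\<in>UNIV. f v) = (\<Prod>k\<in>UNIV. f (Inl k)) * (\<Prod>k\<in>UNIV. f (Inr k))"
  for f :: "'a::finite + 'b::finite \<Rightarrow> 'c::comm_monoid_mult"
  unfolding UNIV_Plus_UNIV[symmetric] by (subst prod.Plus) auto

lemma ev_hm: "ev (hm J) (pt \<zeta>) = wmono J \<zeta>"
  by (simp add: hm_def monomial_def prod_UNIV_Plus prod_option_UNIV expo_def wmono_def zmono_def)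

lemma ev_am: "ev (am J) (pt \<zeta>) = wmono J (wcnj \<zeta>)"
  by (simp add: am_def monomial_def prod_UNIV_Plus prod_option_UNIV expo_def wmono_def zmono_def wcnj_def cnjv_def)

lemma C_mm: "C (monomial E) = monomial (E \<circ> swp)"
proof -
  have "C (monomial E) = (\<Prod>v\<in>UNIV. var (swp v) ^ E v)" by (simp add: monomial_def C_var)
  also have "\<dots> = (\<Prod>v\<in>UNIV. var v ^ E (swp v))"
    by (rule prod.reindex_bij_witness[where i = swp and j = swp]) auto
  finally show ?thesis by (simp add: monomial_def)
qed

lemma C_hm: "C (hm J) = am J" and C_am: "C (am J) = hm J"
  unfolding hm_def am_def C_mm by (rule arg_cong[where f = monomial], auto simp: fun_eq_iff swp_def split: sum.splits)+

lemma delta_Some: "delta m (Some j) = 1 / (2 * real (m j))" and delta_None [simp]: "delta m None = 1"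
  by (simp_all add: delta_def)

lemma wt_delta: "wt m A = (\<Sum>j\<in>UNIV. real (A j) * delta m (Some j))"
  by (simp add: wt_def delta_Some)

lemma mwt_ex: "mwt m J = (\<Sum>k\<in>UNIV. real (expo J k) * delta m k)"
  by (simp add: sum_option_UNIV mwt_def wt_delta expo_def)

lemma whom_hm: "whom (wh (delta m)) (mwt m J) (hm J)" "whom (wa (delta m)) 0 (hm J)"
  using whom_mm[of "wh (delta m)" "case_sum (expo J) (\<lambda>_. 0)"] whom_mm[of "wa (delta m)" "case_sum (expo J) (\<lambda>_. 0)"]
  by (simp_all add: hm_def sum_UNIV_Plus mwt_ex)

lemma whom_am: "whom (wa (delta m)) (mwt m J) (am J)" "whom (wh (delta m)) 0 (am J)"
  using whom_C[of "delta m" "mwt m J" "hm J"] whom_C'[of "delta m" 0 "hm J"] whom_hm[of m J] by (simp_all add: C_hm)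

lemma expo_inj: "expo J = expo K \<Longrightarrow> J = K"
proof -
  assume e: "expo J = expo K"
  have "fst J = fst K" using fun_cong[OF e, of None] by (simp add: expo_def)
  moreover have "snd J = snd K"
  proof
    fix j show "snd J j = snd K j" using fun_cong[OF e, of "Some j"] by (simp add: expo_def)
  qed
  ultimately show ?thesis by (rule prod_eqI)
qed

text \<open>Projecting successively onto the degree in each variable isolates a single monomial.\<close>

lemma monomial_independent:
  assumes F: "finite F" "(\<Sum>E\<in>F. cst (c E) * monomial E) = 0" and E0: "E0 \<in> F"
  shows "c E0 = 0"
proof -
  have "(\<Sum>E | E \<in> F \<and> (\<forall>v\<in>S. E v = E0 v). cst (c E) * monomial E) = 0" if "finite S" for S
    using that
  proof (induction S rule: finite_induct)
    case (insert u S)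
    define \<omega> where "\<omega> v = (if v = u then 1 else 0 :: real)" for v
    have w: "whom \<omega> (real (E u)) (cst (c E) * monomial E)" for E
    proof -
      have "(\<Sum>v\<in>UNIV. real (E v) * \<omega> v) = (\<Sum>v\<in>UNIV. if v = u then real (E v) else 0)"
        by (rule sum.cong) (auto simp: \<omega>_def)
      also have "\<dots> = real (E u)" by simp
      finally show ?thesis using whom_mm[of \<omega> E] by (intro whom_cst_mult) simp
    qed
    have "(\<Sum>E | E \<in> F \<and> (\<forall>v\<in>S. E v = E0 v). if E u = E0 u then cst (c E) * monomial E else 0) = 0"
      using arg_cong[OF insert.IH, of "wcomp \<omega> (real (E0 u))"]
      by (simp add: wcomp_sum wcomp_hom[OF w] eq_commute[of "E0 u"] del: wcomp_cst_mult)
    then show ?case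
      using F(1) by (simp add: sum.inter_filter[symmetric] conj_ac)
  qed (use F in simp)
  from this[of UNIV] have "(\<Sum>E | E \<in> F \<and> (\<forall>v\<in>UNIV. E v = E0 v). cst (c E) * monomial E) = 0" by simp
  also have "{E. E \<in> F \<and> (\<forall>v\<in>UNIV. E v = E0 v)} = {E0}" using E0 by auto
  finally have "cst (c E0) * monomial E0 = 0" by simp
  from arg_cong[OF this, of "\<lambda>f. ev f (\<lambda>_. 1)"] show ?thesis by (simp add: monomial_def)
qed

lemma hm_am_independent:
  assumes F: "finite F" "(\<Sum>(J, K)\<in>F. cst (c J K) * (hm J * am K)) = 0" and JK: "(J, K) \<in> F"
  shows "c J K = 0"
proof -
  define e :: "'a midx \<times> 'a midx \<Rightarrow> 'a option + 'a option \<Rightarrow> nat"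
    where "e = (\<lambda>(J, K). case_sum (expo J) (expo K))"
  have inj: "inj e"
  proof (rule injI, clarify)
    fix J K J' K' :: "'a midx"
    assume eq: "e (J, K) = e (J', K')"
    have "expo J = expo J'"
    proof
      fix k show "expo J k = expo J' k" using fun_cong[OF eq, of "Inl k"] by (simp add: e_def)
    qed
    moreover have "expo K = expo K'"
    proof
      fix k show "expo K k = expo K' k" using fun_cong[OF eq, of "Inr k"] by (simp add: e_def)
    qed
    ultimately show "J = J' \<and> K = K'" by (auto dest: expo_inj)
  qed
  define c' where "c' E = (case the_inv e E of (J, K) \<Rightarrow> c J K)" for E
  have c'e: "c' (e (J, K)) = c J K" and mme: "monomial (e (J, K)) = hm J * am K" for J K
    by (simp add: c'_def the_inv_f_f[OF inj]) (simp add: hm_am e_def)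
  have "(\<Sum>E\<in>e ` F. cst (c' E) * monomial E) = (\<Sum>x\<in>F. cst (c' (e x)) * monomial (e x))"
    using inj by (subst sum.reindex) (auto simp: inj_on_def)
  also have "\<dots> = (\<Sum>(J, K)\<in>F. cst (c J K) * (hm J * am K))"
    by (rule sum.cong) (auto simp: c'e mme)
  finally have "c' (e (J, K)) = 0"
    using F JK by (intro monomial_independent[of "e ` F" c']) auto
  then show ?thesis by (simp add: c'e)
qed

section \<open>Polarised polynomials from coefficient families\<close>

definition mon :: "('n::finite \<Rightarrow> nat) \<Rightarrow> ('n \<Rightarrow> nat) \<Rightarrow> ('n option + 'n option) pol" where
  "mon A B = hm (0, A) * am (0, B)"

definition pol_of :: "(('n::finite \<Rightarrow> nat) \<Rightarrow> ('n \<Rightarrow> nat) \<Rightarrow> complex) \<Rightarrow> ('n option + 'n option) pol" where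
  "pol_of c = (\<Sum>(A, B)\<in>{(A, B). c A B \<noteq> 0}. cst (c A B) * mon A B)"

lemma ev_mon: "ev (mon A B) (pt (u, z)) = zmono A z * zmono B (cnjv z)"
  by (simp add: mon_def ev_hm ev_am wmono_def wcnj_def)

lemma ev_pol_of: "ev (pol_of c) (pt (u, z)) = peval c z"
  by (simp add: pol_of_def peval_def case_prod_beta ev_mon mult.assoc)

lemma pol_of_superset:
  assumes "finite F" "{(A, B). c A B \<noteq> 0} \<subseteq> F"
  shows "pol_of c = (\<Sum>(A, B)\<in>F. cst (c A B) * mon A B)"
  unfolding pol_of_def using assms by (intro sum.mono_neutral_left) (auto simp: cst_hom)

lemma pol_of_eq_0:
  assumes "is_poly c" "pol_of c = 0"
  shows "c A B = 0"
proof (rule ccontr)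
  assume n: "c A B \<noteq> 0"
  define F where "F = (\<lambda>(A, B). ((0::nat, A), (0::nat, B))) ` {(A, B). c A B \<noteq> 0}"
  have "(\<Sum>(J, K)\<in>F. cst (c (snd J) (snd K)) * (hm J * am K)) = pol_of c"
    unfolding F_def pol_of_def by (subst sum.reindex) (auto simp: inj_on_def mon_def case_prod_beta)
  then have "c (snd (0::nat, A)) (snd (0::nat, B)) = 0"
    using assms n by (intro hm_am_independent[where F = F]) (auto simp: is_poly_def F_def)
  then show False using n by simp
qed

lemma whom_mon: "whom (wh (delta m)) (wt m A) (mon A B)" "whom (wa (delta m)) (wt m B) (mon A B)"
  using whom_mult[OF whom_hm(1)[of m "(0, A)"] whom_am(2)[of m "(0, B)"]] whom_mult[OF whom_hm(2)[of m "(0, A)"] whom_am(1)[of m "(0, B)"]]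
  by (simp_all add: mon_def mwt_def)

lemma wcomp_pol_of:
  assumes "is_poly c"
  shows "wcomp (wh (delta m)) h (pol_of c) = pol_of (\<lambda>A B. if wt m A = h then c A B else 0)"
proof -
  have "pol_of (\<lambda>A B. if wt m A = h then c A B else 0)
      = (\<Sum>(A, B)\<in>{(A, B). c A B \<noteq> 0}. cst (if wt m A = h then c A B else 0) * mon A B)"
    using assms by (intro pol_of_superset) (auto simp: is_poly_def)
  then show ?thesis
    unfolding pol_of_def wcomp_sum by (auto intro!: sum.cong simp: wcomp_hom[OF whom_mon(1)] cst_hom)
qed

text \<open>Total weight \<mu> and signature 0 together mean holomorphic weight \<mu>/2.\<close>

lemma sig_part_eq:
  assumes "weighted_homogeneous m \<mu> c"
  shows "sig_part m 0 c = (\<lambda>A B. if wt m A = \<mu> / 2 then c A B else 0)"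
  using assms by (fastforce simp: sig_part_def weighted_homogeneous_def fun_eq_iff)

lemma mon_add: "mon (\<lambda>i. A i + A' i) (\<lambda>i. B i + B' i) = mon A B * mon A' B'"
proof -
  have "mon (\<lambda>i. A i + A' i) (\<lambda>i. B i + B' i) = monomial (\<lambda>v. case_sum (expo (0, A)) (expo (0, B)) v + case_sum (expo (0, A')) (expo (0, B')) v)"
    unfolding mon_def hm_am by (rule arg_cong[where f = monomial]) (auto simp: fun_eq_iff expo_def split: sum.splits option.splits)
  then show ?thesis by (simp add: monomial_add mon_def hm_am)
qed

lemma finite_le_funs: "finite {A1 :: 'n::finite \<Rightarrow> nat. \<forall>i. A1 i \<le> A i}"
proof -
  have "{A1. \<forall>i. A1 i \<le> A i} = PiE UNIV (\<lambda>i. {..A i})" by (auto simp: PiE_def)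
  then show ?thesis by (simp add: finite_PiE)
qed

lemma pmult_pol_of:
  assumes c: "is_poly c" and d: "is_poly d"
  shows "is_poly (pmult c d)" "pol_of (pmult c d) = pol_of c * pol_of d"
proof -
  let ?S = "{(A, B). c A B \<noteq> 0}" and ?T = "{(A, B). d A B \<noteq> 0}"
  \<comment> \<open>Sum, truncated difference and order on pairs of multi-indices;
    \<open>pl x (mi E x)\<close> gives back E only when \<open>le x E\<close>, hence the case
    distinctions.\<close>
  define pl :: "('a \<Rightarrow> nat) \<times> ('a \<Rightarrow> nat) \<Rightarrow> ('a \<Rightarrow> nat) \<times> ('a \<Rightarrow> nat) \<Rightarrow> ('a \<Rightarrow> nat) \<times> ('a \<Rightarrow> nat)"
    where "pl = (\<lambda>(A, B) (A', B'). (\<lambda>i. A i + A' i, \<lambda>i. B i + B' i))"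
  define mi :: "('a \<Rightarrow> nat) \<times> ('a \<Rightarrow> nat) \<Rightarrow> ('a \<Rightarrow> nat) \<times> ('a \<Rightarrow> nat) \<Rightarrow> ('a \<Rightarrow> nat) \<times> ('a \<Rightarrow> nat)"
    where "mi = (\<lambda>(A, B) (A', B'). (\<lambda>i. A i - A' i, \<lambda>i. B i - B' i))"
  define le :: "('a \<Rightarrow> nat) \<times> ('a \<Rightarrow> nat) \<Rightarrow> ('a \<Rightarrow> nat) \<times> ('a \<Rightarrow> nat) \<Rightarrow> bool"
    where "le = (\<lambda>(A, B) (A', B'). (\<forall>i. A i \<le> A' i) \<and> (\<forall>i. B i \<le> B' i))"
  define F where "F = (\<lambda>(x, y). pl x y) ` (?S \<times> ?T)"
  have fS: "finite ?S" and fT: "finite ?T" using c d by (auto simp: is_poly_def)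
  have fF: "finite F" using fS fT by (simp add: F_def)
  have pm: "pmult c d A B = (\<Sum>x\<in>?S. if le x (A, B) then case_prod c x * case_prod d (mi (A, B) x) else 0)" for A B
  proof -
    let ?L = "{A1. \<forall>i. A1 i \<le> A i} \<times> {B1. \<forall>i. B1 i \<le> B i}"
    have fL: "finite ?L" by (intro finite_cartesian_product finite_le_funs)
    have "pmult c d A B = (\<Sum>x\<in>?L. case_prod c x * case_prod d (mi (A, B) x))"
      by (simp add: pmult_def sum.cartesian_product mi_def case_prod_beta)
    also have "\<dots> = (\<Sum>x\<in>?L \<inter> ?S. case_prod c x * case_prod d (mi (A, B) x))"
      using fL by (intro sum.mono_neutral_right) auto
    also have "\<dots> = (\<Sum>x\<in>?S. if x \<in> ?L then case_prod c x * case_prod d (mi (A, B) x) else 0)"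
      using fS by (simp add: sum.inter_restrict Int_commute)
    also have "\<dots> = (\<Sum>x\<in>?S. if le x (A, B) then case_prod c x * case_prod d (mi (A, B) x) else 0)"
      by (rule sum.cong) (auto simp: le_def)
    finally show ?thesis .
  qed
  have sup: "{(A, B). pmult c d A B \<noteq> 0} \<subseteq> F"
  proof clarify
    fix A B assume "pmult c d A B \<noteq> 0"
    then obtain x where x: "x \<in> ?S" "le x (A, B)" "case_prod d (mi (A, B) x) \<noteq> 0"
      unfolding pm by (auto elim!: sum.not_neutral_contains_not_neutral split: if_splits)
    then have "pl x (mi (A, B) x) = (A, B)" by (auto simp: pl_def mi_def le_def split: prod.splits)
    moreover have "mi (A, B) x \<in> ?T" using x(3) by (simp add: case_prod_beta)
    ultimately show "(A, B) \<in> F" unfolding F_def using x(1) by force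
  qed
  show "is_poly (pmult c d)" unfolding is_poly_def using sup fF by (rule finite_subset)
  have "pol_of (pmult c d) = (\<Sum>E\<in>F. cst (case_prod (pmult c d) E) * case_prod mon E)"
    unfolding pol_of_superset[OF fF sup] by (simp add: case_prod_beta)
  also have "\<dots> = (\<Sum>E\<in>F. \<Sum>x\<in>?S. if le x E then cst (case_prod c x) * cst (case_prod d (mi E x)) * case_prod mon E else 0)"
  proof (rule sum.cong)
    fix E :: "('a \<Rightarrow> nat) \<times> ('a \<Rightarrow> nat)"
    have cs: "cst (sum f X) = (\<Sum>x\<in>X. cst (f x))" for f :: "('a \<Rightarrow> nat) \<times> ('a \<Rightarrow> nat) \<Rightarrow> complex" and X
      by (rule pol_eqI) simp
    show "cst (case_prod (pmult c d) E) * case_prod mon E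
        = (\<Sum>x\<in>?S. if le x E then cst (case_prod c x) * cst (case_prod d (mi E x)) * case_prod mon E else 0)"
      by (cases E) (auto simp: pm cs sum_distrib_right cst_hom intro!: sum.cong)
  qed simp
  also have "\<dots> = (\<Sum>x\<in>?S. \<Sum>E\<in>F. if le x E then cst (case_prod c x) * cst (case_prod d (mi E x)) * case_prod mon E else 0)"
    by (rule sum.swap)
  also have "\<dots> = (\<Sum>x\<in>?S. \<Sum>y\<in>?T. (cst (case_prod c x) * case_prod mon x) * (cst (case_prod d y) * case_prod mon y))"
  proof (rule sum.cong)
    fix x assume x: "x \<in> ?S"
    show "(\<Sum>E\<in>F. if le x E then cst (case_prod c x) * cst (case_prod d (mi E x)) * case_prod mon E else 0)
        = (\<Sum>y\<in>?T. (cst (case_prod c x) * case_prod mon x) * (cst (case_prod d y) * case_prod mon y))"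
    proof -
      let ?F = "{E \<in> F. le x E \<and> case_prod d (mi E x) \<noteq> 0}"
      have "(\<Sum>E\<in>F. if le x E then cst (case_prod c x) * cst (case_prod d (mi E x)) * case_prod mon E else 0)
          = (\<Sum>E\<in>?F. cst (case_prod c x) * cst (case_prod d (mi E x)) * case_prod mon E)"
        using fF by (intro sum.mono_neutral_cong_right) auto
      also have "\<dots> = (\<Sum>y\<in>?T. (cst (case_prod c x) * case_prod mon x) * (cst (case_prod d y) * case_prod mon y))"
      proof (rule sum.reindex_bij_witness[where i = "\<lambda>y. pl x y" and j = "\<lambda>E. mi E x"])
        fix E assume E: "E \<in> ?F"
        then show "pl x (mi E x) = E" "mi E x \<in> ?T"
          by (auto simp: pl_def mi_def le_def split: prod.splits)
        have "case_prod mon E = case_prod mon x * case_prod mon (mi E x)"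
          using E mon_add[of "fst x" "fst (mi E x)" "snd x" "snd (mi E x)"]
          by (auto simp: mi_def le_def split: prod.splits)
        then show "(cst (case_prod c x) * case_prod mon x) * (cst (case_prod d (mi E x)) * case_prod mon (mi E x))
          = cst (case_prod c x) * cst (case_prod d (mi E x)) * case_prod mon E"
          by (simp add: algebra_simps)
      next
        fix y assume y: "y \<in> ?T"
        then show 1: "mi (pl x y) x = y"
          by (auto simp: pl_def mi_def split: prod.splits)
        have "le x (pl x y)" by (auto simp: pl_def le_def split: prod.splits)
        moreover have "pl x y \<in> F" unfolding F_def using x y by (intro image_eqI[where x = "(x, y)"]) auto
        moreover have "case_prod d y \<noteq> 0" using y by (simp add: case_prod_beta)
        ultimately show "pl x y \<in> ?F" using 1 by simp
      qed
      finally show ?thesis .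
    qed
  qed simp
  also have "\<dots> = pol_of c * pol_of d"
    unfolding pol_of_def sum_product by (simp add: case_prod_beta)
  finally show "pol_of (pmult c d) = pol_of c * pol_of d" .
qed

lemma weighted_homogeneous_pmult:
  assumes "weighted_homogeneous m \<mu> c" "weighted_homogeneous m \<nu> d"
  shows "weighted_homogeneous m (\<mu> + \<nu>) (pmult c d)"
  unfolding weighted_homogeneous_def
proof (intro allI impI)
  fix A B assume "pmult c d A B \<noteq> 0"
  then obtain A1 B1 where *: "\<forall>i. A1 i \<le> A i" "\<forall>i. B1 i \<le> B i" "c A1 B1 \<noteq> 0" "d (\<lambda>i. A i - A1 i) (\<lambda>i. B i - B1 i) \<noteq> 0"
    unfolding pmult_def by (auto elim!: sum.not_neutral_contains_not_neutral)
  have e: "wt m E = wt m E1 + wt m (\<lambda>i. E i - E1 i)" if "\<forall>i. E1 i \<le> E i" for E E1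
    using that unfolding wt_def sum.distrib[symmetric]
    by (intro sum.cong) (auto simp: add_divide_distrib[symmetric] of_nat_diff)
  have "wt m A1 + wt m B1 = \<mu>" "wt m (\<lambda>i. A i - A1 i) + wt m (\<lambda>i. B i - B1 i) = \<nu>"
    using *(3,4) assms unfolding weighted_homogeneous_def by blast+
  then show "wt m A + wt m B = \<mu> + \<nu>" using e[OF *(1)] e[OF *(2)] by linarith
qed

section \<open>Derivatives at real points and condition (N)\<close>

lemma bounded_linear_cv: "bounded_linear (\<lambda>\<zeta>. cv \<zeta> k)"
proof (cases k)
  case (Some j)
  then show ?thesis
    using bounded_linear_compose[OF bounded_linear_vec_nth bounded_linear_snd, of j] by simp
qed (simp add: bounded_linear_fst)

text \<open>The real differential in Wirtinger form; it connects the formal partial derivatives with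
  the differentials in the geometric hypotheses.\<close>

lemma ev_pt_has_derivative:
  fixes f :: "('n::finite option + 'n option) pol"
  shows "((\<lambda>\<zeta>. ev f (pt \<zeta>)) has_derivative (\<lambda>v. (\<Sum>k\<in>UNIV. ev (pd (Inl k) f) (pt \<zeta>) * cv v k)
    + (\<Sum>k\<in>UNIV. ev (pd (Inr k) f) (pt \<zeta>) * cnj (cv v k)))) (at \<zeta>)"
proof (induction f rule: pol_induct)
  case (cst c)
  show ?case by simp
next
  case (var v)
  show ?case
  proof (cases v)
    case (Inl k)
    have "(\<Sum>i\<in>UNIV. ev (pd (Inl i) (var (Inl k :: 'n option + 'n option))) (pt \<zeta>) * cv x i) = (\<Sum>i\<in>UNIV. if i = k then cv x i else 0)" for x
      by (rule sum.cong) (auto simp: pd_var)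
    then show ?thesis using bounded_linear_imp_has_derivative[OF bounded_linear_cv, of k] by (simp add: Inl pd_var)
  next
    case (Inr k)
    have "(\<Sum>i\<in>UNIV. ev (pd (Inr i) (var (Inr k :: 'n option + 'n option))) (pt \<zeta>) * cnj (cv x i)) = (\<Sum>i\<in>UNIV. if i = k then cnj (cv x i) else 0)" for x
      by (rule sum.cong) (auto simp: pd_var)
    then show ?thesis
      using bounded_linear_imp_has_derivative[OF bounded_linear_compose[OF bounded_linear_cnj bounded_linear_cv], of k] by (simp add: Inr pd_var)
  qed
next
  case (add f g)
  show ?case unfolding ev_simps(3)
    by (rule has_derivative_eq_rhs[OF has_derivative_add[OF add]]) (simp add: sum.distrib algebra_simps fun_eq_iff)
next
  case (mult f g)
  show ?case unfolding ev_simps(4)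
    by (rule has_derivative_eq_rhs[OF has_derivative_mult[OF mult]])
      (simp add: pd_mult sum.distrib algebra_simps sum_distrib_left fun_eq_iff)
qed

lemma ev_mon': "ev (mon A B) x = (\<Prod>i\<in>UNIV. x (Inl (Some i)) ^ A i) * (\<Prod>i\<in>UNIV. x (Inr (Some i)) ^ B i)"
  by (simp add: mon_def hm_am monomial_def prod_UNIV_Plus prod_option_UNIV expo_def)

lemma pd_None_mon: "pd (Inl None) (mon A B) = 0"
  by (rule pd_eqI) (simp add: ev_mon')

lemma pd_Some_mon: "pd (Inl (Some j)) (mon A B) = of_nat (A j) * mon (A(j := A j - 1)) B"
proof (rule pd_eqI)
  fix x :: "'a option + 'a option \<Rightarrow> complex"
  define R where "R = (\<Prod>i\<in>UNIV - {j}. x (Inl (Some i)) ^ A i) * (\<Prod>i\<in>UNIV. x (Inr (Some i)) ^ B i)"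
  have e: "ev (mon A' B) (x(Inl (Some j) := t)) = t ^ A' j * R" if "\<And>i. i \<noteq> j \<Longrightarrow> A' i = A i" for A' t
  proof -
    have "(\<Prod>i\<in>UNIV. (x(Inl (Some j) := t)) (Inl (Some i)) ^ A' i) = t ^ A' j * (\<Prod>i\<in>UNIV - {j}. x (Inl (Some i)) ^ A i)"
      by (subst prod.remove[of UNIV j]) (auto intro!: prod.cong simp: that)
    then show ?thesis by (simp add: ev_mon' R_def mult.assoc)
  qed
  have "((\<lambda>t. t ^ A j * R) has_field_derivative (of_nat (A j) * x (Inl (Some j)) ^ (A j - 1)) * R) (at (x (Inl (Some j))))"
    by (auto intro!: derivative_eq_intros)
  moreover have "ev (mon (A(j := A j - 1)) B) x = x (Inl (Some j)) ^ (A j - 1) * R"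
    using e[of "A(j := A j - 1)" "x (Inl (Some j))"] by simp
  ultimately show "((\<lambda>t. ev (mon A B) (x(Inl (Some j) := t))) has_field_derivative
      ev (of_nat (A j) * mon (A(j := A j - 1)) B) x) (at (x (Inl (Some j))))"
    by (simp add: e mult.assoc)
qed

lemma pd_pol_of_None: "pd (Inl None) (pol_of c) = 0"
  by (simp add: pol_of_def case_prod_beta pd_mult pd_None_mon)

lemma pd_pol_of:
  assumes "is_poly c"
  shows "pd (Inl (Some j)) (pol_of c) = pol_of (dz j c)"
proof -
  let ?S = "{(A, B). c A B \<noteq> 0}"
  let ?S' = "{x \<in> ?S. fst x j \<noteq> 0}"
  have f: "finite ?S" using assms by (simp add: is_poly_def)
  have "pd (Inl (Some j)) (pol_of c) = (\<Sum>x\<in>?S. cst (case_prod c x) * (of_nat (fst x j) * mon ((fst x)(j := fst x j - 1)) (snd x)))"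
    by (simp add: pol_of_def case_prod_beta pd_mult pd_Some_mon)
  \<comment> \<open>Monomials without z_j drop out; on the others lowering the exponent is inverse
    to the shift in \<open>dz\<close>.\<close>
  also have "\<dots> = (\<Sum>x\<in>?S'. cst (case_prod c x) * (of_nat (fst x j) * mon ((fst x)(j := fst x j - 1)) (snd x)))"
    using f by (intro sum.mono_neutral_right) auto
  also have "\<dots> = (\<Sum>x\<in>{(A, B). dz j c A B \<noteq> 0}. cst (case_prod (dz j c) x) * case_prod mon x)"
  proof (rule sum.reindex_bij_witness[where i = "\<lambda>(A, B). (A(j := A j + 1), B)" and j = "\<lambda>(A, B). (A(j := A j - 1), B)"])
    fix x assume x: "x \<in> ?S'"
    obtain A B where AB: "x = (A, B)" by (cases x)
    then have A: "c A B \<noteq> 0" "A j \<noteq> 0" using x by auto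
    then have e: "(A(j := A j - 1))(j := (A(j := A j - 1)) j + 1) = A" by (auto simp: fun_eq_iff)
    show "(case case x of (A, B) \<Rightarrow> (A(j := A j - 1), B) of (A, B) \<Rightarrow> (A(j := A j + 1), B)) = x"
      using e by (simp add: AB)
    have d: "dz j c (A(j := A j - 1)) B = of_nat (A j) * c A B"
      using A(2) unfolding dz_def e by simp
    then show "(case x of (A, B) \<Rightarrow> (A(j := A j - 1), B)) \<in> {(A, B). dz j c A B \<noteq> 0}" using A by (simp add: AB)
    show "cst (case_prod (dz j c) (case x of (A, B) \<Rightarrow> (A(j := A j - 1), B))) * case_prod mon (case x of (A, B) \<Rightarrow> (A(j := A j - 1), B)) =
        cst (case_prod c x) * (of_nat (fst x j) * mon ((fst x)(j := fst x j - 1)) (snd x))"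
      by (simp add: AB d[simplified] cst_hom)
  next
    fix y assume "y \<in> {(A, B). dz j c A B \<noteq> 0}"
    then show "(case case y of (A, B) \<Rightarrow> (A(j := A j + 1), B) of (A, B) \<Rightarrow> (A(j := A j - 1), B)) = y"
      "(case y of (A, B) \<Rightarrow> (A(j := A j + 1), B)) \<in> ?S'"
      by (auto simp: dz_def)
  qed
  finally show ?thesis by (simp add: pol_of_def case_prod_beta)
qed

lemma holo_ev_has_derivative:
  assumes "holo f"
  shows "((\<lambda>z. ev f (pt (0, z))) has_derivative (\<lambda>v. \<Sum>k\<in>UNIV. ev (pd (Inl k) f) (pt (0, z)) * cv (0, v) k)) (at z)"
proof -
  have b: "bounded_linear (\<lambda>z :: complex^'a. (0 :: complex, z))"
    by (intro bounded_linear_Pair bounded_linear_ident bounded_linear_zero)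
  show ?thesis
    using has_derivative_compose[OF bounded_linear_imp_has_derivative[OF b] ev_pt_has_derivative[of f], of z] assms
    by (simp add: holo_def)
qed

lemma cv_scale: "cv (0, c *s v) k = c * cv (0, v) k"
  by (cases k) auto

text \<open>A polynomial field is entire, so its restriction to real points is a competitor in
  condition (N); nothing is lost by restricting, since the coefficients depend on z alone.\<close>

lemma condN_pol_of:
  assumes N: "condN c" and c: "is_poly c"
    and A: "\<And>k. holo (A k)" "\<And>k. pd (Inl None) (A k) = 0" "A None = 0" "D A (pol_of c) = 0"
  shows "A k = 0"
proof (rule ccontr)
  assume ne: "A k \<noteq> 0"
  then obtain j0 where k: "k = Some j0" using A(3) by (cases k) auto
  define \<rho> where "\<rho> j z = ev (A (Some j)) (pt (0, z))" for j z
  have "holo_vec_on UNIV (\<rho> j)" for j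
    unfolding holo_vec_on_def \<rho>_def
    using holo_ev_has_derivative[OF A(1)[of "Some j"]]
    by (intro ballI exI conjI) (auto simp: cv_scale sum_distrib_left mult_ac)
  moreover have "\<exists>j z. \<rho> j z \<noteq> 0"
  proof -
    obtain x where x: "ev (A k) x \<noteq> 0" using pol_nonzero_point[OF ne] by blast
    have "ev (A k) x = ev (A k) (pt (0, \<chi> j. x (Inl (Some j))))"
    proof (rule ev_cong_pd[where V = "range (\<lambda>j. Inl (Some j))"])
      fix v :: "'a option + 'a option" assume v: "v \<notin> range (\<lambda>j. Inl (Some j))"
      show "pd v (A k) = 0"
      proof (cases v)
        case (Inl i)
        then show ?thesis using v A(2) by (cases i) auto
      next
        case (Inr i)
        then show ?thesis using A(1)[of k] by (simp add: holo_def)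
      qed
    qed auto
    then show ?thesis using x unfolding \<rho>_def k by metis
  qed
  moreover have "(\<Sum>j\<in>UNIV. \<rho> j z * peval (dz j c) z) = 0" for z
  proof -
    have "ev (D A (pol_of c)) (pt (0, z)) = (\<Sum>j\<in>UNIV. \<rho> j z * peval (dz j c) z)"
      by (simp add: D_pd sum_option_UNIV A(3) \<rho>_def pd_pol_of[OF c] ev_pol_of)
    then show ?thesis using A(4) by simp
  qed
  ultimately show False using N unfolding condN_def by blast
qed

text \<open>The part of a weighted orbit through a point with nonvanishing coordinate \<open>j0\<close> on which that
  coordinate stays in a half plane is a graph over it, hence a complex curve.\<close>

lemma orbit_submanifold:
  fixes z :: "complex^'n::finite" and d :: "'n \<Rightarrow> real"
  assumes z: "z $ j0 \<noteq> 0" and d: "d j0 \<noteq> 0"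
  shows "\<exists>M. pos_dim_complex_submanifold M \<and> (\<forall>x\<in>M. \<exists>\<theta>. \<forall>j. x $ j = exp (of_real (d j) * \<theta>) * z $ j)"
proof -
  define H where "H = {t. 0 < Re (t / z $ j0)}"
  define U where "U = {x :: complex^'n. x $ j0 \<in> H}"
  \<comment> \<open>The orbit parametrised by its coordinate j0: \<theta> is the logarithm of t /
    z_j0 divided by d j0, single valued on the half plane H.\<close>
  define g where "g j t = exp (of_real (d j / d j0) * Ln (t / z $ j0)) * z $ j" for j t
  define M where "M = {x \<in> U. \<forall>j. x $ j = g j (x $ j0)}"
  \<comment> \<open>A shear that straightens the graph onto the j0 axis; \<open>\<phi>\<close> is
    its inverse.\<close>
  define \<psi> :: "complex^'n \<Rightarrow> complex^'n" where "\<psi> x = (\<chi> j. if j = j0 then x $ j0 else x $ j - g j (x $ j0))" for x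
  define \<phi> :: "complex^'n \<Rightarrow> complex^'n" where "\<phi> x = (\<chi> j. if j = j0 then x $ j0 else x $ j + g j (x $ j0))" for x
  have oH: "open H" unfolding H_def using z by (intro open_Collect_less continuous_intros) auto
  have oU: "open U"
  proof -
    have "U = (\<lambda>x. x $ j0) -` H" by (auto simp: U_def)
    then show ?thesis using oH by (simp add: open_vimage_vec_nth)
  qed
  have g0: "g j0 t = t" if "t \<in> H" for t
  proof -
    have "t / z $ j0 \<noteq> 0" using that by (auto simp: H_def)
    then show ?thesis using z d by (simp add: g_def)
  qed
  have gh: "g j holomorphic_on H" for j
    unfolding g_def H_def using z by (auto intro!: holomorphic_intros simp: complex_nonpos_Reals_iff)
  have hv: "holo_vec_on U (\<lambda>x. x $ j + c * g j (x $ j0))" "holo_vec_on U (\<lambda>x. x $ j)" for j c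
  proof -
    have vn: "((\<lambda>x. x $ i) has_derivative (\<lambda>v. v $ i)) (at x)" for i and x :: "complex^'n"
      by (rule bounded_linear_imp_has_derivative[OF bounded_linear_vec_nth])
    show "holo_vec_on U (\<lambda>x. x $ j)" unfolding holo_vec_on_def using vn by fastforce
    show "holo_vec_on U (\<lambda>x. x $ j + c * g j (x $ j0))" unfolding holo_vec_on_def
    proof
      fix x assume "x \<in> U"
      then have "(g j has_field_derivative deriv (g j) (x $ j0)) (at (x $ j0))"
        using holomorphic_derivI[OF gh oH] by (auto simp: U_def)
      then have "((\<lambda>x. g j (x $ j0)) has_derivative (\<lambda>v. deriv (g j) (x $ j0) * v $ j0)) (at x)"
        using has_derivative_compose[OF vn] unfolding has_field_derivative_def by blast
      then have "((\<lambda>x. x $ j + c * g j (x $ j0)) has_derivative (\<lambda>v. v $ j + c * (deriv (g j) (x $ j0) * v $ j0))) (at x)"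
        by (intro has_derivative_add has_derivative_mult_right vn)
      then show "\<exists>L. ((\<lambda>x. x $ j + c * g j (x $ j0)) has_derivative L) (at x) \<and> (\<forall>c v. L (c *s v) = c * L v)"
        by (intro exI conjI, assumption) (simp add: algebra_simps)
    qed
  qed
  have \<psi>\<phi>: "\<psi> (\<phi> x) = x" "\<phi> (\<psi> x) = x" for x by (auto simp: \<psi>_def \<phi>_def vec_eq_iff)
  have \<psi>U: "\<psi> x \<in> U \<longleftrightarrow> x \<in> U" "\<phi> x \<in> U \<longleftrightarrow> x \<in> U" for x by (auto simp: \<psi>_def \<phi>_def U_def)
  have im: "\<psi> ` U = U"
  proof (intro subset_antisym subsetI)
    fix y assume "y \<in> U"
    then show "y \<in> \<psi> ` U" using \<psi>\<phi>(1)[of y] \<psi>U by (intro image_eqI[of _ _ "\<phi> y"]) auto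
  qed (use \<psi>U in auto)
  have inj: "inj_on \<psi> U" by (rule inj_on_inverseI[where g = \<phi>]) (rule \<psi>\<phi>)
  have inv: "inv_into U \<psi> y = \<phi> y" if "y \<in> U" for y
    by (rule inv_into_f_eq[OF inj]) (use that \<psi>U \<psi>\<phi> in auto)
  have bi: "biholo U U \<psi>" unfolding biholo_def
  proof (intro conjI allI inj im)
    fix i
    show "holo_vec_on U (\<lambda>x. \<psi> x $ i)"
      using hv(1)[of i "-1"] hv(2)[of i] by (cases "i = j0") (auto simp: \<psi>_def)
    have p: "holo_vec_on U (\<lambda>x. \<phi> x $ i)"
      using hv(1)[of i 1] hv(2)[of i] by (cases "i = j0") (auto simp: \<phi>_def)
    show "holo_vec_on U (\<lambda>y. inv_into U \<psi> y $ i)" unfolding holo_vec_on_def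
    proof
      fix x assume x: "x \<in> U"
      then obtain L where L: "((\<lambda>x. \<phi> x $ i) has_derivative L) (at x)" "\<forall>c v. L (c *s v) = c * L v"
        using p unfolding holo_vec_on_def by blast
      have "((\<lambda>y. inv_into U \<psi> y $ i) has_derivative L) (at x)"
        by (rule has_derivative_transform_within_open[OF L(1) oU x]) (simp add: inv)
      then show "\<exists>L. ((\<lambda>y. inv_into U \<psi> y $ i) has_derivative L) (at x) \<and> (\<forall>c v. L (c *s v) = c * L v)"
        using L(2) by blast
    qed
  qed
  have img: "\<psi> ` (M \<inter> U) = U \<inter> {x. \<forall>i. i \<notin> {j0} \<longrightarrow> x $ i = 0}"
  proof (intro subset_antisym subsetI)
    fix y assume "y \<in> \<psi> ` (M \<inter> U)"
    then obtain x where x: "y = \<psi> x" "x \<in> U" "\<forall>j. x $ j = g j (x $ j0)" by (auto simp: M_def)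
    have "y \<in> U" using x \<psi>U by simp
    moreover have "y $ i = 0" if "i \<noteq> j0" for i using that x(3)[rule_format, of i] by (simp add: x(1) \<psi>_def)
    ultimately show "y \<in> U \<inter> {x. \<forall>i. i \<notin> {j0} \<longrightarrow> x $ i = 0}" by simp
  next
    fix y assume y: "y \<in> U \<inter> {x. \<forall>i. i \<notin> {j0} \<longrightarrow> x $ i = 0}"
    have "\<phi> y $ j = g j (\<phi> y $ j0)" for j
    proof (cases "j = j0")
      case True
      have "y $ j0 \<in> H" using y by (simp add: U_def)
      from g0[OF this] show ?thesis by (simp add: True \<phi>_def)
    next
      case False
      then have "y $ j = 0" using y by simp
      then show ?thesis using False by (simp add: \<phi>_def)
    qed
    moreover have "\<phi> y \<in> U" using y \<psi>U(2) by blast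
    ultimately have "\<phi> y \<in> M" "\<phi> y \<in> U" unfolding M_def by blast+
    then have "\<psi> (\<phi> y) \<in> \<psi> ` (M \<inter> U)" by blast
    then show "y \<in> \<psi> ` (M \<inter> U)" unfolding \<psi>\<phi>(1) .
  qed
  have "z \<in> M" using z by (auto simp: M_def U_def H_def g_def)
  then have "pos_dim_complex_submanifold M"
    unfolding pos_dim_complex_submanifold_def
  proof (intro conjI ballI)
    fix a assume "a \<in> M"
    then have "a \<in> U" by (simp add: M_def)
    then show "\<exists>U V \<psi> I. open U \<and> a \<in> U \<and> open V \<and> biholo U V \<psi> \<and> I \<noteq> {} \<and>
        \<psi> ` (M \<inter> U) = V \<inter> {x. \<forall>i. i \<notin> I \<longrightarrow> x $ i = 0}"
      using oU bi img by blast
  qed blast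
  moreover have "\<exists>\<theta>. \<forall>j. x $ j = exp (of_real (d j) * \<theta>) * z $ j" if "x \<in> M" for x
  proof (intro exI allI)
    fix j
    have "x $ j = g j (x $ j0)" using that unfolding M_def by blast
    also have "\<dots> = exp (of_real (d j) * (Ln (x $ j0 / z $ j0) / of_real (d j0))) * z $ j" by (simp add: g_def)
    finally show "x $ j = exp (of_real (d j) * (Ln (x $ j0 / z $ j0) / of_real (d j0))) * z $ j" .
  qed
  ultimately show ?thesis by blast
qed

text \<open>The hypothesis on submanifolds serves the last goal: each component is homogeneous
  separately in z and in cnj z, so a common zero spreads to exp(\<delta> \<theta>) z for complex
  \<theta>, whereas p as a whole is in general homogeneous only for real \<theta>.\<close>

lemma model_pol_of:
  fixes m :: "'n::finite \<Rightarrow> nat"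
  assumes m: "\<forall>j. m j > 0"
    and p: "real_poly p" "weighted_homogeneous m 1 p" "no_pure_terms p"
    and M: "\<not> (\<exists>M. M \<subseteq> {z. peval p z = 0} \<and> pos_dim_complex_submanifold M)"
    and N: "condN (sig_part m 0 p)" "condN (sig_part m 0 (pmult p p))"
  shows "model (delta m) (pol_of p)"
proof -
  have ip: "is_poly p" using p(1) by (simp add: real_poly_def)
  have wt0: "A = (\<lambda>_. 0)" if "wt m A \<le> 0" for A
  proof -
    have nn: "\<And>i. 0 \<le> real (A i) / (2 * real (m i))" by simp
    have "(\<Sum>i\<in>UNIV. real (A i) / (2 * real (m i))) = 0"
      using that sum_nonneg[of UNIV "\<lambda>i. real (A i) / (2 * real (m i))"] unfolding wt_def by (intro antisym) auto
    then have "real (A i) / (2 * real (m i)) = 0" for i by (subst (asm) sum_nonneg_eq_0_iff) auto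
    then have "A i = 0" for i using m by (metis divide_eq_0_iff mult_eq_0_iff of_nat_eq_0_iff not_less_zero zero_neq_numeral)
    then show ?thesis by auto
  qed
  have filt: "is_poly (\<lambda>A B. if Z A B then c A B else 0)" if "is_poly c" for Z and c :: "('n \<Rightarrow> nat) \<Rightarrow> ('n \<Rightarrow> nat) \<Rightarrow> complex"
    using that unfolding is_poly_def by (rule finite_subset[rotated]) auto
  have sig: "sig_part m 0 p = (\<lambda>A B. if wt m A = 1 / 2 then p A B else 0)"
    by (rule sig_part_eq[OF p(2)])
  have sig2: "sig_part m 0 (pmult p p) = (\<lambda>A B. if wt m A = 1 then pmult p p A B else 0)"
    using sig_part_eq[OF weighted_homogeneous_pmult[OF p(2) p(2)]] by simp
  have isp: "whom (wa (delta m)) (1 - h) (wcomp (wh (delta m)) h (pol_of p))" for h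
    unfolding wcomp_pol_of[OF ip] unfolding pol_of_def
  proof (intro whom_sum)
    fix x assume "x \<in> {(A, B). (if wt m A = h then p A B else 0) \<noteq> 0}"
    then obtain A B where x: "x = (A, B)" "wt m A = h" "p A B \<noteq> 0" by (auto split: if_splits)
    then have "wt m B = 1 - h" using p(2) unfolding weighted_homogeneous_def by force
    then show "whom (wa (delta m)) (1 - h) (case x of (A, B) \<Rightarrow> cst (if wt m A = h then p A B else 0) * mon A B)"
      using whom_cst_mult[OF whom_mon(2)[of m B A]] x by simp
  qed
  show ?thesis
  proof
    show "delta m None = 1" by simp
    show "\<exists>M::nat. 2 \<le> M \<and> real M * delta m (Some j) = 1" for j
      using m[rule_format, of j] by (intro exI[of _ "2 * m j"]) (simp add: delta_Some)
    show "C (pol_of p) = pol_of p"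
    proof -
      have herm: "cnj (p A B) = p B A" for A B using p(1) unfolding real_poly_def by metis
      have nz: "p B A \<noteq> 0" if "p A B \<noteq> 0" for A B using that unfolding herm[symmetric, of A B] by simp
      have "C (pol_of p) = (\<Sum>x\<in>{(A, B). p A B \<noteq> 0}. cst (cnj (p (fst x) (snd x))) * mon (snd x) (fst x))"
        by (simp add: pol_of_def case_prod_beta mon_def C_hm C_am mult.commute)
      also have "\<dots> = (\<Sum>x\<in>{(A, B). p A B \<noteq> 0}. cst (p (fst x) (snd x)) * mon (fst x) (snd x))"
      proof (rule sum.reindex_bij_witness[where i = prod.swap and j = prod.swap])
        fix x assume "x \<in> {(A, B). p A B \<noteq> 0}"
        then have "p (fst x) (snd x) \<noteq> 0" by auto
        then show "prod.swap x \<in> {(A, B). p A B \<noteq> 0}" "prod.swap x \<in> {(A, B). p A B \<noteq> 0}"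
          using nz[of "fst x" "snd x"] by (simp_all add: prod.swap_def)
      qed (simp_all add: herm)
      finally show ?thesis by (simp add: pol_of_def case_prod_beta)
    qed
    show "pd (Inl None) (pol_of p) = 0" by (rule pd_pol_of_None)
    show "Eu (wh (delta m)) (pol_of p) + Eu (wa (delta m)) (pol_of p) = pol_of p"
    proof -
      have "Eu (wh (delta m)) (cst c * mon A B) + Eu (wa (delta m)) (cst c * mon A B) = cst c * mon A B"
        if "wt m A + wt m B = 1" for A B c
      proof -
        have "Eu (wh (delta m)) (cst c * mon A B) + Eu (wa (delta m)) (cst c * mon A B) = rc (wt m A + wt m B) * (cst c * mon A B)"
          using whom_cst_mult[OF whom_mon(1)[of m A B], of c] whom_cst_mult[OF whom_mon(2)[of m B A], of c]
          by (simp add: whom_def cst_hom algebra_simps)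
        then show ?thesis using that by (simp add: cst_hom)
      qed
      then show ?thesis
        using p(2) unfolding pol_of_def Eu_def der_sum sum.distrib[symmetric] weighted_homogeneous_def
        by (intro sum.cong) auto
    qed
    show "wcomp (wh (delta m)) h (pol_of p) = 0" if h: "h \<le> 0 \<or> 1 \<le> h" for h
    proof -
      have "p A B = 0" if "wt m A = h" for A B
      proof (rule ccontr)
        assume ne: "p A B \<noteq> 0"
        then have "wt m A + wt m B = 1" using p(2) unfolding weighted_homogeneous_def by blast
        then have "wt m A \<le> 0 \<or> wt m B \<le> 0" using h that by auto
        then have "A = (\<lambda>_. 0) \<or> B = (\<lambda>_. 0)" using wt0 by blast
        then show False using ne p(3) unfolding no_pure_terms_def by auto
      qed
      then have "(\<lambda>A B. if wt m A = h then p A B else 0) = (\<lambda>A B. 0)" by (intro ext) simp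
      then show ?thesis unfolding wcomp_pol_of[OF ip] by (simp add: pol_of_def)
    qed
    show "A k = 0" if "\<And>k. holo (A k)" "\<And>k. pd (Inl None) (A k) = 0" "A None = 0"
      "D A (wcomp (wh (delta m)) (1 / 2) (pol_of p)) = 0" for A k
      by (rule condN_pol_of[where A = A, OF N(1) _ that(1-3)]) (use that(4) in \<open>auto simp: sig wcomp_pol_of[OF ip] filt[OF ip]\<close>)
    show "A k = 0" if "\<And>k. holo (A k)" "\<And>k. pd (Inl None) (A k) = 0" "A None = 0"
      "D A (wcomp (wh (delta m)) 1 (pol_of p * pol_of p)) = 0" for A k
      by (rule condN_pol_of[where A = A, OF N(2) _ that(1-3)])
        (use that(4) in \<open>auto simp: sig2 wcomp_pol_of[OF pmult_pol_of(1)[OF ip ip]] pmult_pol_of(2)[OF ip ip, symmetric] filt[OF pmult_pol_of(1)[OF ip ip]]\<close>)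
    show "\<zeta> k = 0" if \<zeta>: "\<zeta> None = 0" "\<And>h. ev (wcomp (wh (delta m)) h (pol_of p)) (case_sum \<zeta> (cnj \<circ> \<zeta>)) = 0" for \<zeta> k
    proof (rule ccontr)
      assume "\<zeta> k \<noteq> 0"
      then obtain j0 where j0: "\<zeta> (Some j0) \<noteq> 0" using \<zeta>(1) by (cases k) auto
      define z where "z = (\<chi> j. \<zeta> (Some j))"
      obtain S where S: "pos_dim_complex_submanifold S"
        "\<And>x. x \<in> S \<Longrightarrow> \<exists>\<theta>. \<forall>j. x $ j = exp (of_real (delta m (Some j)) * \<theta>) * z $ j"
        using orbit_submanifold[of z j0 "\<lambda>j. delta m (Some j)"] j0 m by (auto simp: z_def delta_Some)
      have "peval p x = 0" if xS: "x \<in> S" for x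
      proof -
        obtain \<theta> where \<theta>: "\<And>j. x $ j = exp (of_real (delta m (Some j)) * \<theta>) * z $ j" using S(2)[OF xS] by blast
        define y where "y v = exp (of_real (wh (delta m) v) * \<theta>) * case_sum \<zeta> (cnj \<circ> \<zeta>) v" for v
        \<comment> \<open>The conjugate variables are scaled with cnj \<theta>, so the scaling law
          is applied twice, with different parameters.\<close>
        have pt: "pt (0, x) = (\<lambda>v. exp (of_real (wa (delta m) v) * cnj \<theta>) * y v)"
        proof
          fix v
          show "pt (0, x) v = exp (of_real (wa (delta m) v) * cnj \<theta>) * y v"
          proof (cases v)
            case (Inl i)
            then show ?thesis using \<theta> \<zeta>(1) by (cases i) (auto simp: y_def z_def)
          next
            case (Inr i)
            then show ?thesis using \<theta> \<zeta>(1) by (cases i) (auto simp: y_def z_def exp_cnj)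
          qed
        qed
        have "ev (wcomp (wh (delta m)) h (pol_of p)) (pt (0, x)) = 0" for h
          unfolding pt whom_scale[OF isp] unfolding y_def whom_scale[OF whom_cmp] by (simp add: \<zeta>(2))
        then have "ev (\<Sum>h | wcomp (wh (delta m)) h (pol_of p) \<noteq> 0. wcomp (wh (delta m)) h (pol_of p)) (pt (0, x)) = 0" by simp
        then show ?thesis by (simp add: wcomp_sum_all wcomp_finite ev_pol_of)
      qed
      then show False using M S(1) by blast
    qed
  qed
qed

section \<open>The leading part of a Taylor expansion\<close>

lemma whom_pd_general:
  assumes "whom \<omega> a f"
  shows "whom \<omega> (a - \<omega> v) (pd v f)"
proof -
  define e where "e w = (if w = v then 1 else 0 :: 'a pol)" for w
  have "der (brk (\<lambda>w. rc (\<omega> w) * var w) e) f = - rc (\<omega> v) * der e f"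
  proof (rule derivation_eqI[where M = "\<lambda>f. - rc (\<omega> v) * der e f"])
    fix u
    show "der (brk (\<lambda>w. rc (\<omega> w) * var w) e) (var u) = - rc (\<omega> v) * der e (var u)"
      by (cases "u = v") (simp_all add: brk_def e_def)
  qed (auto simp: der_mult algebra_simps)
  then have "Eu \<omega> (pd v f) = pd v (Eu \<omega> f) - rc (\<omega> v) * pd v f"
    unfolding der_brk pd_eq_der Eu_def e_def[symmetric, abs_def] by (simp add: algebra_simps)
  then show ?thesis using assms by (simp add: whom_def pd_mult cst_hom algebra_simps)
qed

text \<open>Real dilations see the total weight; it becomes the holomorphic weight once the leading
  part is known to be holomorphic.\<close>

definition wtot :: "('k \<Rightarrow> real) \<Rightarrow> 'k + 'k \<Rightarrow> real" where "wtot \<delta> = case_sum \<delta> \<delta>"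

lemma wtot_simps [simp]: "wtot \<delta> (Inl k) = \<delta> k" "wtot \<delta> (Inr k) = \<delta> k"
  by (simp_all add: wtot_def)

lemma Eu_wtot: "Eu (wtot \<delta>) f = Eu (wh \<delta>) f + Eu (wa \<delta>) f"
  by (simp add: Eu_def der_def sum_UNIV_Plus cst_hom)

lemma whom_hm_am: "whom (wtot (delta m)) (mwt m J + mwt m K) (hm J * am K)"
proof -
  have "whom (wh (delta m)) (mwt m J) (hm J * am K)" "whom (wa (delta m)) (mwt m K) (hm J * am K)"
    using whom_mult[OF whom_hm(1)[of m J] whom_am(2)[of m K]] whom_mult[OF whom_hm(2)[of m J] whom_am(1)[of m K]] by simp_all
  then show ?thesis by (simp add: whom_def Eu_wtot cst_hom algebra_simps)
qed

section \<open>Weighted dilations and rescaled expansions\<close>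

definition wscale :: "('n::finite option \<Rightarrow> real) \<Rightarrow> nat \<Rightarrow> complex \<times> (complex^'n) \<Rightarrow> complex \<times> (complex^'n)" where
  "wscale \<delta> n \<zeta> = (of_real (exp (- (\<delta> None * real n))) * fst \<zeta>,
    \<chi> j. of_real (exp (- (\<delta> (Some j) * real n))) * snd \<zeta> $ j)"

lemma cv_scl: "cv (wscale \<delta> n \<zeta>) k = of_real (exp (- (\<delta> k * real n))) * cv \<zeta> k"
  by (cases k) (simp_all add: wscale_def)

lemma real_exp: "exp (of_real a * of_real (- real n)) = complex_of_real (exp (- (a * real n)))"
  by (simp only: of_real_mult[symmetric] exp_of_real mult_minus_right)

lemma pt_scl: "pt (wscale \<delta> n \<zeta>) = (\<lambda>v. exp (of_real (wtot \<delta> v) * of_real (- real n)) * pt \<zeta> v)"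
proof
  fix v
  show "pt (wscale \<delta> n \<zeta>) v = exp (of_real (wtot \<delta> v) * of_real (- real n)) * pt \<zeta> v"
    unfolding real_exp by (cases v) (simp_all add: cv_scl)
qed

lemma ev_scl: "whom (wtot \<delta>) a f \<Longrightarrow> ev f (pt (wscale \<delta> n \<zeta>)) = of_real (exp (- (a * real n))) * ev f (pt \<zeta>)"
  unfolding pt_scl by (subst whom_scale, assumption) (simp only: real_exp)

definition n1 :: "complex \<times> (complex^'n::finite) \<Rightarrow> real" where "n1 \<zeta> = (\<Sum>k\<in>UNIV. norm (cv \<zeta> k))"

lemma norm_le_n1: "norm \<zeta> \<le> n1 \<zeta>"
proof -
  have "norm (snd \<zeta>) \<le> (\<Sum>j\<in>UNIV. norm (snd \<zeta> $ j))"
    unfolding norm_vec_def by (rule L2_set_le_sum) simp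
  moreover have "norm \<zeta> \<le> norm (fst \<zeta>) + norm (snd \<zeta>)"
    using norm_Pair_le[of "fst \<zeta>" "snd \<zeta>"] by simp
  ultimately show ?thesis by (simp add: n1_def sum_option_UNIV)
qed

lemma norm_cv_le_n1: "norm (cv \<zeta> k) \<le> n1 \<zeta>"
  unfolding n1_def by (rule member_le_sum) auto

lemma n1_scl:
  assumes "\<And>k. d \<le> \<delta> k"
  shows "n1 (wscale \<delta> n \<zeta>) \<le> exp (- (d * real n)) * n1 \<zeta>"
  unfolding n1_def sum_distrib_left
proof (rule sum_mono)
  fix k
  have "exp (- (\<delta> k * real n)) \<le> exp (- (d * real n))" using assms[of k] by (simp add: mult_right_mono)
  then show "norm (cv (wscale \<delta> n \<zeta>) k) \<le> exp (- (d * real n)) * norm (cv \<zeta> k)"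
    by (simp add: cv_scl norm_mult mult_right_mono)
qed

lemma cv_eq_0: "(\<And>k. cv \<zeta> k = 0) \<Longrightarrow> \<zeta> = 0"
proof -
  assume a: "\<And>k. cv \<zeta> k = 0"
  have "fst \<zeta> = 0" using a[of None] by simp
  moreover have "snd \<zeta> = 0" using a[of "Some _"] by (simp add: vec_eq_iff)
  ultimately show ?thesis by (simp add: prod_eq_iff)
qed

lemma wscale_eq_0: "wscale \<delta> n \<zeta> = 0 \<Longrightarrow> \<zeta> = 0"
proof (rule cv_eq_0)
  fix k assume "wscale \<delta> n \<zeta> = 0"
  then have "cv (wscale \<delta> n \<zeta>) k = 0" by (cases k) simp_all
  then show "cv \<zeta> k = 0" by (simp add: cv_scl)
qed

lemma mdeg_ex: "mdeg J = (\<Sum>k\<in>UNIV. expo J k)"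
  by (simp add: sum_option_UNIV mdeg_def expo_def)

lemma mwt_ge: "(\<And>k. d \<le> delta m k) \<Longrightarrow> d * real (mdeg J) \<le> mwt m J"
  unfolding mwt_ex mdeg_ex of_nat_sum sum_distrib_left
  by (intro sum_mono) (metis mult.commute mult_left_mono of_nat_0_le_iff)

lemma finite_mdeg: "finite {J :: 'n::finite midx. mdeg J \<le> N}"
proof -
  have "{J :: 'n midx. mdeg J \<le> N} \<subseteq> {..N} \<times> {A. \<forall>i. A i \<le> N}"
  proof
    fix J :: "'n midx" assume "J \<in> {J. mdeg J \<le> N}"
    then have J: "fst J + (\<Sum>i\<in>UNIV. snd J i) \<le> N" by (simp add: mdeg_def)
    have "snd J i \<le> (\<Sum>i\<in>UNIV. snd J i)" for i by (rule member_le_sum) auto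
    then have "snd J i \<le> N" for i using J by (meson add_leE order_trans)
    then show "J \<in> {..N} \<times> {A. \<forall>i. A i \<le> N}" using J by (cases J) auto
  qed
  then show ?thesis by (rule finite_subset) (intro finite_cartesian_product finite_le_funs, simp)
qed

lemma finite_mdeg2: "finite {(J :: 'n::finite midx, K :: 'n midx). mdeg J + mdeg K \<le> N}"
  by (rule finite_subset[of _ "{J. mdeg J \<le> N} \<times> {J. mdeg J \<le> N}"]) (auto simp: finite_mdeg)

text \<open>A Taylor expansion at 0 is dominated, along \<open>wscale \<delta> n \<zeta>\<close> for large \<open>n\<close>, by its terms of lowest weight.\<close>

definition lead_part :: "('n::finite \<Rightarrow> nat) \<Rightarrow> real \<Rightarrow> ('n midx \<Rightarrow> 'n midx \<Rightarrow> complex) \<Rightarrow> ('n option + 'n option) pol" where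
  "lead_part m s a = (\<Sum>(J, K)\<in>{(J, K). a J K \<noteq> 0 \<and> mwt m J + mwt m K = s}. cst (a J K) * (hm J * am K))"

lemma whom_leadp: "whom (wtot (delta m)) s (lead_part m s a)"
  unfolding lead_part_def by (rule whom_sum) (auto intro!: whom_cst_mult simp: whom_hm_am)

lemma delta_lower:
  fixes m :: "'n::finite \<Rightarrow> nat"
  assumes "\<forall>j. m j > 0"
  shows "\<exists>d>0. \<forall>k. d \<le> delta m k"
proof (intro exI conjI allI)
  have "0 < delta m k" for k using assms by (cases k) (auto simp: delta_Some)
  then show "0 < Min (range (delta m))" by (subst Min_gr_iff) auto
  show "Min (range (delta m)) \<le> delta m k" for k by (rule Min_le) auto
qed

text \<open>Weights are bounded below by a positive multiple of the degree.\<close>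

lemma finite_weight_le:
  fixes m :: "'n::finite \<Rightarrow> nat"
  assumes "\<forall>j. m j > 0"
  shows "finite {(J, K). mwt m J + mwt m K \<le> s}"
proof -
  obtain d where d: "d > 0" "\<And>k. d \<le> delta m k" using delta_lower[OF assms] by blast
  obtain N where N: "s / d < real N" using reals_Archimedean2 by blast
  have "{(J, K). mwt m J + mwt m K \<le> s} \<subseteq> {(J, K). mdeg J + mdeg K \<le> N}"
  proof clarify
    fix J K :: "'n midx" assume "mwt m J + mwt m K \<le> s"
    then have "d * real (mdeg J) + d * real (mdeg K) \<le> s"
      using mwt_ge[OF d(2), of J] mwt_ge[OF d(2), of K] by linarith
    then have "d * real (mdeg J + mdeg K) \<le> s" by (simp add: distrib_left)
    then have "real (mdeg J + mdeg K) \<le> s / d" using d(1) by (simp add: pos_le_divide_eq mult.commute)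
    then show "mdeg J + mdeg K \<le> N" using N by linarith
  qed
  then show ?thesis using finite_mdeg2 by (rule finite_subset)
qed

text \<open>The threshold n0 does not depend on \<zeta> in a bounded set; this uniformity lets
  holomorphy pass to the limit.\<close>

lemma taylor_leading:
  fixes f :: "complex \<times> (complex^'n::finite) \<Rightarrow> complex" and m :: "'n \<Rightarrow> nat"
  assumes m: "\<forall>j. m j > 0"
    and T: "\<And>N. ((\<lambda>\<zeta>. (f \<zeta> - (\<Sum>(J, K)\<in>{(J, K). mdeg J + mdeg K \<le> N}.
            a J K * wmono J \<zeta> * wmono K (wcnj \<zeta>))) / of_real (norm \<zeta> ^ N)) \<longlongrightarrow> 0) (at 0 within S)"
    and low: "\<And>J K. a J K \<noteq> 0 \<Longrightarrow> s \<le> mwt m J + mwt m K"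
    and \<epsilon>: "0 < \<epsilon>" and R: "1 \<le> R"
  shows "\<exists>n0. \<forall>n\<ge>n0. \<forall>\<zeta>. wscale (delta m) n \<zeta> \<in> S \<and> \<zeta> \<noteq> 0 \<and> n1 \<zeta> \<le> R \<longrightarrow>
    norm (of_real (exp (s * real n)) * f (wscale (delta m) n \<zeta>) - ev (lead_part m s a) (pt \<zeta>)) \<le> \<epsilon>"
proof -
  obtain d where d: "d > 0" "\<And>k. d \<le> delta m k" using delta_lower[OF m] by blast
  \<comment> \<open>With d N \<ge> s the remainder, a small multiple of |\<xi>|^N with |\<xi>| \<le>
    exp(-d n) R, is still small after multiplication by exp(s n).\<close>
  obtain N where N: "s / d < real N" using reals_Archimedean2 by blast
  then have Nd: "s \<le> d * real N" using d(1) by (simp add: pos_divide_less_eq mult.commute less_imp_le)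
  let ?F = "{(J :: 'n midx, K :: 'n midx). mdeg J + mdeg K \<le> N}"
  let ?L = "{(J, K). a J K \<noteq> 0 \<and> mwt m J + mwt m K = s}"
  define t where "t x = cst (case_prod a x) * (hm (fst x) * am (snd x))" for x
  define g where "g x = mwt m (fst x) + mwt m (snd x)" for x
  have tw: "whom (wtot (delta m)) (g x) (t x)" for x
    unfolding t_def g_def by (intro whom_cst_mult whom_hm_am)
  have LF: "?L \<subseteq> ?F"
  proof clarify
    fix J K assume "s = mwt m J + mwt m K"
    then have "d * real (mdeg J) + d * real (mdeg K) \<le> s"
      using mwt_ge[OF d(2), of J] mwt_ge[OF d(2), of K] by linarith
    then have "d * real (mdeg J + mdeg K) \<le> d * real N" using Nd by (simp add: distrib_left)
    then show "mdeg J + mdeg K \<le> N" using d(1) by simp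
  qed
  have lead: "lead_part m s a = (\<Sum>x\<in>?L. t x)" by (simp add: lead_part_def t_def case_prod_beta)
  have "\<forall>x. \<exists>B. \<forall>\<zeta>. n1 \<zeta> \<le> R \<longrightarrow> norm (ev (t x) (pt \<zeta>)) \<le> B"
  proof
    fix x
    obtain e M where e: "size_bd e M (t x)" using size_bd_exists by blast
    have "norm (ev (t x) (pt \<zeta>)) \<le> M * R ^ e" if "n1 \<zeta> \<le> R" for \<zeta>
    proof (rule size_bd_ev[OF e _ R])
      show "norm (pt \<zeta> v) \<le> R" for v
        using norm_cv_le_n1[of \<zeta>] that by (cases v) (auto intro: order_trans)
    qed
    then show "\<exists>B. \<forall>\<zeta>. n1 \<zeta> \<le> R \<longrightarrow> norm (ev (t x) (pt \<zeta>)) \<le> B" by blast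
  qed
  then obtain B where B: "\<And>x \<zeta>. n1 \<zeta> \<le> R \<Longrightarrow> norm (ev (t x) (pt \<zeta>)) \<le> B x" by metis
  \<comment> \<open>The remaining monomials have weight strictly above s and decay after
    rescaling.\<close>
  define G where "G = {x \<in> ?F - ?L. case_prod a x \<noteq> 0}"
  have G: "s < g x" if "x \<in> G" for x
    using that low[of "fst x" "snd x"] by (force simp: G_def g_def case_prod_beta)
  have fG: "finite G" unfolding G_def by (intro finite_subset[OF _ finite_mdeg2[of N]]) auto
  have "(\<lambda>n. \<Sum>x\<in>G. exp ((s - g x) * real n) * B x) \<longlonglongrightarrow> (\<Sum>x\<in>G. 0 * B x)"
    by (intro tendsto_intros exp_lim_0) (use G in auto)
  then have "(\<lambda>n. \<Sum>x\<in>G. exp ((s - g x) * real n) * B x) \<longlonglongrightarrow> 0" by simp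
  from LIMSEQ_D[OF this, of "\<epsilon> / 2"] \<epsilon>
  obtain na where na: "\<forall>n\<ge>na. norm ((\<Sum>x\<in>G. exp ((s - g x) * real n) * B x) - 0) < \<epsilon> / 2"
    by auto
  \<comment> \<open>R^N cancels against the bound for |\<xi>|^N; the other half of \<epsilon> pays
    for the higher monomials.\<close>
  define \<epsilon>' where "\<epsilon>' = \<epsilon> / (2 * R ^ N)"
  have \<epsilon>': "0 < \<epsilon>'" using \<epsilon> R by (simp add: \<epsilon>'_def)
  obtain \<rho> where \<rho>: "0 < \<rho>" "\<And>\<xi>. \<xi> \<in> S \<Longrightarrow> 0 < dist \<xi> 0 \<Longrightarrow> dist \<xi> 0 < \<rho> \<Longrightarrow>
      norm ((f \<xi> - (\<Sum>(J, K)\<in>?F. a J K * wmono J \<xi> * wmono K (wcnj \<xi>))) / of_real (norm \<xi> ^ N)) < \<epsilon>'"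
  proof -
    from T[of N, unfolded Lim_within, rule_format, OF \<epsilon>']
    obtain \<rho> where "0 < \<rho>" "\<forall>\<xi>\<in>S. 0 < dist \<xi> 0 \<and> dist \<xi> 0 < \<rho> \<longrightarrow>
      dist ((f \<xi> - (\<Sum>(J, K)\<in>?F. a J K * wmono J \<xi> * wmono K (wcnj \<xi>))) / of_real (norm \<xi> ^ N)) 0 < \<epsilon>'"
      by blast
    then show ?thesis using that[of \<rho>] by (simp add: dist_norm)
  qed
  have "(\<lambda>n. exp ((- d) * real n)) \<longlonglongrightarrow> 0" using d(1) by (intro exp_lim_0) simp
  moreover have "0 < \<rho> / R" using \<rho>(1) R by simp
  ultimately obtain nb where nb: "\<forall>n\<ge>nb. norm (exp ((- d) * real n) - 0) < \<rho> / R"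
    using LIMSEQ_D by blast
  show ?thesis
  proof (intro exI[of _ "max na nb"] allI impI, elim conjE)
    fix n \<zeta>
    assume n: "max na nb \<le> n" and S: "wscale (delta m) n \<zeta> \<in> S" and nz: "\<zeta> \<noteq> 0" and \<zeta>R: "n1 \<zeta> \<le> R"
    define \<xi> where "\<xi> = wscale (delta m) n \<zeta>"
    have x0: "\<xi> \<noteq> 0" using wscale_eq_0 nz unfolding \<xi>_def by blast
    have nx: "norm \<xi> \<le> exp (- (d * real n)) * R"
    proof -
      have "norm \<xi> \<le> n1 \<xi>" by (rule norm_le_n1)
      also have "\<dots> \<le> exp (- (d * real n)) * n1 \<zeta>" unfolding \<xi>_def by (rule n1_scl) (rule d(2))
      also have "\<dots> \<le> exp (- (d * real n)) * R" using \<zeta>R by (intro mult_left_mono) auto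
      finally show ?thesis .
    qed
    also have "\<dots> < \<rho>" using nb[rule_format, of n] n R by (simp add: pos_less_divide_eq)
    finally have "norm \<xi> < \<rho>" .
    define E where "E = f \<xi> - (\<Sum>(J, K)\<in>?F. a J K * wmono J \<xi> * wmono K (wcnj \<xi>))"
    have "norm (E / of_real (norm \<xi> ^ N)) < \<epsilon>'"
      unfolding E_def by (rule \<rho>(2)) (use S x0 \<open>norm \<xi> < \<rho>\<close> in \<open>auto simp: \<xi>_def\<close>)
    then have "norm E \<le> \<epsilon>' * norm \<xi> ^ N"
      using x0 by (simp add: norm_divide norm_power pos_divide_less_eq less_imp_le)
    also have "\<dots> \<le> \<epsilon>' * (exp (- (d * real n)) * R) ^ N"
      using nx \<epsilon>' by (intro mult_left_mono power_mono) auto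
    finally have "exp (s * real n) * norm E \<le> exp (s * real n) * (\<epsilon>' * (exp (- (d * real n)) * R) ^ N)"
      by (intro mult_left_mono) auto
    also have "\<dots> = exp ((s - d * real N) * real n) * (\<epsilon> / 2)"
      using R by (simp add: \<epsilon>'_def power_mult_distrib exp_of_nat_mult[symmetric] exp_add[symmetric] algebra_simps mult_exp_exp)
    also have "\<dots> \<le> 1 * (\<epsilon> / 2)"
      using Nd \<epsilon> by (intro mult_right_mono) (auto simp: mult_nonpos_nonneg)
    finally have E2: "norm (of_real (exp (s * real n)) * E) \<le> \<epsilon> / 2" by (simp add: norm_mult)
    have "(\<Sum>(J, K)\<in>?F. a J K * wmono J \<xi> * wmono K (wcnj \<xi>)) = (\<Sum>x\<in>?F. ev (t x) (pt \<xi>))"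
      by (simp add: t_def case_prod_beta ev_hm ev_am mult.assoc)
    also have "of_real (exp (s * real n)) * \<dots> = (\<Sum>x\<in>?F. of_real (exp ((s - g x) * real n)) * ev (t x) (pt \<zeta>))"
      unfolding \<xi>_def ev_scl[OF tw] sum_distrib_left
      by (intro sum.cong) (simp_all add: exp_add[symmetric] algebra_simps mult_exp_exp flip: of_real_mult)
    also have "\<dots> = (\<Sum>x\<in>?L. of_real (exp ((s - g x) * real n)) * ev (t x) (pt \<zeta>))
        + (\<Sum>x\<in>?F - ?L. of_real (exp ((s - g x) * real n)) * ev (t x) (pt \<zeta>))"
      using LF finite_mdeg2[of N] by (subst sum.subset_diff[of ?L]) auto
    also have "(\<Sum>x\<in>?L. of_real (exp ((s - g x) * real n)) * ev (t x) (pt \<zeta>)) = ev (lead_part m s a) (pt \<zeta>)"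
      unfolding lead ev_sum by (intro sum.cong) (auto simp: g_def)
    also have "(\<Sum>x\<in>?F - ?L. of_real (exp ((s - g x) * real n)) * ev (t x) (pt \<zeta>))
        = (\<Sum>x\<in>G. of_real (exp ((s - g x) * real n)) * ev (t x) (pt \<zeta>))"
      using finite_mdeg2[of N] by (intro sum.mono_neutral_right) (auto simp: G_def t_def cst_hom)
    finally have eq: "of_real (exp (s * real n)) * f \<xi> - ev (lead_part m s a) (pt \<zeta>)
        = of_real (exp (s * real n)) * E + (\<Sum>x\<in>G. of_real (exp ((s - g x) * real n)) * ev (t x) (pt \<zeta>))"
      by (simp add: E_def algebra_simps)
    have "norm (\<Sum>x\<in>G. of_real (exp ((s - g x) * real n)) * ev (t x) (pt \<zeta>)) \<le> (\<Sum>x\<in>G. exp ((s - g x) * real n) * B x)"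
      by (intro sum_norm_le) (simp add: norm_mult B[OF \<zeta>R])
    also have "\<dots> \<le> \<epsilon> / 2" using na[rule_format, of n] n by simp
    finally show "norm (of_real (exp (s * real n)) * f (wscale (delta m) n \<zeta>) - ev (lead_part m s a) (pt \<zeta>)) \<le> \<epsilon>"
      unfolding \<xi>_def[symmetric] eq using E2 by (intro order_trans[OF norm_triangle_ineq]) linarith
  qed
qed

lemma cv_line: "cv (\<zeta> + t *\<^sub>R \<eta>) k = cv \<zeta> k + of_real t * cv \<eta> k"
proof (cases k)
  case (Some j)
  have "(snd \<zeta> + t *\<^sub>R snd \<eta>) $ j = snd \<zeta> $ j + t *\<^sub>R (snd \<eta> $ j)"
    by (simp only: vector_add_component vector_scaleR_component)
  then show ?thesis unfolding Some scaleR_conv_of_real[of t "snd \<eta> $ j"] by simp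
qed (simp add: scaleR_conv_of_real)

lemma ev_real_line: "\<exists>q. \<forall>t::real. ev f (pt (\<zeta> + t *\<^sub>R \<eta>)) = poly q (of_real t)"
proof -
  obtain q where q: "\<forall>t. ev f (\<lambda>v. pt \<zeta> v + t * pt \<eta> v) = poly q t" using poly_fun_line[OF ev] by blast
  have "pt (\<zeta> + t *\<^sub>R \<eta>) = (\<lambda>v. pt \<zeta> v + of_real t * pt \<eta> v)" for t
  proof
    fix v show "pt (\<zeta> + t *\<^sub>R \<eta>) v = pt \<zeta> v + of_real t * pt \<eta> v"
      by (cases v) (simp_all add: cv_line)
  qed
  then show ?thesis using q by auto
qed

lemma poly_real_zero:
  assumes "infinite T" "\<And>t. t \<in> T \<Longrightarrow> poly q (complex_of_real t) = 0"
  shows "q = 0"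
proof (rule ccontr)
  assume "q \<noteq> 0"
  then have "finite {x. poly q x = 0}" by (rule poly_roots_finite)
  moreover have "of_real ` T \<subseteq> {x. poly q x = 0}" using assms(2) by auto
  ultimately have "finite (complex_of_real ` T)" by (rule finite_subset[rotated])
  then show False using assms(1) by (simp add: finite_image_iff inj_on_def)
qed

text \<open>The points \<open>(\<zeta>, cnj \<zeta>)\<close> form a totally real subspace of maximal dimension.\<close>

lemma pol_zero_on_open:
  fixes f :: "('n::finite option + 'n option) pol"
  assumes U: "open U" "U \<noteq> {}" and f: "\<And>\<zeta>. \<zeta> \<in> U \<Longrightarrow> ev f (pt \<zeta>) = 0"
  shows "f = 0"
proof -
  obtain \<zeta>\<^sub>0 where z0: "\<zeta>\<^sub>0 \<in> U" using U(2) by blast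
  have all: "ev f (pt \<zeta>) = 0" for \<zeta>
  proof -
    obtain q where q: "\<And>t::real. ev f (pt (\<zeta>\<^sub>0 + t *\<^sub>R (\<zeta> - \<zeta>\<^sub>0))) = poly q (of_real t)" using ev_real_line by blast
    have "open ((\<lambda>t::real. \<zeta>\<^sub>0 + t *\<^sub>R (\<zeta> - \<zeta>\<^sub>0)) -` U)"
      by (intro open_vimage U continuous_intros)
    moreover have "0 \<in> (\<lambda>t::real. \<zeta>\<^sub>0 + t *\<^sub>R (\<zeta> - \<zeta>\<^sub>0)) -` U" using z0 by simp
    ultimately have "infinite ((\<lambda>t::real. \<zeta>\<^sub>0 + t *\<^sub>R (\<zeta> - \<zeta>\<^sub>0)) -` U)"
      using finite_imp_not_open by blast
    then have "q = 0" by (rule poly_real_zero) (simp add: q[symmetric] f)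
    then show ?thesis using q[of 1] by simp
  qed
  show ?thesis
  proof (rule pol_eqI)
    fix x :: "'n option + 'n option \<Rightarrow> complex"
    define mk where "mk c = (c None, \<chi> j. c (Some j))" for c :: "'n option \<Rightarrow> complex"
    have cm: "cv (mk c) k = c k" for c k by (cases k) (simp_all add: mk_def)
    \<comment> \<open>Two real points with x = \<alpha> + i \<beta>: vanishing for real parameters
      on the line through them extends to the parameter i.\<close>
    define \<alpha> where "\<alpha> = mk (\<lambda>k. (x (Inl k) + cnj (x (Inr k))) / 2)"
    define \<beta> where "\<beta> = mk (\<lambda>k. (x (Inl k) - cnj (x (Inr k))) / (2 * \<i>))"
    obtain q where q: "\<forall>t. ev f (\<lambda>v. pt \<alpha> v + t * pt \<beta> v) = poly q t" using poly_fun_line[OF ev] by blast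
    have "pt (\<alpha> + t *\<^sub>R \<beta>) = (\<lambda>v. pt \<alpha> v + of_real t * pt \<beta> v)" for t
    proof
      fix v show "pt (\<alpha> + t *\<^sub>R \<beta>) v = pt \<alpha> v + of_real t * pt \<beta> v"
        by (cases v) (simp_all add: cv_line)
    qed
    then have "poly q (of_real t) = 0" for t using q all by metis
    then have "q = 0" by (intro poly_real_zero[of UNIV]) (auto simp: infinite_UNIV_char_0)
    moreover have "(\<lambda>v. pt \<alpha> v + \<i> * pt \<beta> v) = x"
    proof
      fix v show "pt \<alpha> v + \<i> * pt \<beta> v = x v"
        by (cases v) (simp_all add: \<alpha>_def \<beta>_def cm field_simps)
    qed
    ultimately show "ev f x = ev 0 x" using q[rule_format, of \<i>] by simp
  qed
qed

text \<open>The expansion admits conjugate monomials, so holomorphy of the leading part has to be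
  derived: on a small disc in each coordinate direction the rescaled functions are holomorphic and
  converge uniformly to it.\<close>

lemma leading_holo:
  fixes f :: "complex \<times> (complex^'n::finite) \<Rightarrow> complex" and m :: "'n \<Rightarrow> nat"
  assumes m: "\<forall>j. m j > 0"
    and T: "\<And>N. ((\<lambda>\<zeta>. (f \<zeta> - (\<Sum>(J, K)\<in>{(J, K). mdeg J + mdeg K \<le> N}.
            a J K * wmono J \<zeta> * wmono K (wcnj \<zeta>))) / of_real (norm \<zeta> ^ N)) \<longlongrightarrow> 0) (at 0 within closure S)"
    and low: "\<And>J K. a J K \<noteq> 0 \<Longrightarrow> s \<le> mwt m J + mwt m K"
    and S: "open S" "S \<noteq> {}" "0 \<notin> S" "\<And>n \<zeta>. \<zeta> \<in> S \<Longrightarrow> wscale (delta m) n \<zeta> \<in> S"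
    and f: "holo_on S f"
  shows "holo (lead_part m s a)"
  unfolding holo_def
proof
  fix k :: "'n option"
  let ?q = "lead_part m s a"
  define e :: "complex \<times> (complex^'n)" where "e = (if k = None then 1 else 0, \<chi> j. if k = Some j then 1 else 0)"
  have ce: "cv e i = (if i = k then 1 else 0)" for i by (cases i) (auto simp: e_def)
  have cvc: "cv (csmul \<tau> v) i = \<tau> * cv v i" for \<tau> v i by (cases i) (auto simp: csmul_def)
  have cva: "cv (u + v) i = cv u i + cv v i" for u v i by (cases i) auto
  have cv_inj: "u = v" if "\<And>i. cv u i = cv v i" for u v
    using that[of None] that[of "Some _"] by (auto simp: prod_eq_iff vec_eq_iff)
  have bl: "bounded_linear (\<lambda>\<tau>. csmul \<tau> v)" for v
    unfolding csmul_def
    by (intro bounded_linear_Pair bounded_linear_mult_left)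
      (auto intro!: linear_conv_bounded_linear[THEN iffD1] linearI simp: vec_eq_iff algebra_simps)
  show "pd (Inr k) ?q = 0"
  proof (rule pol_zero_on_open[OF S(1,2)])
    fix \<zeta> assume \<zeta>: "\<zeta> \<in> S"
    define \<gamma> where "\<gamma> \<tau> = \<zeta> + csmul \<tau> e" for \<tau>
    have \<gamma>d: "(\<gamma> has_derivative (\<lambda>h. csmul h e)) (at \<tau>)" for \<tau>
      unfolding \<gamma>_def using has_derivative_add[OF has_derivative_const bounded_linear_imp_has_derivative[OF bl]] by simp
    have cont: "continuous_on UNIV \<gamma>"
      using \<gamma>d by (intro continuous_at_imp_continuous_on ballI has_derivative_continuous) blast
    have \<gamma>0: "\<gamma> 0 = \<zeta>" by (rule cv_inj) (simp add: \<gamma>_def cva cvc)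
    have "open (\<gamma> -` S)" using open_vimage[OF S(1) cont] .
    moreover have "0 \<in> \<gamma> -` S" using \<gamma>0 \<zeta> by simp
    ultimately obtain \<rho> where \<rho>: "0 < \<rho>" "ball 0 \<rho> \<subseteq> \<gamma> -` S" using open_contains_ball by blast
    define R where "R = n1 \<zeta> + \<rho> * n1 e + 1"
    have n1pos: "0 \<le> n1 \<xi>" for \<xi> :: "complex \<times> (complex^'n)" by (simp add: n1_def sum_nonneg)
    have R1: "1 \<le> R" using n1pos[of \<zeta>] n1pos[of e] \<rho>(1) by (simp add: R_def)
    have \<gamma>R: "n1 (\<gamma> \<tau>) \<le> R" if "\<tau> \<in> ball 0 \<rho>" for \<tau>
    proof -
      have "n1 (\<gamma> \<tau>) \<le> (\<Sum>i\<in>UNIV. norm (cv \<zeta> i) + norm \<tau> * norm (cv e i))"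
        unfolding n1_def by (intro sum_mono) (auto simp: \<gamma>_def cva cvc norm_mult intro: order_trans[OF norm_triangle_ineq])
      also have "\<dots> = n1 \<zeta> + norm \<tau> * n1 e" by (simp add: n1_def sum.distrib sum_distrib_left)
      also have "norm \<tau> * n1 e \<le> \<rho> * n1 e"
        using that n1pos[of e] by (intro mult_right_mono) auto
      also have "n1 \<zeta> + \<rho> * n1 e \<le> R" by (simp add: R_def)
      finally show ?thesis by simp
    qed
    define F where "F n \<tau> = of_real (exp (s * real n)) * f (wscale (delta m) n (\<gamma> \<tau>))" for n and \<tau> :: complex
    define G where "G \<tau> = ev ?q (pt (\<gamma> \<tau>))" for \<tau>
    have Fh: "F n holomorphic_on ball 0 \<rho>" for n
      unfolding holomorphic_on_def
    proof
      fix \<tau> :: complex assume \<tau>: "\<tau> \<in> ball 0 \<rho>"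
      have in_S: "wscale (delta m) n (\<gamma> \<tau>) \<in> S" using \<rho>(2) \<tau> by (intro S(4)) auto
      have sg: "wscale (delta m) n (\<gamma> \<tau>) = wscale (delta m) n \<zeta> + csmul \<tau> (wscale (delta m) n e)" for \<tau> :: complex
        by (rule cv_inj) (simp add: \<gamma>_def cva cvc cv_scl algebra_simps)
      obtain L where L: "(f has_derivative L) (at (wscale (delta m) n (\<gamma> \<tau>)))" "\<And>c v. L (csmul c v) = c * L v"
        using f in_S unfolding holo_on_def by blast
      have "((\<lambda>\<tau>. wscale (delta m) n (\<gamma> \<tau>)) has_derivative (\<lambda>h. csmul h (wscale (delta m) n e))) (at \<tau>)"
        unfolding sg using has_derivative_add[OF has_derivative_const bounded_linear_imp_has_derivative[OF bl]] by simp
      from has_derivative_compose[OF this L(1)]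
      have "((\<lambda>\<tau>. f (wscale (delta m) n (\<gamma> \<tau>))) has_field_derivative L (wscale (delta m) n e)) (at \<tau>)"
        unfolding has_field_derivative_def by (rule has_derivative_eq_rhs) (simp add: L(2) fun_eq_iff mult.commute)
      then have "(F n has_field_derivative of_real (exp (s * real n)) * L (wscale (delta m) n e)) (at \<tau>)"
        unfolding F_def by (intro DERIV_cmult)
      then show "F n field_differentiable at \<tau> within ball 0 \<rho>"
        unfolding field_differentiable_def by (blast intro: has_field_derivative_at_within)
    qed
    have "G holomorphic_on ball 0 \<rho>"
    proof (rule holomorphic_uniform_sequence[OF open_ball Fh])
      fix x :: complex assume "x \<in> ball 0 \<rho>"
      then obtain d where d: "0 < d" "cball x d \<subseteq> ball 0 \<rho>" using open_ball open_contains_cball by blast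
      have "uniform_limit (cball x d) F G sequentially"
      proof (rule uniform_limitI)
        fix \<epsilon> :: real assume \<epsilon>: "0 < \<epsilon>"
        then obtain n0 where n0: "\<And>n \<xi>. n \<ge> n0 \<Longrightarrow> wscale (delta m) n \<xi> \<in> closure S \<Longrightarrow> \<xi> \<noteq> 0 \<Longrightarrow> n1 \<xi> \<le> R \<Longrightarrow>
          norm (of_real (exp (s * real n)) * f (wscale (delta m) n \<xi>) - ev ?q (pt \<xi>)) \<le> \<epsilon> / 2"
          using taylor_leading[OF m T low _ R1, where \<epsilon> = "\<epsilon> / 2"] by (auto simp: half_gt_zero)
        have "dist (F n \<tau>) (G \<tau>) < \<epsilon>" if "n \<ge> n0" "\<tau> \<in> cball x d" for n \<tau>
        proof -
          have \<tau>: "\<tau> \<in> ball 0 \<rho>" using d(2) that(2) by blast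
          then have g: "\<gamma> \<tau> \<in> S" using \<rho>(2) by auto
          have "norm (F n \<tau> - G \<tau>) \<le> \<epsilon> / 2"
            unfolding F_def G_def
            by (rule n0[OF that(1)]) (use g S(3) subsetD[OF closure_subset S(4)[OF g]] \<gamma>R[OF \<tau>] in auto)
          then show ?thesis using \<epsilon> by (simp add: dist_norm)
        qed
        then show "\<forall>\<^sub>F n in sequentially. \<forall>x\<in>cball x d. dist (F n x) (G x) < \<epsilon>"
          unfolding eventually_sequentially by blast
      qed
      then show "\<exists>d>0. cball x d \<subseteq> ball 0 \<rho> \<and> uniform_limit (cball x d) F G sequentially" using d by blast
    qed
    then obtain G' where "(G has_field_derivative G') (at 0)"
      using \<rho>(1) holomorphic_derivI[of G "ball 0 \<rho>" 0] by auto
    then have D1: "(G has_derivative (\<lambda>h. G' * h)) (at 0)" by (simp add: has_field_derivative_def)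
    have "((\<lambda>\<tau>. ev ?q (pt (\<gamma> \<tau>))) has_derivative
      (\<lambda>h. (\<Sum>i\<in>UNIV. ev (pd (Inl i) ?q) (pt (\<gamma> 0)) * cv (csmul h e) i)
        + (\<Sum>i\<in>UNIV. ev (pd (Inr i) ?q) (pt (\<gamma> 0)) * cnj (cv (csmul h e) i)))) (at 0)"
      by (rule has_derivative_compose[OF \<gamma>d ev_pt_has_derivative])
    moreover have "(\<Sum>i\<in>UNIV. c i * cv (csmul h e) i) = c k * h" "(\<Sum>i\<in>UNIV. c i * cnj (cv (csmul h e) i)) = c k * cnj h" for c h
    proof -
      have "(\<Sum>i\<in>UNIV. c i * cv (csmul h e) i) = (\<Sum>i\<in>UNIV. if i = k then c i * h else 0)"
        by (rule sum.cong) (auto simp: cvc ce)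
      then show "(\<Sum>i\<in>UNIV. c i * cv (csmul h e) i) = c k * h" by simp
      have "(\<Sum>i\<in>UNIV. c i * cnj (cv (csmul h e) i)) = (\<Sum>i\<in>UNIV. if i = k then c i * cnj h else 0)"
        by (rule sum.cong) (auto simp: cvc ce)
      then show "(\<Sum>i\<in>UNIV. c i * cnj (cv (csmul h e) i)) = c k * cnj h" by simp
    qed
    ultimately have D2: "(G has_derivative (\<lambda>h. ev (pd (Inl k) ?q) (pt \<zeta>) * h + ev (pd (Inr k) ?q) (pt \<zeta>) * cnj h)) (at 0)"
      by (simp add: G_def[abs_def] \<gamma>0)
    \<comment> \<open>A complex linear differential has no part in cnj h; the directions 1 and i
      separate the two coefficients.\<close>
    have "(\<lambda>h. G' * h) = (\<lambda>h. ev (pd (Inl k) ?q) (pt \<zeta>) * h + ev (pd (Inr k) ?q) (pt \<zeta>) * cnj h)"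
      by (rule has_derivative_unique[OF D1 D2])
    from fun_cong[OF this, of 1] fun_cong[OF this, of \<i>]
    have "G' = ev (pd (Inl k) ?q) (pt \<zeta>) + ev (pd (Inr k) ?q) (pt \<zeta>)"
      "G' * \<i> = (ev (pd (Inl k) ?q) (pt \<zeta>) - ev (pd (Inr k) ?q) (pt \<zeta>)) * \<i>"
      by (simp_all add: algebra_simps)
    then show "ev (pd (Inr k) ?q) (pt \<zeta>) = 0" by simp
  qed
qed

section \<open>Division by the defining function\<close>

lift_definition subst :: "'v \<Rightarrow> 'v pol \<Rightarrow> 'v pol \<Rightarrow> 'v pol" is "\<lambda>v t f x. f (x(v := t x))"
proof -
  fix v :: 'v and t f :: "('v \<Rightarrow> complex) \<Rightarrow> complex"
  assume t: "t \<in> poly_fun" and "f \<in> poly_fun"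
  from this(2) show "(\<lambda>x. f (x(v := t x))) \<in> poly_fun"
  proof (induction rule: poly_fun.induct)
    case (coord w)
    show ?case using t poly_fun.coord[of w] by (cases "w = v") simp_all
  qed (auto intro: poly_fun.intros)
qed

lemma ev_subst: "ev (subst v t f) x = ev f (x(v := ev t x))"
  by (simp add: subst.rep_eq)

text \<open>The factor theorem, with a polynomial in place of a root.\<close>

lemma subst_dvd: "(var v - t) dvd (f - subst v t f)"
proof (induction f rule: pol_induct)
  case (cst c)
  have "subst v t (cst c) = cst c" by (rule pol_eqI) (simp add: ev_subst)
  then show ?case by simp
next
  case (var w)
  have "subst v t (var w) = (if w = v then t else var w)" by (rule pol_eqI) (simp add: ev_subst)
  then show ?case by simp
next
  case (add f g)
  have "subst v t (f + g) = subst v t f + subst v t g" by (rule pol_eqI) (simp add: ev_subst)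
  then have "f + g - subst v t (f + g) = (f - subst v t f) + (g - subst v t g)" by simp
  then show ?case using add by (metis dvd_add)
next
  case (mult f g)
  have "subst v t (f * g) = subst v t f * subst v t g" by (rule pol_eqI) (simp add: ev_subst)
  then have "f * g - subst v t (f * g) = f * (g - subst v t g) + (f - subst v t f) * subst v t g"
    by (simp add: algebra_simps)
  then show ?case using mult by (metis dvd_add dvd_mult dvd_mult2)
qed

context model
begin

lemma ev_p_real: "ev p (pt \<zeta>) \<in> \<real>"
  using ev_C_pt[of p \<zeta>] p_real by (simp add: Reals_cnj_iff)

lemma ev_p_cong: "snd \<zeta> = snd \<xi> \<Longrightarrow> ev p (pt \<zeta>) = ev p (pt \<xi>)"
proof (rule ev_cong_pd[where V = "UNIV - {Inl None, Inr None}"])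
  fix v :: "'n option + 'n option" assume "v \<notin> UNIV - {Inl None, Inr None}"
  then show "pd v p = 0" using p_wfree p_wfree' by auto
next
  fix v :: "'n option + 'n option" assume e: "snd \<zeta> = snd \<xi>" and v: "v \<in> UNIV - {Inl None, Inr None}"
  have "cv \<zeta> k = cv \<xi> k" if "k \<noteq> None" for k using that e by (cases k) auto
  then show "pt \<zeta> v = pt \<xi> v" using v by (cases v) auto
qed

lemma ev_r: "ev r (pt \<zeta>) = of_real (Im (fst \<zeta>)) + ev p (pt \<zeta>)"
proof -
  have "fst \<zeta> - cnj (fst \<zeta>) = 2 * \<i> * of_real (Im (fst \<zeta>))" by (simp add: complex_diff_cnj)
  then show ?thesis by (simp add: r_def)
qed

text \<open>The hypersurface is large enough to detect multiples of r: eliminating w by r = 0 leaves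
  a polynomial that vanishes at all real points. Points with Re w = 0 are left out so that only
  \<zeta> \<noteq> 0 occurs when the expansion at 0 is used.\<close>

lemma r_dvd:
  assumes "\<And>\<zeta>. ev r (pt \<zeta>) = 0 \<Longrightarrow> Re (fst \<zeta>) \<noteq> 0 \<Longrightarrow> ev F (pt \<zeta>) = 0"
  shows "r dvd F"
proof -
  define t where "t = wb - cst (2 * \<i>) * p"
  have "subst (Inl None) t F = 0"
  proof (rule pol_zero_on_open[of UNIV])
    fix \<zeta> :: "complex \<times> (complex^'n)"
    define P0 where "P0 = Re (ev p (pt \<zeta>))"
    have P0: "ev p (pt \<zeta>) = of_real P0" using ev_p_real[of \<zeta>] by (simp add: P0_def of_real_Re)
    \<comment> \<open>For fixed z this is a polynomial in wb alone; points of the hypersurface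
      provide the zeros u + i p with u real and nonzero.\<close>
    obtain q where q: "\<And>b. ev (subst (Inl None) t F) (\<lambda>v. ((pt \<zeta>)(Inr None := 0)) v + b * (if v = Inr None then 1 else 0)) = poly q b"
      using poly_fun_line[OF ev, where a = "(pt \<zeta>)(Inr None := 0)" and b = "\<lambda>v. if v = Inr None then 1 else 0"] by blast
    have pe: "ev p x = of_real P0" if "\<And>v. v \<noteq> Inl None \<Longrightarrow> v \<noteq> Inr None \<Longrightarrow> x v = pt \<zeta> v" for x
      unfolding P0[symmetric]
    proof (rule ev_cong_pd[where V = "UNIV - {Inl None, Inr None}"])
      fix v :: "'n option + 'n option" assume "v \<notin> UNIV - {Inl None, Inr None}"
      then show "pd v p = 0" using p_wfree p_wfree' by auto
    qed (use that in auto)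
    have "poly q (of_real u + \<i> * of_real P0) = 0" if u: "u \<noteq> 0" for u
    proof -
      define x where "x = (\<lambda>v. ((pt \<zeta>)(Inr None := 0)) v + (of_real u + \<i> * of_real P0) * (if v = Inr None then 1 else 0))"
      define \<xi> where "\<xi> = (of_real u - \<i> * of_real P0, snd \<zeta>)"
      have tx: "ev t x = of_real u - \<i> * of_real P0"
        using pe[of x] by (simp add: t_def x_def)
      have "x(Inl None := ev t x) = pt \<xi>"
      proof
        fix v
        show "(x(Inl None := ev t x)) v = pt \<xi> v"
        proof (cases v)
          case (Inl k)
          then show ?thesis unfolding tx by (cases k) (auto simp: x_def \<xi>_def)
        next
          case (Inr k)
          then show ?thesis by (cases k) (auto simp: x_def \<xi>_def)
        qed
      qed
      then have "poly q (of_real u + \<i> * of_real P0) = ev F (pt \<xi>)"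
        using q[of "of_real u + \<i> * of_real P0"] by (simp add: ev_subst x_def)
      moreover have "ev r (pt \<xi>) = 0"
        using ev_p_cong[of \<xi> \<zeta>] by (simp add: ev_r \<xi>_def P0)
      ultimately show ?thesis using assms[of \<xi>] u by (simp add: \<xi>_def)
    qed
    then have "poly (pcompose q [:\<i> * of_real P0, 1:]) (of_real u) = 0" if "u \<in> - {0}" for u
      using that by (simp add: poly_pcompose add.commute)
    moreover have "infinite (- {0 :: real})" by (simp add: finite_compl infinite_UNIV_char_0)
    ultimately have "pcompose q [:\<i> * of_real P0, 1:] = 0" by (intro poly_real_zero[of "- {0}"]) auto
    then have "q = 0" by (simp add: pcompose_eq_0_iff)
    moreover have "(\<lambda>v. ((pt \<zeta>)(Inr None := 0)) v + cnj (fst \<zeta>) * (if v = Inr None then 1 else 0)) = pt \<zeta>"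
      by (auto simp: fun_eq_iff)
    ultimately show "ev (subst (Inl None) t F) (pt \<zeta>) = 0" using q[of "cnj (fst \<zeta>)"] by simp
  qed auto
  then have "(w - t) dvd F" using subst_dvd[of "Inl None" t F] by simp
  moreover have "w - t = cst (2 * \<i>) * r" by (rule pol_eqI) (simp add: t_def r_def field_simps)
  ultimately show ?thesis by (metis dvd_mult_right)
qed

end

theorem theorem3p7:
  fixes m :: "'n::finite \<Rightarrow> nat"
    and p :: "('n \<Rightarrow> nat) \<Rightarrow> ('n \<Rightarrow> nat) \<Rightarrow> complex"
    and Q :: "complex \<times> (complex^'n) \<Rightarrow> complex \<times> (complex^'n)"
  assumes "\<forall>j. m j > 0"
    and "real_poly p"
    and "weighted_homogeneous m 1 p"
    and "no_pure_terms p"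
    and "\<not> (\<exists>M. M \<subseteq> {z. peval p z = 0} \<and> pos_dim_complex_submanifold M)"
    and "condN (sig_part m 0 p)"
    and "condN (sig_part m 0 (pmult p p))"
    and "tangential (model_domain p) (\<lambda>(w, z). Im w + Re (peval p z)) Q"
    and "\<exists>\<zeta>\<in>model_domain p. Q \<zeta> \<noteq> 0"
    and "wt_pos m (model_domain p) Q"
  shows "balanced m p"
proof -
  note m = assms(1)
  have ip: "is_poly p" using assms(2) by (simp add: real_poly_def)
  interpret md: model "delta m" "pol_of p"
    by (rule model_pol_of[OF assms(1-7)])
  let ?D = "model_domain p"
  have pe: "ev (pol_of p) (pt \<zeta>) = of_real (Re (peval p (snd \<zeta>)))" for \<zeta>
    using md.ev_p_real[of \<zeta>] ev_pol_of[of p "fst \<zeta>" "snd \<zeta>"] by (simp add: of_real_Re)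
  have rf: "(\<lambda>(w, z). Im w + Re (peval p z)) = (\<lambda>\<zeta>. Re (ev md.r (pt \<zeta>)))"
    by (auto simp: md.ev_r pe fun_eq_iff)
  have rR: "ev md.r (pt \<zeta>) = of_real (Re (ev md.r (pt \<zeta>)))" for \<zeta>
    by (simp add: md.ev_r pe)
  have D: "?D = {\<zeta>. Re (ev md.r (pt \<zeta>)) < 0}"
    unfolding model_domain_def by (auto simp: md.ev_r pe)
  have r_tot: "whom (wtot (delta m)) 1 md.r"
  proof -
    have "whom (wtot (delta m)) 1 (pol_of p)" using md.p_weight by (simp add: whom_def Eu_wtot cst_hom)
    moreover have "whom (wtot (delta m)) 1 (var (Inl None))" "whom (wtot (delta m)) 1 (var (Inr None))"
      using whom_var[of "wtot (delta m)" "Inl None"] whom_var[of "wtot (delta m)" "Inr None"] by simp_all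
    ultimately show ?thesis unfolding md.r_def by (intro whom_add whom_cst_mult whom_diff)
  qed
  have r_scl: "Re (ev md.r (pt (wscale (delta m) n \<zeta>))) = exp (- real n) * Re (ev md.r (pt \<zeta>))" for n \<zeta>
    using ev_scl[OF r_tot, of n \<zeta>] by simp
  have cont: "continuous_on UNIV (\<lambda>\<zeta>. Re (ev md.r (pt \<zeta>)))"
    by (intro continuous_on_Re continuous_at_imp_continuous_on ballI has_derivative_continuous[OF ev_pt_has_derivative])
  have oD: "open ?D" unfolding D by (intro open_Collect_less cont continuous_intros)
  \<comment> \<open>Lowering v by 1/(n + 1) enters the domain.\<close>
  have clD: "\<zeta> \<in> closure ?D" if "ev md.r (pt \<zeta>) = 0" for \<zeta>
  proof -
    define x where "x n = (fst \<zeta> - \<i> * of_real (inverse (real (Suc n))), snd \<zeta>)" for n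
    have "x n \<in> ?D" for n
    proof -
      have "Re (ev md.r (pt \<zeta>)) = 0" using that by simp
      then have "Re (ev md.r (pt (fst \<zeta> - \<i> * of_real e, snd \<zeta>))) = - e" for e
        by (simp add: md.ev_r pe)
      then have "Re (ev md.r (pt (x n))) = - inverse (real (Suc n))"
        unfolding x_def .
      then show ?thesis unfolding D by simp
    qed
    moreover have "x \<longlonglongrightarrow> \<zeta>"
    proof -
      have "(\<lambda>n. (fst \<zeta> - \<i> * of_real (inverse (real (Suc n))), snd \<zeta>)) \<longlonglongrightarrow> (fst \<zeta> - \<i> * of_real 0, snd \<zeta>)"
        by (intro tendsto_intros LIMSEQ_inverse_real_of_nat)
      then show ?thesis by (simp add: x_def[abs_def])
    qed
    ultimately show ?thesis unfolding closure_sequential by blast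
  qed
  have frD: "\<zeta> \<in> frontier ?D" if "ev md.r (pt \<zeta>) = 0" for \<zeta>
    using clD[OF that] that oD by (simp add: frontier_def interior_open D)
  obtain a where a: "taylor_at0 ?D Q a" "\<exists>k J K. a k J K \<noteq> 0"
    "\<And>k J K. a k J K \<noteq> 0 \<Longrightarrow> mwt m J + mwt m K - delta m k > 0"
    using assms(10) unfolding wt_pos_def by blast
  have T: "((\<lambda>\<zeta>. (comp Q k \<zeta> - (\<Sum>(J, K)\<in>{(J, K). mdeg J + mdeg K \<le> N}.
     a k J K * wmono J \<zeta> * wmono K (wcnj \<zeta>))) / of_real (norm \<zeta> ^ N)) \<longlongrightarrow> 0) (at 0 within closure ?D)" for k N
    using a(1) unfolding taylor_at0_def by blast
  obtain k1 J1 K1 where k1: "a k1 J1 K1 \<noteq> 0" using a(2) by blast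
  define g where "g = (\<lambda>(k, J, K). mwt m J + mwt m K - delta m k)"
  \<comment> \<open>The expansion may have infinitely many terms; the least weight is attained
    because only finitely many terms do not exceed the weight of a given one.\<close>
  define W where "W = {x. (case x of (k, J, K) \<Rightarrow> a k J K) \<noteq> 0 \<and> g x \<le> g (k1, J1, K1)}"
  have \<delta>1: "delta m k \<le> 1" for k using md.\<delta>_le by (cases k) (auto intro: order_trans[OF md.\<delta>_le])
  have fW: "finite W"
  proof (rule finite_subset)
    show "W \<subseteq> UNIV \<times> {(J, K). mwt m J + mwt m K \<le> g (k1, J1, K1) + 1}"
    proof
      fix x assume "x \<in> W"
      then obtain k J K where x: "x = (k, J, K)" "g (k, J, K) \<le> g (k1, J1, K1)" by (cases x) (auto simp: W_def)
      then show "x \<in> UNIV \<times> {(J, K). mwt m J + mwt m K \<le> g (k1, J1, K1) + 1}"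
        using \<delta>1[of k] by (simp add: g_def)
    qed
  qed (intro finite_cartesian_product finite_weight_le m, simp)
  have W1: "(k1, J1, K1) \<in> W" using k1 by (simp add: W_def)
  define \<mu> where "\<mu> = Min (g ` W)"
  have "\<mu> \<in> g ` W" unfolding \<mu>_def using fW W1 by (intro Min_in) auto
  then obtain k0 J0 K0 where k0: "a k0 J0 K0 \<noteq> 0" "mwt m J0 + mwt m K0 = \<mu> + delta m k0"
    by (auto simp: W_def g_def)
  have \<mu>: "0 < \<mu>" using a(3)[OF k0(1)] k0(2) by simp
  have low: "\<mu> + delta m k \<le> mwt m J + mwt m K" if "a k J K \<noteq> 0" for k J K
  proof -
    have "\<mu> \<le> g (k1, J1, K1)" unfolding \<mu>_def using fW W1 by (intro Min_le) auto
    moreover have "\<mu> \<le> g (k, J, K)" if "g (k, J, K) \<le> g (k1, J1, K1)"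
      unfolding \<mu>_def using fW \<open>a k J K \<noteq> 0\<close> that by (intro Min_le) (auto simp: W_def)
    ultimately show ?thesis by (cases "g (k, J, K) \<le> g (k1, J1, K1)") (auto simp: g_def)
  qed
  \<comment> \<open>Component k is cut at weight \<mu> + \<delta> k, so that the parts form one
    field of weight \<mu>; some of them may be 0.\<close>
  define q where "q k = lead_part m (\<mu> + delta m k) (a k)" for k
  have D0: "0 \<notin> ?D"
  proof -
    have "ev md.r (pt (0 :: complex \<times> (complex^'n))) = 0"
      by (rule whom_ev_0[OF r_tot]) (auto simp: pt_def cv_def split: sum.splits option.splits)
    then show ?thesis unfolding D by simp
  qed
  have Dne: "?D \<noteq> {}" using assms(9) by blast
  have Dscl: "wscale (delta m) n \<zeta> \<in> ?D" if "\<zeta> \<in> ?D" for n \<zeta>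
    using that unfolding D by (simp add: r_scl mult_less_0_iff)
  have qh: "holo (q k)" for k
    unfolding q_def
    by (rule leading_holo[OF m T low oD Dne D0 Dscl]) (use assms(8) in \<open>auto simp: tangential_def\<close>)
  have qf: "field_weight (delta m) \<mu> q"
    unfolding field_weight_def
  proof
    fix k
    show "whom (wh (delta m)) (\<mu> + delta m k) (q k)"
      using whom_leadp[of m "\<mu> + delta m k" "a k"] Eu_wa_holo[OF qh[of k], of "delta m"]
      by (simp add: whom_def Eu_wtot q_def)
  qed
  have q0: "q k0 \<noteq> 0"
  proof
    assume "q k0 = 0"
    moreover have "finite {(J, K). a k0 J K \<noteq> 0 \<and> mwt m J + mwt m K = \<mu> + delta m k0}"
      by (rule finite_subset[OF _ finite_weight_le[OF m, of "\<mu> + delta m k0"]]) auto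
    ultimately have "a k0 J0 K0 = 0"
      using k0 by (intro hm_am_independent[of _ "a k0"]) (auto simp: q_def lead_part_def)
    then show False using k0(1) by simp
  qed
  have qt: "md.tang q"
    unfolding md.tang_def
  proof (rule md.r_dvd)
    fix \<zeta> assume r0: "ev md.r (pt \<zeta>) = 0" and u: "Re (fst \<zeta>) \<noteq> 0"
    define G where "G k = ev (pd (Inl k) md.r) (pt \<zeta>)" for k
    define R where "R = n1 \<zeta> + 1"
    have R: "1 \<le> R" "n1 \<zeta> \<le> R" by (simp_all add: R_def n1_def sum_nonneg)
    have z: "\<zeta> \<noteq> 0" using u by auto
    have s0: "ev md.r (pt (wscale (delta m) n \<zeta>)) = 0" for n
      using ev_scl[OF r_tot, of n \<zeta>] r0 by simp
    have lim: "(\<lambda>n. of_real (exp ((\<mu> + delta m k) * real n)) * comp Q k (wscale (delta m) n \<zeta>)) \<longlonglongrightarrow> ev (q k) (pt \<zeta>)" for k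
    proof (rule LIMSEQ_I)
      fix \<epsilon> :: real assume e: "0 < \<epsilon>"
      from taylor_leading[OF m T[of k] low[where k = k] half_gt_zero[OF e] R(1)]
      obtain n0 where "\<forall>n\<ge>n0. \<forall>\<xi>. wscale (delta m) n \<xi> \<in> closure ?D \<and> \<xi> \<noteq> 0 \<and> n1 \<xi> \<le> R \<longrightarrow>
        norm (of_real (exp ((\<mu> + delta m k) * real n)) * comp Q k (wscale (delta m) n \<xi>) - ev (lead_part m (\<mu> + delta m k) (a k)) (pt \<xi>)) \<le> \<epsilon> / 2" ..
      then have n0: "norm (of_real (exp ((\<mu> + delta m k) * real n)) * comp Q k (wscale (delta m) n \<zeta>) - ev (q k) (pt \<zeta>)) \<le> \<epsilon> / 2"
        if "n \<ge> n0" for n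
        using that clD[OF s0] z R(2) unfolding q_def by blast
      show "\<exists>no. \<forall>n\<ge>no. norm (of_real (exp ((\<mu> + delta m k) * real n)) * comp Q k (wscale (delta m) n \<zeta>) - ev (q k) (pt \<zeta>)) < \<epsilon>"
        using n0 e by (intro exI[of _ n0]) fastforce
    qed
    \<comment> \<open>Dilated boundary points stay on the boundary. There the derivative of r in the
      variable k scales with weight 1 - \<delta> k, so rescaling Q k with \<mu> + \<delta> k takes
      the common factor exp((\<mu> + 1) n) out of the tangency equation.\<close>
    have tan: "Re (\<Sum>k\<in>UNIV. G k * (of_real (exp ((\<mu> + delta m k) * real n)) * comp Q k (wscale (delta m) n \<zeta>))) = 0" for n
    proof -
      define \<xi> where "\<xi> = wscale (delta m) n \<zeta>"
      define L where "L v = Re ((\<Sum>k\<in>UNIV. ev (pd (Inl k) md.r) (pt \<xi>) * cv v k)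
        + (\<Sum>k\<in>UNIV. ev (pd (Inr k) md.r) (pt \<xi>) * cnj (cv v k)))" for v
      have "((\<lambda>\<zeta>. Re (ev md.r (pt \<zeta>))) has_derivative L) (at \<xi>)"
        unfolding L_def by (rule has_derivative_Re[OF ev_pt_has_derivative])
      then have L0: "L (Q \<xi>) = 0"
        using assms(8) frD[OF s0] unfolding tangential_def rf \<xi>_def by blast
      have cQ: "cv (Q \<xi>) k = comp Q k \<xi>" for k by (cases k) (simp_all add: comp_def)
      have cG: "ev (pd (Inr k) md.r) (pt \<xi>) = cnj (ev (pd (Inl k) md.r) (pt \<xi>))" for k
        using pd_C[of k md.r] by (simp add: md.C_r ev_C_pt)
      have "L (Q \<xi>) = 2 * Re (\<Sum>k\<in>UNIV. ev (pd (Inl k) md.r) (pt \<xi>) * comp Q k \<xi>)"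
        unfolding L_def cG cQ by (simp add: sum.distrib)
      then have z0: "Re (\<Sum>k\<in>UNIV. ev (pd (Inl k) md.r) (pt \<xi>) * comp Q k \<xi>) = 0" using L0 by simp
      have Gk: "ev (pd (Inl k) md.r) (pt \<xi>) = of_real (exp (- ((1 - delta m k) * real n))) * G k" for k
        using ev_scl[OF whom_pd_general[OF r_tot, of "Inl k"]] by (simp add: G_def \<xi>_def)
      have "(\<Sum>k\<in>UNIV. G k * (of_real (exp ((\<mu> + delta m k) * real n)) * comp Q k \<xi>))
          = of_real (exp ((\<mu> + 1) * real n)) * (\<Sum>k\<in>UNIV. ev (pd (Inl k) md.r) (pt \<xi>) * comp Q k \<xi>)"
        unfolding Gk sum_distrib_left
      proof (rule sum.cong)
        fix k
        have "exp ((\<mu> + delta m k) * real n) = exp ((\<mu> + 1) * real n) * exp (- ((1 - delta m k) * real n))"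
          by (simp add: mult_exp_exp algebra_simps)
        then show "G k * (of_real (exp ((\<mu> + delta m k) * real n)) * comp Q k \<xi>) =
          of_real (exp ((\<mu> + 1) * real n)) * (of_real (exp (- ((1 - delta m k) * real n))) * G k * comp Q k \<xi>)"
          by simp
      qed simp
      then show ?thesis unfolding \<xi>_def[symmetric] using z0 by simp
    qed
    have "(\<lambda>n. Re (\<Sum>k\<in>UNIV. G k * (of_real (exp ((\<mu> + delta m k) * real n)) * comp Q k (wscale (delta m) n \<zeta>))))
        \<longlonglongrightarrow> Re (\<Sum>k\<in>UNIV. G k * ev (q k) (pt \<zeta>))"
      by (intro tendsto_intros lim)
    then have "Re (\<Sum>k\<in>UNIV. G k * ev (q k) (pt \<zeta>)) = 0" by (simp only: tan LIMSEQ_const_iff)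
    moreover have "ev (D q md.r) (pt \<zeta>) = (\<Sum>k\<in>UNIV. G k * ev (q k) (pt \<zeta>))"
      by (simp add: D_pd G_def mult.commute)
    ultimately have "Re (ev (D q md.r) (pt \<zeta>)) = 0" by simp
    then show "ev (D q md.r + Db q md.r) (pt \<zeta>) = 0"
      unfolding md.C_D_r[symmetric] ev_simps ev_C_pt by (simp add: complex_add_cnj)
  qed
  have P0: "md.P h = 0" if "h \<noteq> 1 / 2" for h
    by (rule md.tangential_imp_balanced[OF qh qf qt \<mu> q0 that])
  show ?thesis
    unfolding balanced_def
  proof (intro ext)
    fix A B
    show "p A B = sig_part m 0 p A B"
    proof (cases "wt m A = 1 / 2")
      case True
      then show ?thesis by (simp add: sig_part_eq[OF assms(3)])
    next
      case False
      let ?c = "\<lambda>A' B'. if wt m A' = wt m A then p A' B' else 0"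
      have "is_poly ?c" using ip unfolding is_poly_def by (rule finite_subset[rotated]) auto
      moreover have "pol_of ?c = 0" using P0[OF False] by (simp add: md.P_def wcomp_pol_of[OF ip])
      ultimately have "?c A B = 0" by (rule pol_of_eq_0)
      then show ?thesis using False by (simp add: sig_part_eq[OF assms(3)])
    qed
  qed
qed

end
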